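(* Let $l\geq 1$ be an odd integer and let $p\ge l^2+3l+5$ be a prime. Then there exists an infinite sequence of pairs of primes $\{(q_j,r_j)\}_{j=1}^{\infty}$ with $p<q_j$, $pq_j<r_j$ and $q_{j+1}>q_j$ for all $j$, such that $$\{a_{pq_jr_j}(k):k\geq 0\}=\Big\{-\frac{p-l-2}{2},-\frac{p-l-2}{2}+1,\dots,\frac{p+l+2}{2}\Big\}$$ (the set of all integers in the interval $[-(p-l-2)/2,(p+l+2)/2]$).
   Context: For a positive integer $n$, the $n$-th cyclotomic polynomial is $\Phi_n(x)=\prod_{1\le j\le n,\ \gcd(j,n)=1}(x-e^{2\pi i j/n})=\sum_{k=0}^{\varphi(n)}a_n(k)x^k$, and $a_n(k)=0$ for $k>\varphi(n)$. *)

theory Defs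
  imports Complex_Main "HOL-Computational_Algebra.Computational_Algebra"
begin

definition cyclotomic_poly :: "nat \<Rightarrow> complex poly" where
  "cyclotomic_poly n =
     (\<Prod>j\<in>{j\<in>{1..n}. coprime j n}. [:- exp (2 * of_real pi * \<i> * of_nat j / of_nat n), 1:])"

text \<open>
  The coefficients are complex numbers by construction; that they are integers is not
  built into the definition.
\<close>

definition cyclotomic_coeff :: "nat \<Rightarrow> nat \<Rightarrow> complex" where
  "cyclotomic_coeff n k = coeff (cyclotomic_poly n) k"

end

theory Submission
  imports "HOL-Number_Theory.Number_Theory" Defs
begin

text \<open>
  From \<open>\<Phi>\<^sub>p\<^sub>q\<^sub>r(x) (1 - x^(p q)) = \<Phi>\<^sub>p\<^sub>q(x^r) (1 + x + \<dots> + x^(p - 1)) (1 - x^q)\<close> and \<open>r > p q\<close> every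
  coefficient of \<open>\<Phi>\<^sub>p\<^sub>q\<^sub>r\<close> is a truncated sum of coefficients of \<open>\<Phi>\<^sub>p\<^sub>q\<close> that depends only on the truncation
  point \<open>N\<close>, on a residue \<open>t\<close> modulo \<open>p q\<close> and on \<open>r\<close> modulo \<open>p q\<close>. For fixed \<open>t\<close> it starts in
  \<open>{-1, 0, 1}\<close> and changes by at most 1 with \<open>N\<close>, so the set of coefficients is an interval around 0.

  Let \<open>\<sigma> = (p + l + 2) / 2\<close> be the inverse of \<open>q\<close> modulo \<open>p\<close> and \<open>\<rho> \<ge> \<sigma>\<close> that of \<open>r\<close>. The sum splits
  into \<open>p\<close> differences, one for each residue \<open>\<beta>\<close> modulo \<open>p\<close>, which lie in \<open>{0, 1}\<close> if \<open>\<beta> < \<sigma>\<close> and in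
  \<open>{-1, 0}\<close> otherwise; hence all coefficients lie in \<open>[\<sigma> - p, \<sigma>]\<close>. Both ends are attained if
  \<open>\<rho> = p - d\<close> with \<open>d (l + 2) \<equiv> \<plusminus>2\<close> modulo \<open>p\<close> (so that \<open>\<rho> \<sigma> \<equiv> \<plusminus>1\<close> and \<open>\<beta>\<close> runs through
  consecutive values) and if the residue of \<open>r\<close> modulo \<open>q\<close> is chosen suitably; the bound on \<open>p\<close> is what
  gives \<open>l + 2 \<le> d \<le> p - \<sigma>\<close>.

  Primes \<open>q\<close> and \<open>r\<close> in the required classes come from Dirichlet's theorem, proved here for squarefree
  moduli by the elementary method of Mertens and Shapiro.
\<close>

section \<open>Sums of the von Mangoldt function\<close>

text \<open>Put \<open>v = p - sg\<close>, where \<open>sg\<close> is the \<sigma> above, so that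
  \<open>sg = v + l + 2\<close>. The p relevant residues have coordinates on a line of slope
  \<open>- \<kappa>\<close>: one step along it changes the exponent
  \<open>\<alpha> * p + \<beta> * q\<close> by \<open>q - \<kappa> * p\<close>, while raising
  \<beta> by \<open>d\<close> changes it by \<open>d * q\<close>. The maximum asks that the part
  below \<open>sg\<close> stays left of \<open>pb\<close>,
  \<open>\<kappa> * p * (sg - 1) \<le> v * q\<close>, and that a cutoff separates it from its raised
  copy, \<open>(q - \<kappa> * p) * (sg - 1) < d * q\<close>. Adding the two yields
  \<open>sg - 1 < v + d\<close>, which is \<open>l + 2 \<le> d\<close>. Conversely, for large q this
  leaves room for \<kappa> near \<open>v * q / ((v + d) * p)\<close>, and the same \<kappa> serves
  the minimum. The condition \<open>d \<le> v\<close> says \<open>sg \<le> \<rho>\<close>, which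
  fixes the sign of each difference. Up to sign, d is the residue of 2/(l + 2) modulo p, so only the
  size of p keeps it away from 0, ..., l + 1: for such d the nonzero number
  \<open>d * (l + 2) - 2 * \<epsilon>\<close> is at most (l + 1)(l + 2) + 2 = l^2 + 3l + 4.
  Dirichlet's theorem is applied to the moduli p and \<open>p * q\<close> alone, whence the
  restriction to squarefree ones.\<close>

lemma real_div_less_Suc_div:
  assumes "d > 0"
  shows "real x / real d < real (x div d) + 1"
proof -
  have "real x < real (d + x div d * d)"
    using dividend_less_div_times[OF assms, of x] by (simp only: of_nat_less_iff)
  thus ?thesis using assms by (simp add: field_simps)
qed

text \<open>Writing n = d * m turns a divisor sum into a sum over lattice points under a hyperbola.
  The estimates for the von Mangoldt sums and for the Lambert series all start this way.\<close>

lemma sum_divisors_swap: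
  fixes f :: "nat \<Rightarrow> nat \<Rightarrow> 'a::comm_monoid_add"
  shows "(\<Sum>n=1..x. \<Sum>d | d dvd n. f d (n div d)) = (\<Sum>d=1..x. \<Sum>m=1..x div d. f d m)"
proof -
  have le: "b \<le> x" if "b * k \<le> x" "0 < k" for b k
    using that by (metis dvd_imp_le dvd_triv_left le_trans mult_eq_0_iff neq0_conv le0)
  have "(\<Sum>n=1..x. \<Sum>d | d dvd n. f d (n div d)) =
      (\<Sum>(n, d)\<in>Sigma {1..x} (\<lambda>n. {d. d dvd n}). f d (n div d))"
    by (rule sum.Sigma) auto
  also have "\<dots> = (\<Sum>(d, m)\<in>Sigma {1..x} (\<lambda>d. {1..x div d}). f d m)"
    by (rule sum.reindex_bij_witness[where i = "\<lambda>(d, m). (d * m, d)" and j = "\<lambda>(n, d). (d, n div d)"])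
       (auto simp: div_le_mono less_eq_div_iff_mult_less_eq mult.commute Suc_le_eq
         dest: dvd_imp_le intro: le elim!: dvdE)
  also have "\<dots> = (\<Sum>d=1..x. \<Sum>m=1..x div d. f d m)"
    by (rule sum.Sigma [symmetric]) auto
  finally show ?thesis .
qed

section \<open>Chebyshev's bound and Mertens' first theorem\<close>

lemma ln_fact_eq_sum_mangoldt:
  "ln (fact x) = (\<Sum>d=1..x. mangoldt d * real (x div d))"
proof -
  have "ln (fact x) = (\<Sum>n=1..x. ln (real n))"
    by (induction x) (simp_all add: ln_mult add.commute)
  also have "\<dots> = (\<Sum>n=1..x. \<Sum>d | d dvd n. mangoldt d)"
    by (intro sum.cong refl) (simp add: mangoldt_sum)
  also have "\<dots> = (\<Sum>d=1..x. \<Sum>m=1..x div d. mangoldt d)"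
    by (rule sum_divisors_swap)
  finally show ?thesis by (simp add: mult.commute)
qed

lemma ln_fact_ge: "real x * ln (real x) - real x \<le> ln (fact x)"
proof (induction x)
  case (Suc x)
  show ?case
  proof (cases "x = 0")
    case False
    hence "ln (1 + 1 / real x) \<le> 1 / real x"
      by (intro ln_add_one_self_le_self) auto
    moreover have "ln (1 + 1 / real x) = ln (real (Suc x)) - ln (real x)"
      using False ln_div[of "real (Suc x)" "real x"] by (simp add: field_simps)
    ultimately have "ln (real (Suc x)) - ln (real x) \<le> 1 / real x"
      by simp
    hence "real x * (ln (real (Suc x)) - ln (real x)) \<le> 1"
      using False by (simp only: pos_le_divide_eq mult.commute)
    moreover have "ln (fact (Suc x)) = ln (real (Suc x)) + ln (fact x)"
      by (simp add: ln_mult del: of_nat_Suc)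
    ultimately show ?thesis using Suc
      by (simp add: algebra_simps)
  qed auto
qed auto

lemma ln_fact_le: "ln (fact x) \<le> real x * ln (real x)"
proof (cases "x = 0")
  case False
  have "ln (fact x :: real) \<le> ln (real x ^ x)"
    using fact_le_power[of x, where ?'a = real] False by (subst ln_le_cancel_iff) auto
  thus ?thesis using False by (simp add: ln_realpow)
qed auto

definition chebyshev_psi :: "nat \<Rightarrow> real" where
  "chebyshev_psi x = (\<Sum>d=1..x. mangoldt d)"

lemma chebyshev_psi_mono: "x \<le> y \<Longrightarrow> chebyshev_psi x \<le> chebyshev_psi y"
  unfolding chebyshev_psi_def by (rule sum_mono2) (auto simp: mangoldt_nonneg)

text \<open>The logarithm of the central binomial coefficient is the sum of
  \<open>mangoldt d\<close> with weights \<open>2 * n div d - 2 * (n div d)\<close>. These weights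
  are nonnegative and equal 1 for n < d \<le> 2n, so the block is at most ln (4^n).\<close>

lemma chebyshev_psi_double: "chebyshev_psi (2 * n) - chebyshev_psi n \<le> 2 * real n"
proof -
  have "chebyshev_psi (2 * n) - chebyshev_psi n = (\<Sum>d=Suc n..2*n. mangoldt d)"
    unfolding chebyshev_psi_def using sum.ub_add_nat[of 1 n "\<lambda>d. mangoldt d :: real" n]
    by (simp add: mult_2)
  also have "\<dots> \<le> (\<Sum>d=1..2*n. mangoldt d * (real (2 * n div d) - 2 * real (n div d)))"
  proof -
    have nn: "0 \<le> mangoldt d * (real (2 * n div d) - 2 * real (n div d))" for d
    proof -
      have "2 * (n div d) \<le> 2 * n div d"
        by (metis div_mult_self1_is_m div_by_0 div_le_mono less_eq_div_iff_mult_less_eq mult.assoc mult.commute mult_is_0 neq0_conv order_refl times_div_less_eq_dividend)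
      thus ?thesis by (auto intro!: mult_nonneg_nonneg mangoldt_nonneg)
    qed
    have "(\<Sum>d=Suc n..2*n. mangoldt d) = 
          (\<Sum>d=Suc n..2*n. mangoldt d * (real (2 * n div d) - 2 * real (n div d)) :: real)"
    proof (intro sum.cong refl)
      fix d assume d: "d \<in> {Suc n..2*n}"
      have "2 * n div d = 1" using d by (intro div_nat_eqI) auto
      thus "mangoldt d = mangoldt d * (real (2 * n div d) - 2 * real (n div d))"
        using d by simp
    qed
    also have "\<dots> \<le> (\<Sum>d=1..2*n. mangoldt d * (real (2 * n div d) - 2 * real (n div d)))"
      by (rule sum_mono2) (use nn in auto)
    finally show ?thesis .
  qed
  also have "\<dots> = ln (fact (2 * n)) - 2 * ln (fact n)"
  proof -
    have "(\<Sum>d=1..2*n. mangoldt d * real (n div d)) = (\<Sum>d=1..n. mangoldt d * real (n div d))"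
      by (rule sum.mono_neutral_right) auto
    moreover have "(\<Sum>d=1..2*n. mangoldt d * (real (2 * n div d) - 2 * real (n div d))) =
        (\<Sum>d=1..2*n. mangoldt d * real (2 * n div d)) - 2 * (\<Sum>d=1..2*n. mangoldt d * real (n div d))"
      by (simp only: right_diff_distrib sum_subtractf sum_distrib_left mult.left_commute)
    ultimately show ?thesis
      by (simp only: ln_fact_eq_sum_mangoldt)
  qed
  also have "\<dots> = ln (real (2 * n choose n))"
    by (simp add: binomial_fact ln_div ln_mult power2_eq_square)
  also have "\<dots> \<le> ln (2 ^ (2 * n))"
  proof -
    have "(2 * n choose n) \<le> 2 ^ (2 * n)" by (rule binomial_le_pow2)
    hence "real (2 * n choose n) \<le> 2 ^ (2 * n)" by (metis of_nat_le_iff of_nat_numeral of_nat_power)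
    thus ?thesis by (subst ln_le_cancel_iff) (auto simp: zero_less_binomial)
  qed
  also have "\<dots> = 2 * real n * ln 2" by (simp add: ln_realpow)
  also have "\<dots> \<le> 2 * real n * 1" using ln_2_less_1 by (intro mult_left_mono) auto
  finally show ?thesis by simp
qed

lemma chebyshev_psi_le: "chebyshev_psi x \<le> 6 * real x"
proof (induction x rule: less_induct)
  case (less x)
  show ?case
  proof (cases "x \<le> 1")
    case True
    hence "x = 0 \<or> x = 1" by auto
    thus ?thesis by (auto simp: chebyshev_psi_def)
  next
    case False
    \<comment> \<open>Rounding up keeps \<open>x \<le> 2 * n\<close>; the constant 6 absorbs the
      loss, since 8n \<le> 4(x + 1) \<le> 6x for x \<ge> 2.\<close>
    define n where "n = (x + 1) div 2"
    have n: "n < x" "x \<le> 2 * n" "2 * n \<le> x + 1" using False by (auto simp: n_def)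
    have "chebyshev_psi x \<le> chebyshev_psi (2 * n)" using n by (intro chebyshev_psi_mono)
    also have "\<dots> \<le> chebyshev_psi n + 2 * real n" using chebyshev_psi_double[of n] by simp
    also have "\<dots> \<le> 8 * real n" using less[OF n(1)] by simp
    also have "\<dots> \<le> 6 * real x" using n False by linarith
    finally show ?thesis .
  qed
qed

text \<open>Replacing \<open>x div d\<close> by x / d in the formula for ln (x!) only increases the
  sum, which gives the lower bound. It increases it by at most \<open>chebyshev_psi x\<close>, which
  is where the constant 6 comes from.\<close>

lemma sum_mangoldt_div_bounds:
  assumes "x > 0"
  shows "ln (real x) - 1 \<le> (\<Sum>d=1..x. mangoldt d / real d)"
    and "(\<Sum>d=1..x. mangoldt d / real d) \<le> ln (real x) + 6"
proof -
  have "real x * ln (real x) - real x \<le> (\<Sum>d=1..x. mangoldt d * real (x div d))"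
    using ln_fact_ge[of x] by (simp add: ln_fact_eq_sum_mangoldt)
  also have "\<dots> \<le> (\<Sum>d=1..x. mangoldt d * (real x / real d))"
    by (intro sum_mono mult_left_mono mangoldt_nonneg of_nat_div_le_of_nat)
  also have "\<dots> = real x * (\<Sum>d=1..x. mangoldt d / real d)"
    by (simp add: sum_distrib_left field_simps)
  finally show "ln (real x) - 1 \<le> (\<Sum>d=1..x. mangoldt d / real d)"
    using mult_le_cancel_left_pos[of "real x" "ln (real x) - 1"] assms by (simp add: right_diff_distrib)
  have "real x * (\<Sum>d=1..x. mangoldt d / real d) = (\<Sum>d=1..x. mangoldt d * (real x / real d))"
    by (simp add: sum_distrib_left field_simps)
  also have "\<dots> \<le> (\<Sum>d=1..x. mangoldt d * (real (x div d) + 1))"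
    by (intro sum_mono mult_left_mono mangoldt_nonneg) (use real_div_less_Suc_div in \<open>auto intro: less_imp_le\<close>)
  also have "\<dots> = ln (fact x) + chebyshev_psi x"
    by (simp add: ln_fact_eq_sum_mangoldt chebyshev_psi_def algebra_simps sum.distrib)
  also have "\<dots> \<le> real x * ln (real x) + 6 * real x"
    using ln_fact_le[of x] chebyshev_psi_le[of x] by simp
  also have "\<dots> = real x * (ln (real x) + 6)" by (simp add: algebra_simps)
  finally show "(\<Sum>d=1..x. mangoldt d / real d) \<le> ln (real x) + 6"
    using assms by simp
qed

text \<open>By ln m \<le> 2 sqrt m the left side is at most 4 / m^(3/2). With u = sqrt m and v =
  sqrt (m - 1) one has u^2 - v^2 = 1, so 1/v - 1/u = 1/(u v (u + v)), which is at least 1/(2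
  u^3).\<close>

lemma ln_div_square_le_telescope:
  fixes m :: nat
  assumes "m \<ge> 2"
  shows "ln (real m) * (2 / real m ^ 2) \<le> 8 * (1 / sqrt (real m - 1) - 1 / sqrt (real m))"
proof -
  define u v where "u = sqrt (real m)" and "v = sqrt (real m - 1)"
  have uv: "u ^ 2 = real m" "v ^ 2 = real m - 1" "0 < v" "v \<le> u" "0 < u"
    using assms by (auto simp: u_def v_def)
  have "ln (real m) = 2 * ln u" using uv(5) by (simp flip: uv(1) add: ln_realpow)
  also have "\<dots> \<le> 2 * u" using ln_le_minus_one[of u] uv(5) by simp
  finally have "ln (real m) \<le> 2 * u" .
  moreover have "real m ^ 2 = u ^ 4" by (simp flip: uv(1) power_mult)
  ultimately have "ln (real m) * (2 / real m ^ 2) \<le> 2 * u * (2 / u ^ 4)"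
    using uv(5) by (intro mult_mono) auto
  also have "\<dots> = 4 / u ^ 3" using uv(5) by (simp add: power_eq_if)
  also have "\<dots> \<le> 8 * (1 / (u * v * (u + v)))"
  proof -
    have "u * v * (u + v) \<le> u * u * (u + u)" using uv by (intro mult_mono add_mono) auto
    hence "8 / (u * u * (u + u)) \<le> 8 / (u * v * (u + v))"
      using uv by (intro divide_left_mono mult_pos_pos) auto
    thus ?thesis using uv(5) by (simp add: power3_eq_cube)
  qed
  also have "1 / (u * v * (u + v)) = (u ^ 2 - v ^ 2) / (u * v * (u + v))" using uv by simp
  also have "\<dots> = ((u - v) * (u + v)) / (u * v * (u + v))"
    by (simp add: power2_eq_square algebra_simps)
  also have "\<dots> = 1 / v - 1 / u" using uv(3,5) by (simp add: diff_divide_distrib)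
  finally show ?thesis by (simp add: u_def v_def)
qed

text \<open>Only proper prime powers contribute. Allowing every base m \<ge> 2, the geometric series
  over the exponents is at most 2 / m^2 and the remaining sum over m telescopes. Since the bound
  does not depend on x, any divergence of the weighted sums must come from primes.\<close>

lemma sum_mangoldt_nonprime_le:
  "(\<Sum>d | d \<in> {1..x} \<and> \<not> prime d. mangoldt d / real d) \<le> 8"
proof -
  define I where "I = {m \<in> {2..x}. prime m} \<times> {2..x}"
  have fin: "finite I" by (auto simp: I_def)
  let ?g = "\<lambda>d. mangoldt d / real d"
  have "(\<Sum>d | d \<in> {1..x} \<and> \<not> prime d. ?g d) = 
        (\<Sum>d | d \<in> {1..x} \<and> \<not> prime d \<and> primepow d. ?g d)"
    by (rule sum.mono_neutral_right) (auto simp: mangoldt_def)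
  also have "\<dots> \<le> sum ?g ((\<lambda>(m, k). m ^ k) ` I)"
  proof (rule sum_mono2)
    show "{d. d \<in> {1..x} \<and> \<not> prime d \<and> primepow d} \<subseteq> (\<lambda>(m, k). m ^ k) ` I"
    proof safe
      fix d :: nat assume d: "d \<in> {1..x}" "\<not> prime d" "primepow d"
      then obtain m k where mk: "prime m" "k > 0" "d = m ^ k" by (auto simp: primepow_def)
      have "k \<noteq> 1" using d mk by auto
      hence "k \<ge> 2" using mk by simp
      have "m \<ge> 2" using mk by (simp add: prime_ge_2_nat)
      have "m \<le> m ^ k" using mk \<open>m \<ge> 2\<close> by (intro self_le_power) auto
      moreover have "k < m ^ k" using \<open>m \<ge> 2\<close> by (intro power_gt_expt) auto
      ultimately have "(m, k) \<in> I" using mk d \<open>k \<ge> 2\<close> \<open>m \<ge> 2\<close> by (auto simp: I_def)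
      thus "d \<in> (\<lambda>(m, k). m ^ k) ` I" using mk by force
    qed
  qed (use fin in \<open>auto intro!: divide_nonneg_nonneg mangoldt_nonneg\<close>)
  also have "\<dots> \<le> sum (?g \<circ> (\<lambda>(m, k). m ^ k)) I"
    by (rule sum_image_le) (use fin in \<open>auto intro!: divide_nonneg_nonneg mangoldt_nonneg\<close>)
  also have "\<dots> = (\<Sum>(m, k)\<in>I. ln (real m) / real m ^ k)"
    by (rule sum.cong) (auto simp: I_def)
  also have "\<dots> = (\<Sum>m | m \<in> {2..x} \<and> prime m. \<Sum>k=2..x. ln (real m) / real m ^ k)"
    unfolding I_def by (subst sum.cartesian_product) (auto simp: conj_commute)
  also have "\<dots> \<le> (\<Sum>m=2..x. \<Sum>k=2..x. ln (real m) / real m ^ k)"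
    by (intro sum_mono2) (auto intro!: sum_nonneg divide_nonneg_nonneg)
  also have "\<dots> \<le> (\<Sum>m=2..x. 8 * (1 / sqrt (real m - 1) - 1 / sqrt (real m)))"
  proof (intro sum_mono)
    fix m assume m: "m \<in> {2..x}"
    \<comment> \<open>The subtracted tail is the strengthening that lets the induction close; it is
      dropped afterwards.\<close>
    have geo: "(\<Sum>k=2..<2+n. 1 / real m ^ k) \<le> 2 / real m ^ 2 - 2 / real m ^ (n + 2)" for n
    proof (induction n)
      case (Suc n)
      have "2 / real m ^ (n + 3) + 1 / real m ^ (n + 2) \<le> 2 / real m ^ (n + 2)"
      proof -
        have "2 / real m ^ (n + 3) = (2 / real m) * (1 / real m ^ (n + 2))"
          by (simp add: power_add power3_eq_cube power2_eq_square)
        also have "\<dots> \<le> 1 * (1 / real m ^ (n + 2))"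
          using m by (intro mult_right_mono) auto
        finally have "2 / real m ^ (n + 3) \<le> 1 / real m ^ (n + 2)" by simp
        moreover have "2 / real m ^ (n + 2) = 2 * (1 / real m ^ (n + 2))" by simp
        ultimately show ?thesis by linarith
      qed
      moreover have "(\<Sum>k=2..<2+Suc n. 1 / real m ^ k) = (\<Sum>k=2..<2+n. 1 / real m ^ k) + 1 / real m ^ (n + 2)"
        by (simp add: add.commute)
      moreover have "Suc n + 2 = n + 3" by simp
      ultimately show ?case using Suc by (simp only:)
    qed (auto simp: power2_eq_square)
    have "(\<Sum>k=2..x. 1 / real m ^ k) = (\<Sum>k=2..<2+(x-1). 1 / real m ^ k)"
      using m by (intro sum.cong) auto
    also have "\<dots> \<le> 2 / real m ^ 2"
      by (rule order.trans[OF geo]) auto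
    finally have "ln (real m) * (\<Sum>k=2..x. 1 / real m ^ k) \<le> ln (real m) * (2 / real m ^ 2)"
      using m by (intro mult_left_mono) auto
    also have "\<dots> \<le> 8 * (1 / sqrt (real m - 1) - 1 / sqrt (real m))"
      using m by (intro ln_div_square_le_telescope) auto
    finally show "(\<Sum>k=2..x. ln (real m) / real m ^ k) \<le> 8 * (1 / sqrt (real m - 1) - 1 / sqrt (real m))"
      by (simp add: sum_distrib_left)
  qed
  also have "\<dots> \<le> 8"
  proof -
    have "(\<Sum>m=2..<2+n. 8 * (1 / sqrt (real m - 1) - 1 / sqrt (real m))) = 8 - 8 / sqrt (real (n + 1))" for n
      by (induction n) (auto simp: algebra_simps)
    from this[of "x - 1"] have "(\<Sum>m=2..<2+(x-1). 8 * (1 / sqrt (real m - 1) - 1 / sqrt (real m))) \<le> 8"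
      by simp
    moreover have "{2..x} = {2..<2+(x-1)}" by (cases x) auto
    ultimately show ?thesis by simp
  qed
  finally show ?thesis .
qed

section \<open>Moebius inversion and Abel summation\<close>

definition moebius :: "nat \<Rightarrow> real" where
  "moebius n = (if squarefree n then (- 1) ^ card (prime_factors n) else 0)"

lemma abs_moebius_le: "\<bar>moebius n\<bar> \<le> 1"
  by (simp add: moebius_def)

lemma moebius_1 [simp]: "moebius (Suc 0) = 1"
  by (simp add: moebius_def)

text \<open>For a prime p dividing n, the squarefree divisors pair up as d and p * d with opposite
  signs.\<close>

lemma moebius_sum:
  assumes "n > 1"
  shows "(\<Sum>d | d dvd n. moebius d) = 0"
proof -
  obtain p where p: "prime p" "p dvd n" using assms prime_factor_nat[of n] by auto
  define A where "A = {d. d dvd n \<and> squarefree d \<and> \<not> p dvd d}"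
  have fin: "finite A" using assms by (auto simp: A_def intro: finite_subset[OF _ finite_divisors_nat[of n]])
  have A: "squarefree d" "\<not> p dvd d" "coprime p d" "d dvd n" "d \<noteq> 0" if "d \<in> A" for d
    using that p assms prime_imp_coprime[of p d] by (auto simp: A_def intro!: Nat.gr0I)
  have "(\<Sum>d | d dvd n. moebius d) = (\<Sum>d | d dvd n \<and> squarefree d. moebius d)"
    using assms by (intro sum.mono_neutral_right) (auto simp: moebius_def)
  also have "{d. d dvd n \<and> squarefree d} = A \<union> (*) p ` A"
  proof (intro equalityI subsetI)
    fix d assume d: "d \<in> {d. d dvd n \<and> squarefree d}"
    show "d \<in> A \<union> (*) p ` A"
    proof (cases "p dvd d")
      case True
      then obtain e where e: "d = p * e" by blast
      have "\<not> p dvd e"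
      proof
        assume "p dvd e"
        hence "p ^ 2 dvd d" by (auto simp: e power2_eq_square)
        thus False using d p by (auto simp: squarefree_def)
      qed
      moreover have "squarefree e" using d e by (auto intro: squarefree_mono[of e d])
      moreover have "e dvd n" using d e by (auto dest: dvd_mult_right)
      ultimately show ?thesis using e by (auto simp: A_def)
    qed (use d in \<open>auto simp: A_def\<close>)
  next
    fix d assume "d \<in> A \<union> (*) p ` A"
    moreover have "p * e dvd n \<and> squarefree (p * e)" if "e \<in> A" for e
      using A[OF that] p by (auto intro: squarefree_mult_coprime divides_mult squarefree_prime)
    ultimately show "d \<in> {d. d dvd n \<and> squarefree d}"
      using A by blast
  qed
  also have "(\<Sum>d\<in>A \<union> (*) p ` A. moebius d) = sum moebius A + sum moebius ((*) p ` A)"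
    using fin by (intro sum.union_disjoint) (auto dest: A(2))
  also have "sum moebius ((*) p ` A) = (\<Sum>d\<in>A. moebius (p * d))"
    using p by (subst sum.reindex) (auto simp: inj_on_def)
  also have "\<dots> = (\<Sum>d\<in>A. - moebius d)"
  proof (intro sum.cong refl)
    fix d assume d: "d \<in> A"
    have "squarefree (p * d)"
      using A[OF d] p by (intro squarefree_mult_coprime) (auto simp: squarefree_prime)
    moreover have "prime_factors (p * d) = insert p (prime_factors d)"
      using p A[OF d] by (subst prime_factors_product) (auto simp: prime_factorization_prime)
    moreover have "p \<notin> prime_factors d" using A[OF d] by auto
    ultimately show "moebius (p * d) = - moebius d"
      using A[OF d] by (simp add: moebius_def)
  qed
  finally show ?thesis by (simp add: sum_negf)
qed

text \<open>Since ln is the divisor sum of \<open>mangoldt\<close>, convolving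
  \<open>moebius\<close> with ln (n / d) returns \<open>mangoldt n\<close>. After splitting ln (n /
  d), the part with ln n vanishes: either ln n = 0 or \<open>moebius_sum\<close> applies.\<close>

lemma moebius_sum_ln:
  assumes "n > 0"
  shows "(\<Sum>d | d dvd n. moebius d * ln (real d)) = - mangoldt n"
proof -
  let ?S = "Sigma {d. d dvd n} (\<lambda>d. {e. e dvd n div d})"
  have fin: "finite {d. d dvd n}" using assms by simp
  have fin2: "finite {e. e dvd n div d}" if "d dvd n" for d
    using assms that by (auto elim!: dvdE)
  have "(\<Sum>d | d dvd n. moebius d * (ln (real n) - ln (real d))) =
        (\<Sum>d | d dvd n. \<Sum>e | e dvd n div d. moebius d * mangoldt e)"
  proof (intro sum.cong refl)
    fix d assume "d \<in> {d. d dvd n}"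
    then obtain k where k: "n = d * k" by auto
    with assms have "d > 0" "k > 0" by auto
    thus "moebius d * (ln (real n) - ln (real d)) = (\<Sum>e | e dvd n div d. moebius d * mangoldt e)"
      by (simp add: k mangoldt_sum ln_mult flip: sum_distrib_left)
  qed
  also have "\<dots> = (\<Sum>(d, e)\<in>?S. moebius d * mangoldt e)"
    using fin fin2 by (intro sum.Sigma) auto
  also have "\<dots> = (\<Sum>(e, d)\<in>?S. moebius d * mangoldt e)"
    by (rule sum.reindex_bij_witness[where i = prod.swap and j = prod.swap])
       (use assms in \<open>auto elim!: dvdE simp: mult_ac\<close>)
  also have "\<dots> = (\<Sum>e | e dvd n. \<Sum>d | d dvd n div e. moebius d * mangoldt e)"
    using fin fin2 by (intro sum.Sigma [symmetric]) auto
  also have "\<dots> = (\<Sum>e | e dvd n. if e = n then mangoldt n else 0)"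
  proof (intro sum.cong refl)
    fix e assume "e \<in> {e. e dvd n}"
    then obtain k where k: "n = e * k" by auto
    with assms have "e > 0" "k > 0" by auto
    show "(\<Sum>d | d dvd n div e. moebius d * mangoldt e) = (if e = n then mangoldt n else 0)"
    proof (cases "k = 1")
      case False
      thus ?thesis using moebius_sum[of k] \<open>e > 0\<close> \<open>k > 0\<close> by (simp add: k flip: sum_distrib_right)
    qed (use \<open>e > 0\<close> in \<open>simp add: k\<close>)
  qed
  also have "\<dots> = mangoldt n" using fin by simp
  also have "(\<Sum>d | d dvd n. moebius d * (ln (real n) - ln (real d))) =
     ln (real n) * (\<Sum>d | d dvd n. moebius d) - (\<Sum>d | d dvd n. moebius d * ln (real d))"
    by (simp add: algebra_simps sum_subtractf sum_distrib_left)
  also have "ln (real n) * (\<Sum>d | d dvd n. moebius d) = 0"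
    using moebius_sum[of n] assms by (cases "n = 1") auto
  finally show ?thesis by simp
qed

text \<open>Abel summation: the partial sums of c are multiplied by the nonnegative differences
  \<open>b k - b (Suc k)\<close>, which telescope.\<close>

lemma norm_sum_antimono_mult_le:
  fixes c :: "nat \<Rightarrow> 'a::real_normed_vector" and b :: "nat \<Rightarrow> real"
  assumes C: "\<And>n. norm (\<Sum>k=a..n. c k) \<le> C"
    and b: "\<And>k. a \<le> k \<Longrightarrow> b (Suc k) \<le> b k" "\<And>k. a \<le> k \<Longrightarrow> 0 \<le> b k"
    and "a \<le> n"
  shows "norm (\<Sum>k=a..n. b k *\<^sub>R c k) \<le> C * b a"
proof -
  define S where "S = (\<lambda>n. \<Sum>k=a..n. c k)"
  have "(\<Sum>k=a..n. b k *\<^sub>R c k) = b n *\<^sub>R S n + (\<Sum>k=a..<n. (b k - b (Suc k)) *\<^sub>R S k)"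
    using \<open>a \<le> n\<close> by (induction n rule: dec_induct) (auto simp: S_def algebra_simps)
  also have "norm \<dots> \<le> norm (b n *\<^sub>R S n) + (\<Sum>k=a..<n. norm ((b k - b (Suc k)) *\<^sub>R S k))"
    by (intro norm_triangle_mono order.refl norm_sum)
  also have "\<dots> \<le> b n * C + (\<Sum>k=a..<n. (b k - b (Suc k)) * C)"
    using b C \<open>a \<le> n\<close> by (intro add_mono sum_mono) (auto simp: S_def intro!: mult_left_mono)
  also have "(\<Sum>k=a..<n. (b k - b (Suc k)) * C) = (b a - b n) * C"
    using \<open>a \<le> n\<close> sum_Suc_diff'[of a n b]
    by (simp flip: sum_distrib_right add: sum_subtractf)
  also have "b n * C + \<dots> = C * b a" by (simp add: algebra_simps)
  finally show ?thesis .
qed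

section \<open>Dirichlet characters\<close>

definition dchar :: "nat \<Rightarrow> (nat \<Rightarrow> complex) \<Rightarrow> bool" where
  "dchar N \<chi> \<longleftrightarrow> \<chi> 1 = 1 \<and> (\<forall>a b. \<chi> (a * b) = \<chi> a * \<chi> b) \<and> (\<forall>a. \<chi> (a mod N) = \<chi> a) \<and>
     (\<forall>a. \<chi> a = 0 \<longleftrightarrow> \<not> coprime a N)"

definition principal_dchar :: "nat \<Rightarrow> nat \<Rightarrow> complex" where
  "principal_dchar N a = of_bool (coprime a N)"

lemma dcharD:
  assumes "dchar N \<chi>"
  shows "\<chi> (Suc 0) = 1" "\<chi> (a * b) = \<chi> a * \<chi> b" "\<chi> (a mod N) = \<chi> a" "\<chi> a = 0 \<longleftrightarrow> \<not> coprime a N"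
  using assms by (auto simp: dchar_def)

lemma dchar_cong:
  assumes "dchar N \<chi>" "[a = b] (mod N)"
  shows "\<chi> a = \<chi> b"
  using dcharD(3)[OF assms(1)] assms(2) by (metis cong_def)

lemma dchar_power:
  assumes "dchar N \<chi>"
  shows "\<chi> (a ^ k) = \<chi> a ^ k"
  by (induction k) (simp_all add: dcharD[OF assms])

lemma dchar_principal: "dchar N (principal_dchar N)"
  by (cases "N = 0") (auto simp: dchar_def principal_dchar_def)

lemma dchar_power_totient:
  assumes "dchar N \<chi>" "coprime a N"
  shows "\<chi> a ^ totient N = 1"
proof -
  have "[a ^ totient N = 1] (mod N)"
    using assms by (intro euler_theorem)
  from dchar_cong[OF assms(1) this] show ?thesis
    by (simp add: dchar_power[OF assms(1)] dcharD(1)[OF assms(1)])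
qed

lemma norm_dchar:
  assumes "dchar N \<chi>" "N > 0"
  shows "norm (\<chi> a) = of_bool (coprime a N)"
proof (cases "coprime a N")
  case True
  have "norm (\<chi> a) ^ totient N = 1"
    using dchar_power_totient[OF assms(1) True] by (metis norm_one norm_power)
  thus ?thesis using True assms power_eq_imp_eq_base[of "norm (\<chi> a)" "totient N" 1] by simp
qed (use dcharD(4)[OF assms(1)] in auto)

lemma norm_dchar_le_1:
  assumes "dchar N \<chi>" "N > 0"
  shows "norm (\<chi> a) \<le> 1"
  by (simp add: norm_dchar[OF assms])

lemma dchar_mult_cnj:
  assumes "dchar N \<chi>" "N > 0"
  shows "\<chi> a * cnj (\<chi> a) = of_bool (coprime a N)"
  using norm_dchar[OF assms, of a] by (simp flip: complex_norm_square)

lemma dchar_mult: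
  assumes "dchar N \<chi>" "dchar N \<psi>"
  shows "dchar N (\<lambda>a. \<chi> a * \<psi> a)"
  using assms by (auto simp: dchar_def)

lemma dchar_cnj:
  assumes "dchar N \<chi>"
  shows "dchar N (\<lambda>a. cnj (\<chi> a))"
  using assms by (auto simp: dchar_def)

text \<open>A character is determined by its values on 0, ..., N - 1, and each value is 0 or a root
  of unity of order dividing \<open>totient N\<close>.\<close>

lemma finite_dchars:
  assumes "N > 0"
  shows "finite {\<chi>. dchar N \<chi>}"
proof -
  define R where "R = insert 0 {z::complex. z ^ totient N = 1}"
  have "finite R" using assms by (simp add: R_def finite_roots_unity Suc_le_eq)
  hence "finite ({..<N} \<rightarrow>\<^sub>E R)" by (intro finite_PiE) auto
  moreover have "(\<lambda>\<chi>. restrict \<chi> {..<N}) ` {\<chi>. dchar N \<chi>} \<subseteq> {..<N} \<rightarrow>\<^sub>E R"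
  proof (intro image_subsetI)
    fix \<chi> assume "\<chi> \<in> {\<chi>. dchar N \<chi>}"
    hence "\<chi> a \<in> R" for a
      using dcharD(4)[of N \<chi> a] dchar_power_totient[of N \<chi> a] by (auto simp: R_def)
    thus "restrict \<chi> {..<N} \<in> {..<N} \<rightarrow>\<^sub>E R" by (simp add: restrict_PiE_iff)
  qed
  ultimately have "finite ((\<lambda>\<chi>. restrict \<chi> {..<N}) ` {\<chi>. dchar N \<chi>})"
    by (rule finite_subset[rotated])
  moreover have "inj_on (\<lambda>\<chi>. restrict \<chi> {..<N}) {\<chi>. dchar N \<chi>}"
  proof (rule inj_onI, rule ext)
    fix \<chi> \<psi> a
    assume "\<chi> \<in> {\<chi>. dchar N \<chi>}" "\<psi> \<in> {\<chi>. dchar N \<chi>}"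
      and *: "restrict \<chi> {..<N} = restrict \<psi> {..<N}"
    hence "dchar N \<chi>" "dchar N \<psi>" by auto
    moreover have "\<chi> (a mod N) = \<psi> (a mod N)"
      using fun_cong[OF *, of "a mod N"] assms by simp
    ultimately show "\<chi> a = \<psi> a" by (simp add: dcharD(3))
  qed
  ultimately show ?thesis by (rule finite_imageD)
qed

lemma sum_lessThan_add:
  fixes f :: "nat \<Rightarrow> 'a::comm_monoid_add"
  shows "(\<Sum>k<m+n. f k) = (\<Sum>k<m. f k) + (\<Sum>k<n. f (m + k))"
  by (induction n) (simp_all add: add.assoc)

text \<open>Multiplication by some b coprime to N with \<open>\<chi> b \<noteq> 1\<close> permutes
  the residues and scales the sum by \<open>\<chi> b\<close>.\<close>

lemma sum_dchar_period:
  assumes "dchar N \<chi>" "\<chi> \<noteq> principal_dchar N" "N > 0"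
  shows "(\<Sum>k<N. \<chi> k) = 0"
proof -
  obtain b where b: "\<chi> b \<noteq> principal_dchar N b" using assms(2) by blast
  have cop: "coprime b N" "\<chi> b \<noteq> 1"
    using b dcharD(4)[OF assms(1), of b] by (auto simp: principal_dchar_def split: if_splits)
  have inj: "inj_on (\<lambda>k. b * k mod N) {..<N}"
  proof (rule inj_onI)
    fix x y assume xy: "x \<in> {..<N}" "y \<in> {..<N}" "b * x mod N = b * y mod N"
    hence "[x = y] (mod N)"
      using cop(1) by (metis cong_def cong_mult_lcancel_nat)
    thus "x = y" using xy by (simp add: cong_def)
  qed
  have bij: "bij_betw (\<lambda>k. b * k mod N) {..<N} {..<N}"
    unfolding bij_betw_def using inj assms(3) by (intro conjI endo_inj_surj) auto
  have "(\<Sum>k<N. \<chi> k) = (\<Sum>k<N. \<chi> (b * k mod N))"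
    by (rule sum.reindex_bij_betw[OF bij, symmetric])
  also have "\<dots> = \<chi> b * (\<Sum>k<N. \<chi> k)"
    by (simp add: dcharD[OF assms(1)] sum_distrib_left)
  finally show ?thesis using cop(2) by (metis mult_cancel_right1)
qed

text \<open>Complete periods cancel. The interval is a difference of two initial segments, each of
  which leaves fewer than N terms of norm at most 1.\<close>

lemma norm_sum_dchar_le:
  assumes "dchar N \<chi>" "\<chi> \<noteq> principal_dchar N" "N > 0"
  shows "norm (\<Sum>k=a..n. \<chi> k) \<le> 2 * real N"
proof -
  have period: "(\<Sum>k<N*q+r. \<chi> k) = (\<Sum>k<r. \<chi> k)" for q r
  proof (induction q)
    case (Suc q)
    have "(\<Sum>k<N * Suc q + r. \<chi> k) = (\<Sum>k<N + (N*q+r). \<chi> k)" by (simp add: algebra_simps)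
    also have "\<dots> = (\<Sum>k<N*q+r. \<chi> (N + k))"
      by (subst sum_lessThan_add) (simp add: sum_dchar_period[OF assms])
    also have "\<dots> = (\<Sum>k<N*q+r. \<chi> k)"
      by (intro sum.cong refl dchar_cong[OF assms(1)]) (simp add: cong_def)
    finally show ?case using Suc by simp
  qed auto
  have bound: "norm (\<Sum>k<m. \<chi> k) \<le> real N" for m
  proof -
    have "(\<Sum>k<m. \<chi> k) = (\<Sum>k<m mod N. \<chi> k)"
      using period[of "m div N" "m mod N"] by simp
    also have "norm \<dots> \<le> (\<Sum>k<m mod N. 1)"
      by (intro sum_norm_le norm_dchar_le_1[OF assms(1,3)])
    also have "\<dots> \<le> real N" using assms(3) by (simp add: less_imp_le)
    finally show ?thesis .
  qed
  show ?thesis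
  proof (cases "a \<le> n")
    case True
    have "(\<Sum>k=a..n. \<chi> k) = (\<Sum>k<Suc n. \<chi> k) - (\<Sum>k<a. \<chi> k)"
    proof -
      have "{..<Suc n} = {..<a} \<union> {a..n}" using True by auto
      moreover have "sum \<chi> ({..<a} \<union> {a..n}) = (\<Sum>k<a. \<chi> k) + (\<Sum>k=a..n. \<chi> k)"
        by (rule sum.union_disjoint) auto
      ultimately show ?thesis by (simp del: sum.lessThan_Suc)
    qed
    also have "norm \<dots> \<le> real N + real N"
      by (intro norm_triangle_le_diff add_mono bound)
    finally show ?thesis by simp
  qed auto
qed

text \<open>
  For a squarefree modulus, separating residues by characters reduces
  to primitive roots modulo primes.
\<close>

lemma exists_dchar_neq_1:
  assumes "squarefree N" "coprime a N" "\<not> [a = 1] (mod N)"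
  shows "\<exists>\<chi>. dchar N \<chi> \<and> \<chi> a \<noteq> 1"
proof -
  have N: "N > 0" using assms(1) by (intro Nat.gr0I) auto
  have "\<exists>p. prime p \<and> p dvd N \<and> \<not> [a = 1] (mod p)"
  proof (rule ccontr)
    assume "\<not> ?thesis"
    hence *: "[a = 1] (mod p)" if "prime p" "p dvd N" for p using that by blast
    have "[a = 1] (mod (\<Prod>p\<in>prime_factors N. p))"
      by (intro cong_cong_prod_coprime_nat ballI *)
         (auto intro: primes_coprime in_prime_factors_imp_prime in_prime_factors_imp_dvd)
    moreover have "N = (\<Prod>p\<in>prime_factors N. p ^ multiplicity p N)"
      using N by (rule prime_factorization_nat)
    moreover have "(\<Prod>p\<in>prime_factors N. p ^ multiplicity p N) = (\<Prod>p\<in>prime_factors N. p)"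
      using assms(1) N by (intro prod.cong refl) (auto simp: squarefree_factorial_semiring')
    ultimately show False using assms(3) by simp
  qed
  then obtain p where p: "prime p" "p dvd N" "\<not> [a = 1] (mod p)" by blast
  obtain g where g: "residue_primroot p g"
    using p prime_primitive_root_exists[of p] prime_gt_1_nat by blast
  define m where "m = totient p"
  have m: "m > 0" "ord p g = m" "coprime p g"
    using g p by (auto simp: m_def residue_primroot_def prime_gt_0_nat)
  have bij: "bij_betw (\<lambda>i. g ^ i mod p) {..<m} (totatives p)"
    using residue_primroot_is_generator[OF prime_gt_1_nat[OF p(1)] g] by (simp add: m_def)
  have ex: "\<exists>i. [g ^ i = x] (mod p) \<and> i < m" if "coprime x N" for x
  proof -
    have "\<not> p dvd x" using that p by (metis coprime_common_divisor not_prime_unit)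
    hence "x mod p \<in> totatives p" using p
      by (auto simp: totatives_def prime_gt_0_nat coprime_commute prime_imp_coprime mod_greater_zero_iff_not_dvd less_imp_le)
    then obtain i where "i < m" "g ^ i mod p = x mod p"
      using bij by (metis (no_types, lifting) bij_betw_imp_surj_on imageE lessThan_iff)
    thus ?thesis by (auto simp: cong_def)
  qed
  \<comment> \<open>The discrete logarithm to the base g modulo p.\<close>
  define ind where "ind x = (SOME i. [g ^ i = x] (mod p) \<and> i < m)" for x
  have ind: "[g ^ ind x = x] (mod p)" "ind x < m" if "coprime x N" for x
    using someI_ex[OF ex[OF that]] by (auto simp: ind_def)
  define \<omega> where "\<omega> = cis (2 * pi / real m)"
  have \<omega>m: "\<omega> ^ m = 1" using m by (simp add: \<omega>_def DeMoivre)
  have \<omega>_cong: "\<omega> ^ i = \<omega> ^ j" if "[i = j] (mod m)" for i j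
  proof -
    have red: "\<omega> ^ i = \<omega> ^ (i mod m)" for i
    proof -
      have "\<omega> ^ i = \<omega> ^ (m * (i div m) + i mod m)" by simp
      also have "\<dots> = \<omega> ^ (i mod m)" by (simp only: power_add power_mult \<omega>m) simp
      finally show ?thesis .
    qed
    show ?thesis using red[of i] red[of j] that by (simp add: cong_def)
  qed
  have ind_eq: "[i = ind x] (mod m)" if "coprime x N" "[g ^ i = x] (mod p)" for i x
  proof -
    have "[g ^ i = g ^ ind x] (mod p)" using ind(1)[OF that(1)] that(2) by (metis cong_sym cong_trans)
    thus ?thesis using order_divides_expdiff[of p g i "ind x"] m by simp
  qed
  \<comment> \<open>A character modulo p induced to the modulus N: nonzero values depend on x modulo
    p only, but zeros are placed at everything not coprime to N.\<close>
  define \<chi> where "\<chi> x = (if coprime x N then \<omega> ^ ind x else 0)" for x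
  have "dchar N \<chi>"
    unfolding dchar_def
  proof (intro conjI allI)
    have "[0 = ind 1] (mod m)" by (rule ind_eq) auto
    from \<omega>_cong[OF this] show "\<chi> 1 = 1" by (simp add: \<chi>_def)
    show "\<chi> (x * y) = \<chi> x * \<chi> y" for x y
    proof (cases "coprime x N \<and> coprime y N")
      case True
      have "[ind x + ind y = ind (x * y)] (mod m)"
        using True ind(1)[of x] ind(1)[of y] by (intro ind_eq) (auto simp: power_add intro: cong_mult)
      from \<omega>_cong[OF this] show ?thesis using True by (simp add: \<chi>_def power_add)
    qed (auto simp: \<chi>_def)
    show "\<chi> (x mod N) = \<chi> x" for x
    proof (cases "coprime x N")
      case True
      hence c: "coprime (x mod N) N" using N by simp
      have "[g ^ ind (x mod N) = x] (mod p)"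
        using ind(1)[OF c] p by (metis cong_def mod_mod_cancel)
      from \<omega>_cong[OF ind_eq[OF True this]] show ?thesis using True c by (simp add: \<chi>_def)
    qed (use N in \<open>auto simp: \<chi>_def\<close>)
    show "\<chi> x = 0 \<longleftrightarrow> \<not> coprime x N" for x
      by (auto simp: \<chi>_def \<omega>_def)
  qed
  moreover have "\<chi> a \<noteq> 1"
  proof
    assume "\<chi> a = 1"
    hence "cis (2 * pi * real (ind a) / real m) = cis (2 * pi * real 0 / real m)"
      using assms(2) by (simp add: \<chi>_def \<omega>_def DeMoivre mult.commute)
    hence "ind a = 0"
      using bij_betw_roots_unity[OF m(1)] ind(2)[OF assms(2)] m(1)
      by (auto simp: bij_betw_def inj_on_def)
    thus False using ind(1)[OF assms(2)] p(3) by (simp add: cong_sym_eq)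
  qed
  ultimately show ?thesis by blast
qed

text \<open>Orthogonality: multiplication by a character \<psi> with
  \<open>\<psi> a \<noteq> 1\<close> permutes all characters and scales the sum. Its inverse is
  multiplication by the conjugate, because \<psi> has norm 1 wherever the characters do not
  vanish.\<close>

lemma sum_dchars:
  assumes "squarefree N" "coprime a N"
  shows "(\<Sum>\<chi> | dchar N \<chi>. \<chi> a) = (if [a = 1] (mod N) then of_nat (card {\<chi>. dchar N \<chi>}) else 0)"
proof (cases "[a = 1] (mod N)")
  case True
  hence "\<chi> a = 1" if "dchar N \<chi>" for \<chi>
    using dchar_cong[OF that True] dcharD(1)[OF that] by simp
  hence "(\<Sum>\<chi> | dchar N \<chi>. \<chi> a) = (\<Sum>\<chi> | dchar N \<chi>. 1)" by (intro sum.cong) auto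
  thus ?thesis using True by simp
next
  case False
  have N: "N > 0" using assms(1) by (intro Nat.gr0I) auto
  obtain \<psi> where \<psi>: "dchar N \<psi>" "\<psi> a \<noteq> 1"
    using exists_dchar_neq_1[OF assms False] by blast
  have cancel: "\<psi> x * (cnj (\<psi> x) * \<chi> x) = \<chi> x" "cnj (\<psi> x) * (\<psi> x * \<chi> x) = \<chi> x" if "dchar N \<chi>" for \<chi> x
    using dchar_mult_cnj[OF \<psi>(1) N, of x] dcharD(4)[OF that, of x]
    by (auto simp flip: mult.assoc simp: mult.commute[of "cnj (\<psi> x)"])
  have "(\<Sum>\<chi> | dchar N \<chi>. \<chi> a) = (\<Sum>\<chi> | dchar N \<chi>. \<psi> a * \<chi> a)"
    by (rule sum.reindex_bij_witness[where i = "\<lambda>\<chi> x. \<psi> x * \<chi> x" and j = "\<lambda>\<chi> x. cnj (\<psi> x) * \<chi> x"])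
       (auto simp: cancel intro!: dchar_mult \<psi> dchar_cnj)
  also have "\<dots> = \<psi> a * (\<Sum>\<chi> | dchar N \<chi>. \<chi> a)" by (simp add: sum_distrib_left)
  finally show ?thesis using \<psi>(2) False by (metis mult_cancel_right1)
qed

section \<open>Values of L-functions at 1\<close>

text \<open>The function ln t / t decreases only beyond e, hence the start at 3; the terms before
  that are treated separately when Abel summation is applied.\<close>

lemma ln_over_id_antimono:
  fixes k :: nat
  assumes "k \<ge> 3"
  shows "ln (real (Suc k)) / real (Suc k) \<le> ln (real k) / real k"
proof -
  have "1 = ln (exp 1 :: real)" by simp
  also have "\<dots> \<le> ln (real k)" using exp_le assms by (subst ln_le_cancel_iff) auto
  finally have 1: "1 \<le> ln (real k)" .
  have "ln (real (Suc k)) - ln (real k) = ln (1 + 1 / real k)"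
    using assms ln_div[of "real (Suc k)" "real k"] by (simp add: field_simps)
  also have "\<dots> \<le> 1 / real k" using assms by (intro ln_add_one_self_le_self) auto
  finally have "real k * (ln (real (Suc k)) - ln (real k)) \<le> 1"
    using assms by (simp only: pos_le_divide_eq mult.commute)
  hence "real k * ln (real (Suc k)) \<le> real (Suc k) * ln (real k)"
    using 1 by (simp add: algebra_simps)
  thus ?thesis using assms by (simp add: divide_simps mult.commute del: of_nat_Suc)
qed

locale nonprincipal_dchar =
  fixes N :: nat and \<chi> :: "nat \<Rightarrow> complex"
  assumes dchar: "dchar N \<chi>" and nonprincipal: "\<chi> \<noteq> principal_dchar N" and N_pos: "N > 0"
begin

definition P :: "nat \<Rightarrow> complex" where "P x = (\<Sum>n=1..x. \<chi> n / of_nat n)"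
definition L :: complex where "L = lim P"
definition S :: "nat \<Rightarrow> complex" where "S x = (\<Sum>n=1..x. \<chi> n * mangoldt n / of_nat n)"

lemma norm_P_diff_le:
  assumes "x \<le> y"
  shows "norm (P y - P x) \<le> 2 * real N / real (x + 1)"
proof (cases "x = y")
  case False
  have "P y - P x = (\<Sum>n=Suc x..y. \<chi> n / of_nat n)"
  proof -
    have "{1..y} = {1..x} \<union> {Suc x..y}" using assms by auto
    hence "P y = P x + (\<Sum>n=Suc x..y. \<chi> n / of_nat n)"
      unfolding P_def by (simp add: sum.union_disjoint)
    thus ?thesis by simp
  qed
  also have "\<dots> = (\<Sum>n=Suc x..y. (1 / real n) *\<^sub>R \<chi> n)"
    by (simp add: scaleR_conv_of_real)
  also have "norm \<dots> \<le> 2 * real N * (1 / real (Suc x))"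
    using assms False norm_sum_dchar_le[OF dchar nonprincipal N_pos]
    by (intro norm_sum_antimono_mult_le) (auto simp: field_simps)
  finally show ?thesis by simp
qed auto

lemma P_tendsto_L: "P \<longlonglongrightarrow> L"
proof -
  have "Cauchy P"
  proof (rule CauchyI')
    fix e :: real assume e: "e > 0"
    obtain M :: nat where M: "2 * real N / e < real M" using reals_Archimedean2 by blast
    show "\<exists>M. \<forall>m\<ge>M. \<forall>n>m. dist (P m) (P n) < e"
    proof (intro exI[of _ M] allI impI)
      fix m n assume mn: "M \<le> m" "m < n"
      have "dist (P m) (P n) \<le> 2 * real N / real (m + 1)"
        using norm_P_diff_le[of m n] mn by (simp add: dist_norm norm_minus_commute)
      also have "\<dots> < e"
      proof -
        have "2 * real N < e * real M" using M e by (simp add: field_simps)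
        also have "\<dots> \<le> e * real (m + 1)" using mn e by (intro mult_left_mono) auto
        finally show ?thesis by (simp add: field_simps)
      qed
      finally show "dist (P m) (P n) < e" .
    qed
  qed
  thus ?thesis unfolding L_def by (simp add: Cauchy_convergent_iff convergent_LIMSEQ_iff)
qed

lemma norm_L_diff_le: "norm (L - P x) \<le> 2 * real N / real (x + 1)"
proof (rule Lim_bounded)
  show "(\<lambda>y. norm (P y - P x)) \<longlonglongrightarrow> norm (L - P x)"
    by (intro tendsto_intros P_tendsto_L)
  show "\<forall>y\<ge>x. norm (P y - P x) \<le> 2 * real N / real (x + 1)"
    using norm_P_diff_le by blast
qed

text \<open>The tail of the series at \<open>x div d\<close> is bounded linearly in d / x, because x
  < d (\<open>x div d\<close> + 1). This factor d cancels the 1 / d in the sums over d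
  below.\<close>

lemma norm_L_diff_div_le:
  assumes "x > 0" "d > 0"
  shows "norm (L - P (x div d)) \<le> 2 * real N * real d / real x"
proof -
  have "real x \<le> real d * real (x div d + 1)"
    using real_div_less_Suc_div[OF assms(2), of x] assms by (simp add: field_simps)
  hence "2 * real N / real (x div d + 1) \<le> 2 * real N * real d / real x"
    using assms mult_left_mono[of "real x" "real d * real (x div d + 1)" "2 * real N"]
    by (simp add: field_simps del: of_nat_add of_nat_Suc)
  thus ?thesis using norm_L_diff_le[of "x div d"] by linarith
qed

lemma sum_ln_bounded:
  "norm (\<Sum>n=1..x. \<chi> n * of_real (ln (real n)) / of_nat n) \<le> 1 + 2 * real N * ln 3"
proof -
  let ?f = "\<lambda>n. \<chi> n * of_real (ln (real n)) / of_nat n"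
  have "(\<Sum>n=1..x. ?f n) = (\<Sum>n\<in>{2..min x 2}. ?f n) + (\<Sum>n=3..x. ?f n)"
  proof -
    have "(\<Sum>n=1..x. ?f n) = (\<Sum>n\<in>{2..min x 2} \<union> {3..x}. ?f n)"
    proof (rule sum.mono_neutral_right)
      show "\<forall>n\<in>{1..x} - ({2..min x 2} \<union> {3..x}). ?f n = 0"
      proof
        fix n assume "n \<in> {1..x} - ({2..min x 2} \<union> {3..x})"
        hence "n = 1" by auto
        thus "?f n = 0" by simp
      qed
    qed auto
    also have "\<dots> = (\<Sum>n\<in>{2..min x 2}. ?f n) + (\<Sum>n=3..x. ?f n)"
      by (rule sum.union_disjoint) auto
    finally show ?thesis .
  qed
  also have "norm \<dots> \<le> 1 + 2 * real N * ln 3"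
  proof (intro norm_triangle_le add_mono)
    show "norm (\<Sum>n\<in>{2..min x 2}. ?f n) \<le> 1"
    proof (cases "x \<ge> 2")
      case True
      have "norm (?f 2) = norm (\<chi> 2) * ln 2 / 2" by (simp add: norm_mult norm_divide)
      also have "\<dots> \<le> 1 * 1 / 2"
        using norm_dchar_le_1[OF dchar N_pos, of 2] ln_2_less_1
        by (intro divide_right_mono mult_mono) auto
      finally show ?thesis using True by simp
    qed auto
    show "norm (\<Sum>n=3..x. ?f n) \<le> 2 * real N * ln 3"
    proof (cases "x \<ge> 3")
      case True
      have "(\<Sum>n=3..x. ?f n) = (\<Sum>n=3..x. (ln (real n) / real n) *\<^sub>R \<chi> n)"
        by (simp add: scaleR_conv_of_real mult_ac)
      also have "norm \<dots> \<le> 2 * real N * (ln (real 3) / real 3)"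
        using True norm_sum_dchar_le[OF dchar nonprincipal N_pos]
        by (intro norm_sum_antimono_mult_le ln_over_id_antimono) auto
      also have "\<dots> \<le> 2 * real N * ln 3" by (intro mult_left_mono) auto
      finally show ?thesis .
    qed auto
  qed
  finally show ?thesis .
qed

text \<open>Expanding ln as a divisor sum of \<open>mangoldt\<close> turns the bounded sum of
  \<open>sum_ln_bounded\<close> into a sum with inner factors \<open>P (x div d)\<close>. Replacing
  these by L costs at most 2N * \<open>chebyshev_psi x\<close> / x \<le> 12N. So S is bounded as
  soon as L is nonzero.\<close>

lemma norm_L_mult_S_le: "norm (L * S x) \<le> 1 + 2 * real N * ln 3 + 12 * real N"
proof (cases "x = 0")
  case False
  have "(\<Sum>n=1..x. \<chi> n * of_real (ln (real n)) / of_nat n) =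
        (\<Sum>n=1..x. \<Sum>d | d dvd n. (\<chi> d * mangoldt d / of_nat d) * (\<chi> (n div d) / of_nat (n div d)))"
  proof (intro sum.cong refl)
    fix n assume n: "n \<in> {1..x}"
    have "\<chi> n * of_real (ln (real n)) / of_nat n = (\<Sum>d | d dvd n. \<chi> n * mangoldt d / of_nat n)"
      using n by (simp add: mangoldt_sum flip: sum_distrib_left sum_divide_distrib)
    also have "\<dots> = (\<Sum>d | d dvd n. (\<chi> d * mangoldt d / of_nat d) * (\<chi> (n div d) / of_nat (n div d)))"
      by (intro sum.cong refl) (use n in \<open>auto elim!: dvdE simp: dcharD[OF dchar]\<close>)
    finally show "\<chi> n * of_real (ln (real n)) / of_nat n = \<dots>" .
  qed
  also have "\<dots> = (\<Sum>d=1..x. \<Sum>m=1..x div d. (\<chi> d * mangoldt d / of_nat d) * (\<chi> m / of_nat m))"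
    by (rule sum_divisors_swap)
  also have "\<dots> = (\<Sum>d=1..x. (\<chi> d * mangoldt d / of_nat d) * P (x div d))"
    by (simp add: P_def sum_distrib_left)
  finally have eq: "L * S x = (\<Sum>n=1..x. \<chi> n * of_real (ln (real n)) / of_nat n) +
      (\<Sum>d=1..x. (\<chi> d * mangoldt d / of_nat d) * (L - P (x div d)))"
    by (simp add: S_def right_diff_distrib sum_subtractf sum_distrib_left mult.commute[of L])
  have "norm (\<Sum>d=1..x. (\<chi> d * mangoldt d / of_nat d) * (L - P (x div d))) \<le>
        (\<Sum>d=1..x. mangoldt d * (2 * real N / real x))"
  proof (intro sum_norm_le)
    fix d assume d: "d \<in> {1..x}"
    have "norm ((\<chi> d * mangoldt d / of_nat d) * (L - P (x div d))) =
          norm (\<chi> d) * (mangoldt d / real d) * norm (L - P (x div d))"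
      by (simp add: norm_mult norm_divide)
    also have "\<dots> \<le> 1 * (mangoldt d / real d) * (2 * real N * real d / real x)"
      using d False norm_dchar_le_1[OF dchar N_pos]
      by (intro mult_mono norm_L_diff_div_le) (auto intro!: divide_nonneg_nonneg mangoldt_nonneg)
    also have "\<dots> = mangoldt d * (2 * real N / real x)" using d by simp
    finally show "norm ((\<chi> d * mangoldt d / of_nat d) * (L - P (x div d))) \<le> \<dots>" .
  qed
  also have "\<dots> = chebyshev_psi x * (2 * real N / real x)"
    unfolding chebyshev_psi_def by (rule sum_distrib_right [symmetric])
  also have "\<dots> \<le> 6 * real x * (2 * real N / real x)"
    by (intro mult_right_mono chebyshev_psi_le) auto
  also have "\<dots> = 12 * real N" using False by simp
  finally show ?thesis
    unfolding eq using sum_ln_bounded[of x] by (intro norm_triangle_le) linarith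
qed (simp add: S_def)

text \<open>If L vanishes, S behaves like - ln x. Summing \<open>moebius d\<close> * ln (x / d) over
  the divisors of n gives \<open>mangoldt n\<close>, plus ln x if n = 1. The inner factors are again
  \<open>P (x div d)\<close>, now themselves tails of size O(d / x), and what remains is x ln x - ln
  (x!) \<le> x.\<close>

lemma norm_ln_add_S_le:
  assumes "L = 0" "x > 0"
  shows "norm (of_real (ln (real x)) + S x) \<le> 2 * real N"
proof -
  let ?g = "\<lambda>d. moebius d * (ln (real x) - ln (real d))"
  have mu: "(\<Sum>d | d dvd n. ?g d) = (if n = 1 then ln (real x) else 0) + mangoldt n" if "n > 0" for n
  proof -
    have "(\<Sum>d | d dvd n. ?g d) = ln (real x) * (\<Sum>d | d dvd n. moebius d) - (\<Sum>d | d dvd n. moebius d * ln (real d))"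
      by (simp add: algebra_simps sum_subtractf sum_distrib_left)
    also have "(\<Sum>d | d dvd n. moebius d) = (if n = 1 then 1 else 0)"
      using moebius_sum[of n] that by auto
    finally show ?thesis using moebius_sum_ln[OF that] by simp
  qed
  have "of_real (ln (real x)) + S x = (\<Sum>n=1..x. \<chi> n / of_nat n * of_real ((if n = 1 then ln (real x) else 0) + mangoldt n))"
  proof -
    have "(\<Sum>n=1..x. \<chi> n / of_nat n * of_real (if n = 1 then ln (real x) else 0)) =
          (\<Sum>n\<in>{1}. \<chi> n / of_nat n * of_real (if n = 1 then ln (real x) else 0))"
      using assms(2) by (intro sum.mono_neutral_right) auto
    thus ?thesis by (simp add: S_def algebra_simps sum.distrib dcharD[OF dchar])
  qed
  also have "\<dots> = (\<Sum>n=1..x. \<Sum>d | d dvd n. (\<chi> d * of_real (?g d) / of_nat d) * (\<chi> (n div d) / of_nat (n div d)))"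
  proof (intro sum.cong refl)
    fix n assume n: "n \<in> {1..x}"
    have "\<chi> n / of_nat n * of_real ((if n = 1 then ln (real x) else 0) + mangoldt n) =
          (\<Sum>d | d dvd n. \<chi> n / of_nat n * of_real (?g d))"
      using n by (subst mu [symmetric]) (simp_all only: of_real_sum sum_distrib_left, auto)
    also have "\<dots> = (\<Sum>d | d dvd n. (\<chi> d * of_real (?g d) / of_nat d) * (\<chi> (n div d) / of_nat (n div d)))"
      by (intro sum.cong refl) (use n in \<open>auto elim!: dvdE simp: dcharD[OF dchar]\<close>)
    finally show "\<chi> n / of_nat n * of_real ((if n = 1 then ln (real x) else 0) + mangoldt n) = \<dots>" .
  qed
  also have "\<dots> = (\<Sum>d=1..x. \<Sum>m=1..x div d. (\<chi> d * of_real (?g d) / of_nat d) * (\<chi> m / of_nat m))"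
    by (rule sum_divisors_swap)
  also have "\<dots> = (\<Sum>d=1..x. (\<chi> d * of_real (?g d) / of_nat d) * P (x div d))"
    by (simp add: P_def sum_distrib_left)
  also have "norm \<dots> \<le> (\<Sum>d=1..x. (ln (real x) - ln (real d)) * (2 * real N / real x))"
  proof (intro sum_norm_le)
    fix d assume d: "d \<in> {1..x}"
    have le: "0 \<le> ln (real x) - ln (real d)" using d by simp
    have "norm ((\<chi> d * of_real (?g d) / of_nat d) * P (x div d)) =
          norm (\<chi> d) * (\<bar>moebius d\<bar> * (ln (real x) - ln (real d))) / real d * norm (L - P (x div d))"
      using le assms by (simp only: norm_mult norm_divide norm_of_real abs_mult norm_of_nat) simp
    also have "\<dots> \<le> 1 * (1 * (ln (real x) - ln (real d))) / real d * (2 * real N * real d / real x)"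
      using d assms(2) le norm_dchar_le_1[OF dchar N_pos] abs_moebius_le
      by (intro mult_mono divide_right_mono norm_L_diff_div_le) auto
    also have "\<dots> = (ln (real x) - ln (real d)) * (2 * real N / real x)" using d by simp
    finally show "norm ((\<chi> d * of_real (?g d) / of_nat d) * P (x div d)) \<le> \<dots>" .
  qed
  also have "\<dots> = (\<Sum>d=1..x. ln (real x) - ln (real d)) * (2 * real N / real x)"
    by (rule sum_distrib_right [symmetric])
  also have "(\<Sum>d=1..x. ln (real x) - ln (real d)) = real x * ln (real x) - ln (fact x)"
  proof -
    have "ln (fact x) = (\<Sum>n=1..x. ln (real n))"
      by (induction x) (simp_all add: ln_mult add.commute)
    thus ?thesis by (simp add: sum_subtractf)
  qed
  also have "\<dots> * (2 * real N / real x) \<le> real x * (2 * real N / real x)"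
    using ln_fact_ge[of x] by (intro mult_right_mono) auto
  also have "\<dots> = 2 * real N" using assms by simp
  finally show ?thesis .
qed

end

section \<open>Nonvanishing of L(1, \<chi>) for real characters\<close>

text \<open>Arithmetic-geometric mean for the i-th term from the front and the i-th from the back,
  whose product is u^(2(n - 1)).\<close>

lemma geometric_sum_ge:
  fixes u :: real
  assumes "0 \<le> u"
  shows "real n * u ^ (n - 1) \<le> (\<Sum>i<n. (u ^ 2) ^ i)"
proof -
  have "2 * (real n * u ^ (n - 1)) = (\<Sum>i<n. 2 * u ^ (n - 1))" by simp
  also have "\<dots> \<le> (\<Sum>i<n. (u ^ 2) ^ i + (u ^ 2) ^ (n - Suc i))"
  proof (intro sum_mono)
    fix i assume "i \<in> {..<n}"
    hence "u ^ (n - 1) = u ^ i * u ^ (n - Suc i)" by (simp flip: power_add)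
    thus "2 * u ^ (n - 1) \<le> (u ^ 2) ^ i + (u ^ 2) ^ (n - Suc i)"
      using sum_squares_bound[of "u ^ i" "u ^ (n - Suc i)"]
      by (simp add: power_mult [symmetric] mult_ac)
  qed
  also have "\<dots> = 2 * (\<Sum>i<n. (u ^ 2) ^ i)"
    by (simp add: sum.distrib sum.nat_diff_reindex)
  finally show ?thesis by simp
qed

text \<open>
  If \<open>L(1, \<chi>) = 0\<close> for a real \<open>\<chi>\<close>, the Lambert series \<open>\<Sum>n. \<chi> n * t^n / (1 - t^n)\<close> equals
  \<open>- (\<Sum>n. \<chi> n * lambert_weight t n)\<close>, which is bounded by Abel summation; but its coefficients
  are nonnegative and at least 1 at squares, so it is unbounded as \<open>t\<close> tends to 1.
\<close>

definition lambert_weight :: "real \<Rightarrow> nat \<Rightarrow> real" where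
  "lambert_weight t n = 1 / (real n * (1 - t)) - t ^ n / (1 - t ^ n)"

lemma lambert_weight_nonneg:
  assumes "0 < t" "t < 1" "n > 0"
  shows "0 \<le> lambert_weight t n"
proof -
  have lt: "t ^ n < 1" using assms by (simp add: power_less_one_iff)
  have "real n * t ^ n = (\<Sum>i<n. t ^ n)" by simp
  also have "\<dots> \<le> (\<Sum>i<n. t ^ i)" using assms by (intro sum_mono power_decreasing) auto
  finally have "(1 - t) * (real n * t ^ n) \<le> (1 - t) * (\<Sum>i<n. t ^ i)"
    using assms by (intro mult_left_mono) auto
  also have "\<dots> = 1 - t ^ n" by (simp add: one_diff_power_eq)
  finally have "t ^ n * (real n * (1 - t)) \<le> 1 * (1 - t ^ n)" by (simp add: mult_ac)
  hence "t ^ n / (1 - t ^ n) \<le> 1 / (real n * (1 - t))"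
    using assms lt by (intro frac_le_eq[THEN iffD2]) (auto simp: divide_simps)
  thus ?thesis by (simp add: lambert_weight_def)
qed

text \<open>With G n = 1 + t + ... + t^(n - 1) the claim reduces to n (n + 1) t^n \<le> G n * G (n +
  1). For u = sqrt t, \<open>geometric_sum_ge\<close> bounds the two factors below by n u^(n - 1)
  and (n + 1) u^n, and the total exponent 2n - 1 is below the required 2n.\<close>

lemma lambert_weight_decreasing:
  assumes t: "0 < t" "t < 1" and n: "n > 0"
  shows "lambert_weight t (Suc n) \<le> lambert_weight t n"
proof -
  define u where "u = sqrt t"
  have u: "0 \<le> u" "u ^ 2 = t" "u \<le> 1" using t by (auto simp: u_def)
  define G where "G = (\<lambda>n. \<Sum>i<n. t ^ i)"
  have G: "1 - t ^ m = (1 - t) * G m" for m by (simp add: G_def one_diff_power_eq)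
  have Gpos: "G m > 0" if "m > 0" for m
    using t that by (auto simp: G_def intro!: sum_pos)
  have "real n * real (Suc n) * t ^ n = real n * real (Suc n) * u ^ (2 * n)"
    by (simp add: power_mult u)
  also have "\<dots> \<le> real n * real (Suc n) * u ^ (2 * n - 1)"
    using u by (intro mult_left_mono power_decreasing) auto
  also have "\<dots> = (real n * u ^ (n - 1)) * (real (Suc n) * u ^ (Suc n - 1))"
    using n by (simp add: mult_ac mult_2_right flip: power_add)
  also have "\<dots> \<le> G n * G (Suc n)"
    using geometric_sum_ge[OF u(1), of n] geometric_sum_ge[OF u(1), of "Suc n"] u Gpos[OF n]
    unfolding G_def u(2) by (intro mult_mono) auto
  finally have key: "real n * real (Suc n) * t ^ n \<le> G n * G (Suc n)" .
  have "lambert_weight t n - lambert_weight t (Suc n) =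
        (1 / (real n * (1 - t)) - 1 / (real (Suc n) * (1 - t))) - (t ^ n / (1 - t ^ n) - t ^ Suc n / (1 - t ^ Suc n))"
    by (simp add: lambert_weight_def)
  also have "1 / (real n * (1 - t)) - 1 / (real (Suc n) * (1 - t)) = 1 / ((1 - t) * (real n * real (Suc n)))"
    using n t by (simp add: divide_simps)
  also have "t ^ n / (1 - t ^ n) - t ^ Suc n / (1 - t ^ Suc n) = t ^ n / ((1 - t) * (G n * G (Suc n)))"
  proof -
    have "1 - t ^ n \<noteq> 0" "1 - t ^ Suc n \<noteq> 0" using G Gpos n t by (metis Gpos G less_numeral_extra(3) mult_eq_0_iff right_minus_eq zero_less_Suc order_less_irrefl)+
    hence "t ^ n / (1 - t ^ n) - t ^ Suc n / (1 - t ^ Suc n) = (t ^ n * (1 - t)) / ((1 - t ^ n) * (1 - t ^ Suc n))"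
      by (simp add: divide_simps) (simp add: algebra_simps)
    also have "\<dots> = (t ^ n * (1 - t)) / (((1 - t) * G n) * ((1 - t) * G (Suc n)))"
      by (simp only: G)
    also have "\<dots> = t ^ n / ((1 - t) * (G n * G (Suc n)))" using t by simp
    finally show ?thesis .
  qed
  also have "1 / ((1 - t) * (real n * real (Suc n))) - t ^ n / ((1 - t) * (G n * G (Suc n))) =
     (1 / (1 - t)) * (1 / (real n * real (Suc n)) - t ^ n / (G n * G (Suc n)))"
    by (simp add: right_diff_distrib)
  also have "\<dots> \<ge> 0"
  proof -
    have "t ^ n * (real n * real (Suc n)) \<le> 1 * (G n * G (Suc n))"
      using key by (simp add: mult_ac)
    hence "t ^ n / (G n * G (Suc n)) \<le> 1 / (real n * real (Suc n))"
      using n Gpos[OF n] Gpos[of "Suc n"] by (simp add: divide_simps mult_ac del: of_nat_Suc)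
    thus ?thesis using t by (intro mult_nonneg_nonneg) auto
  qed
  finally show ?thesis by simp
qed

lemma divisors_prime_power_mult:
  fixes p m :: nat
  assumes "prime p" "\<not> p dvd m"
  shows "{d. d dvd p ^ Suc k * m} = {d. d dvd m} \<union> (*) p ` {d. d dvd p ^ k * m}"
proof (intro equalityI subsetI)
  fix d assume d: "d \<in> {d. d dvd p ^ Suc k * m}"
  show "d \<in> {d. d dvd m} \<union> (*) p ` {d. d dvd p ^ k * m}"
  proof (cases "p dvd d")
    case True
    then obtain e where "d = p * e" by blast
    thus ?thesis using d assms(1) by (auto simp: mult.assoc)
  next
    case False
    hence "coprime d (p ^ Suc k)" using assms(1)
      by (meson coprime_commute coprime_power_right_iff prime_imp_coprime)
    thus ?thesis using d by (simp add: coprime_dvd_mult_right_iff)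
  qed
qed (auto simp: mult.assoc)

lemma prime_power_split:
  fixes n :: nat
  assumes "n > 1"
  obtains p k m where "prime p" "k > 0" "\<not> p dvd m" "n = p ^ k * m" "0 < m" "m < n"
proof -
  obtain p where p: "prime p" "p dvd n" using assms prime_factor_nat[of n] by auto
  obtain m where m: "n = p ^ multiplicity p n * m" "\<not> p dvd m"
    using multiplicity_decompose'[of n p] assms p by (metis not_prime_unit not_one_less_zero)
  have k: "multiplicity p n > 0" using p assms by (simp add: prime_multiplicity_gt_zero_iff)
  have "m > 0" using m assms by (intro Nat.gr0I) auto
  have "p ^ multiplicity p n > 1" using k p by (meson one_less_power prime_gt_1_nat)
  hence "m < p ^ multiplicity p n * m" using \<open>m > 0\<close> by simp
  hence "m < n" using m(1) by simp
  thus ?thesis using that[OF p(1) k m(2,1)] \<open>m > 0\<close> by blast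
qed

text \<open>What the Lambert series argument uses of a real character; periodicity enters only
  later, through the bound on its partial sums.\<close>

locale sign_multiplicative =
  fixes h :: "nat \<Rightarrow> real"
  assumes h_mult: "h (a * b) = h a * h b" and h_1: "h 1 = 1" and h_range: "h a \<in> {-1, 0, 1}"
begin

definition F :: "nat \<Rightarrow> real" where "F n = (\<Sum>d | d dvd n. h d)"

lemma F_1: "F 1 = 1" by (simp add: F_def h_1[simplified])

lemma F_prime_power_mult_Suc:
  assumes "prime p" "\<not> p dvd m"
  shows "F (p ^ Suc k * m) = F m + h p * F (p ^ k * m)"
proof -
  have m: "m > 0" using assms by (intro Nat.gr0I) auto
  have "F (p ^ Suc k * m) = sum h ({d. d dvd m} \<union> (*) p ` {d. d dvd p ^ k * m})"
    unfolding F_def divisors_prime_power_mult[OF assms] ..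
  also have "\<dots> = F m + sum h ((*) p ` {d. d dvd p ^ k * m})"
    unfolding F_def using assms m by (intro sum.union_disjoint) (auto dest: dvd_mult_left simp: prime_gt_0_nat)
  also have "sum h ((*) p ` {d. d dvd p ^ k * m}) = h p * F (p ^ k * m)"
    using assms(1) by (subst sum.reindex) (auto simp: inj_on_def F_def h_mult sum_distrib_left)
  finally show ?thesis .
qed

text \<open>By the recursion in k, the values along powers of p are constant if
  \<open>h p = 0\<close>, nondecreasing if \<open>h p = 1\<close>, and alternate between
  \<open>F m\<close> and 0 if \<open>h p = - 1\<close>. An even exponent never loses
  anything.\<close>

lemma F_prime_power_mult:
  assumes "prime p" "\<not> p dvd m" "0 \<le> F m"
  shows "0 \<le> F (p ^ k * m) \<and> (even k \<longrightarrow> F m \<le> F (p ^ k * m))"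
proof -
  consider "h p = 0" | "h p = 1" | "h p = - 1" using h_range[of p] by auto
  thus ?thesis
  proof cases
    case 1
    thus ?thesis using assms F_prime_power_mult_Suc[OF assms(1,2)] by (cases k) auto
  next
    case 2
    have "F m \<le> F (p ^ k * m)"
    proof (induction k)
      case (Suc k)
      thus ?case using F_prime_power_mult_Suc[OF assms(1,2), of k] 2 assms(3) by simp
    qed auto
    thus ?thesis using assms(3) by auto
  next
    case 3
    have "F (p ^ k * m) = (if even k then F m else 0)"
    proof (induction k)
      case (Suc k)
      thus ?case using F_prime_power_mult_Suc[OF assms(1,2), of k] 3 by simp
    qed auto
    thus ?thesis using assms(3) by auto
  qed
qed

lemma F_nonneg: "n > 0 \<Longrightarrow> 0 \<le> F n"
proof (induction n rule: less_induct)
  case (less n)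
  show ?case
  proof (cases "n = 1")
    case False
    then obtain p k m where "prime p" "\<not> p dvd m" "n = p ^ k * m" "0 < m" "m < n"
      using less.prems prime_power_split[of n] by (metis less_one linorder_neqE_nat not_less_zero)
    thus ?thesis using F_prime_power_mult[of p m k] less.IH[of m] by auto
  qed (use F_1 in auto)
qed

lemma F_square_ge: "s > 0 \<Longrightarrow> 1 \<le> F (s ^ 2)"
proof (induction s rule: less_induct)
  case (less s)
  show ?case
  proof (cases "s = 1")
    case False
    then obtain p k m where *: "prime p" "\<not> p dvd m" "s = p ^ k * m" "0 < m" "m < s"
      using less.prems prime_power_split[of s] by (metis less_one linorder_neqE_nat not_less_zero)
    have "1 \<le> F (m ^ 2)" using less.IH * by blast
    also have "\<dots> \<le> F (p ^ (2 * k) * m ^ 2)"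
      using F_prime_power_mult[of p "m ^ 2" "2 * k"] * F_nonneg[of "m ^ 2"] prime_dvd_power by auto
    also have "p ^ (2 * k) * m ^ 2 = s ^ 2"
      using * by (simp add: power_mult_distrib power_mult [symmetric] mult.commute)
    finally show ?thesis .
  qed (use F_1 in auto)
qed

text \<open>Truncated Lambert identity. After the swap, each inner geometric sum is t^d / (1 - t^d)
  minus a remainder, and t^d / (1 - t^d) = 1 / (d (1 - t)) - \<open>lambert_weight t d\<close>. The
  three resulting sums are bounded by Q, by Abel summation with
  \<open>lambert_weight t 1 = 1\<close>, and by x remainders of size at most t^x / (1 - t).\<close>

lemma sum_F_power_le:
  fixes C :: real
  assumes t: "0 < t" "t < 1" and C: "\<And>n. \<bar>\<Sum>k=1..n. h k\<bar> \<le> C"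
    and Q: "\<bar>\<Sum>n=1..x. h n / real n\<bar> \<le> C / real (x + 1)" and x: "x > 0"
  shows "(\<Sum>n=1..x. F n * t ^ n) \<le> C + (C / real (x + 1)) / (1 - t) + real x * t ^ x / (1 - t)"
proof -
  have t1: "t ^ d < 1" "1 - t \<le> 1 - t ^ d" if "d > 0" for d
    using t that power_decreasing[of 1 d t] by (auto simp: power_less_one_iff)
  have "(\<Sum>n=1..x. F n * t ^ n) = (\<Sum>n=1..x. \<Sum>d | d dvd n. h d * t ^ (d * (n div d)))"
    unfolding F_def sum_distrib_right by (intro sum.cong refl) auto
  also have "\<dots> = (\<Sum>d=1..x. \<Sum>m=1..x div d. h d * t ^ (d * m))"
    by (rule sum_divisors_swap)
  also have "\<dots> = (\<Sum>d=1..x. h d / real d / (1 - t) - lambert_weight t d * h d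
       - h d * (t ^ (d * (x div d + 1)) / (1 - t ^ d)))"
  proof (intro sum.cong refl)
    fix d assume d: "d \<in> {1..x}"
    have "(1 - z) * (\<Sum>m=1..y. z ^ m) = z - z ^ (y + 1)" for y and z :: real
    proof (induction y)
      case (Suc y)
      have "(1 - z) * (\<Sum>m=1..Suc y. z ^ m) = (1 - z) * (\<Sum>m=1..y. z ^ m) + (1 - z) * z ^ (y + 1)"
        by (simp add: distrib_left)
      also have "\<dots> = z - z ^ (Suc y + 1)" unfolding Suc.IH by (simp add: algebra_simps)
      finally show ?case .
    qed auto
    hence "(\<Sum>m=1..y. (t ^ d) ^ m) = (t ^ d - (t ^ d) ^ (y + 1)) / (1 - t ^ d)" for y
      using t1(1)[of d] d by (simp add: eq_divide_eq mult.commute)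
    from this[of "x div d"] have "(\<Sum>m=1..x div d. h d * t ^ (d * m)) =
        h d * ((t ^ d - t ^ (d * (x div d + 1))) / (1 - t ^ d))"
      by (simp only: power_mult sum_distrib_left [symmetric])
    thus "(\<Sum>m=1..x div d. h d * t ^ (d * m)) = h d / real d / (1 - t) - lambert_weight t d * h d
       - h d * (t ^ (d * (x div d + 1)) / (1 - t ^ d))"
      by (simp add: lambert_weight_def diff_divide_distrib algebra_simps)
  qed
  also have "\<dots> = (\<Sum>d=1..x. h d / real d) / (1 - t) - (\<Sum>d=1..x. lambert_weight t d * h d) -
      (\<Sum>d=1..x. h d * (t ^ (d * (x div d + 1)) / (1 - t ^ d)))"
    by (simp add: sum_subtractf sum_divide_distrib)
  also have "\<dots> \<le> (C / real (x + 1)) / (1 - t) - (- C) - (- (real x * t ^ x / (1 - t)))"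
  proof (intro diff_mono divide_right_mono)
    have "\<bar>\<Sum>d=1..x. lambert_weight t d * h d\<bar> \<le> C * lambert_weight t 1"
      using norm_sum_antimono_mult_le[of h 1 C "lambert_weight t" x] C x t
        lambert_weight_nonneg[of t] lambert_weight_decreasing[of t] by auto
    also have "lambert_weight t 1 = 1" using t by (simp add: lambert_weight_def diff_divide_distrib [symmetric])
    finally show "- C \<le> (\<Sum>d=1..x. lambert_weight t d * h d)" by simp
    have "\<bar>\<Sum>d=1..x. h d * (t ^ (d * (x div d + 1)) / (1 - t ^ d))\<bar> \<le> (\<Sum>d=1..x. t ^ x / (1 - t))"
    proof (intro order.trans[OF sum_abs] sum_mono)
      fix d assume d: "d \<in> {1..x}"
      have "x \<le> d * (x div d + 1)"
        using dividend_less_div_times[of d x] d by (simp add: algebra_simps)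
      hence "t ^ (d * (x div d + 1)) \<le> t ^ x" using t by (intro power_decreasing) auto
      moreover define e where "e = t ^ (d * (x div d + 1)) / (1 - t ^ d)"
      ultimately have "e \<le> t ^ x / (1 - t)"
        using t t1[of d] d unfolding e_def by (intro frac_le) auto
      moreover have "\<bar>h d\<bar> \<le> 1" using h_range[of d] by auto
      moreover have "0 \<le> e" using t t1[of d] d by (auto simp: e_def)
      ultimately have "\<bar>h d\<bar> * \<bar>e\<bar> \<le> 1 * (t ^ x / (1 - t))"
        by (intro mult_mono) auto
      thus "\<bar>h d * (t ^ (d * (x div d + 1)) / (1 - t ^ d))\<bar> \<le> t ^ x / (1 - t)"
        by (simp only: abs_mult e_def mult_1)
    qed
    thus "- (real x * t ^ x / (1 - t)) \<le> (\<Sum>d=1..x. h d * (t ^ (d * (x div d + 1)) / (1 - t ^ d)))"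
      by simp
  qed (use Q t in auto)
  finally show ?thesis by simp
qed

text \<open>Q is the decay that L(1, \<chi>) = 0 would entail. For fixed t, letting x tend to
  infinity removes both error terms and leaves C as a bound for the squares up to M^2; letting t
  tend to 1 then gives M \<le> C.\<close>

lemma not_all_decay:
  fixes C :: real
  assumes C: "\<And>n. \<bar>\<Sum>k=1..n. h k\<bar> \<le> C"
    and Q: "\<And>x. \<bar>\<Sum>n=1..x. h n / real n\<bar> \<le> C / real (x + 1)"
  shows False
proof -
  obtain M :: nat where M: "C < real M" using reals_Archimedean2 by blast
  have le: "(\<Sum>s=1..M. t ^ (s ^ 2)) \<le> C" if t: "0 < t" "t < 1" for t :: real
  proof (rule LIMSEQ_le_const)
    have "(\<lambda>x. C / real (x + 1)) \<longlonglongrightarrow> 0"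
      using LIMSEQ_Suc[OF lim_const_over_n[of C]] by simp
    moreover have "(\<lambda>x. real x * t ^ x) \<longlonglongrightarrow> 0"
      using powser_times_n_limit_0[of t] t by simp
    ultimately have "(\<lambda>x. C + (C / real (x + 1)) / (1 - t) + real x * t ^ x / (1 - t)) \<longlonglongrightarrow> C + 0 / (1 - t) + 0 / (1 - t)"
      using t by (intro tendsto_intros) auto
    thus "(\<lambda>x. C + (C / real (x + 1)) / (1 - t) + real x * t ^ x / (1 - t)) \<longlonglongrightarrow> C" by simp
    show "\<exists>K. \<forall>x\<ge>K. (\<Sum>s=1..M. t ^ (s ^ 2)) \<le> C + (C / real (x + 1)) / (1 - t) + real x * t ^ x / (1 - t)"
    proof (intro exI[of _ "M ^ 2 + 1"] allI impI)
      fix x assume x: "M ^ 2 + 1 \<le> x"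
      have "(\<Sum>s=1..M. t ^ (s ^ 2)) \<le> (\<Sum>s=1..M. F (s ^ 2) * t ^ (s ^ 2))"
        using F_square_ge t by (intro sum_mono) (auto simp: mult_le_cancel_right1)
      also have "\<dots> = (\<Sum>n\<in>(\<lambda>s. s ^ 2) ` {1..M}. F n * t ^ n)"
        by (subst sum.reindex) (auto simp: inj_on_def)
      also have "\<dots> \<le> (\<Sum>n=1..x. F n * t ^ n)"
      proof (rule sum_mono2)
        show "(\<lambda>s. s ^ 2) ` {1..M} \<subseteq> {1..x}"
        proof safe
          fix s assume "s \<in> {1..M}"
          hence "1 \<le> s ^ 2" "s ^ 2 \<le> M ^ 2" by (auto intro: power_mono)
          moreover have "s ^ 2 \<le> x" using \<open>s ^ 2 \<le> M ^ 2\<close> x by linarith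
          ultimately show "s ^ 2 \<in> {1..x}" by simp
        qed
      qed (use F_nonneg t in auto)
      also have "\<dots> \<le> C + (C / real (x + 1)) / (1 - t) + real x * t ^ x / (1 - t)"
        using x by (intro sum_F_power_le t C Q) auto
      finally show "(\<Sum>s=1..M. t ^ (s ^ 2)) \<le> \<dots>" .
    qed
  qed
  have "((\<lambda>t::real. \<Sum>s=1..M. t ^ (s ^ 2)) \<longlongrightarrow> (\<Sum>s=1..M. 1 ^ (s ^ 2))) (at_left 1)"
    by (intro tendsto_intros)
  moreover have "eventually (\<lambda>t::real. (\<Sum>s=1..M. t ^ (s ^ 2)) \<le> C) (at_left 1)"
    unfolding eventually_at_left_field by (intro exI[of _ 0]) (use le in auto)
  ultimately have "(\<Sum>s=1..M. 1 ^ (s ^ 2)) \<le> C"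
    by (intro tendsto_upperbound) auto
  thus False using M by simp
qed

end

context nonprincipal_dchar
begin

lemma L_nonzero_if_real:
  assumes real: "\<And>n. cnj (\<chi> n) = \<chi> n"
  shows "L \<noteq> 0"
proof
  assume L0: "L = 0"
  have Im: "Im (\<chi> n) = 0" for n using real[of n] by (simp add: complex_eq_iff)
  interpret h: sign_multiplicative "\<lambda>n. Re (\<chi> n)"
  proof
    show "Re (\<chi> (a * b)) = Re (\<chi> a) * Re (\<chi> b)" for a b
      by (simp add: dcharD(2)[OF dchar] Im)
    show "Re (\<chi> 1) = 1" by (simp add: dcharD(1)[OF dchar])
    show "Re (\<chi> a) \<in> {-1, 0, 1}" for a
      using norm_dchar[OF dchar N_pos, of a] by (cases "coprime a N") (auto simp: cmod_def Im)
  qed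
  show False
  proof (rule h.not_all_decay)
    show "\<bar>\<Sum>k=1..n. Re (\<chi> k)\<bar> \<le> 2 * real N" for n
      using abs_Re_le_cmod[of "\<Sum>k=1..n. \<chi> k"] norm_sum_dchar_le[OF dchar nonprincipal N_pos, of 1 n]
      by simp
    show "\<bar>\<Sum>n=1..x. Re (\<chi> n) / real n\<bar> \<le> 2 * real N / real (x + 1)" for x
      using abs_Re_le_cmod[of "P x"] norm_L_diff_le[of x] L0
      by (simp add: P_def Re_divide_of_nat)
  qed
qed

end

section \<open>Dirichlet's theorem\<close>

definition mangoldt_sum_dchar :: "(nat \<Rightarrow> complex) \<Rightarrow> nat \<Rightarrow> complex" where
  "mangoldt_sum_dchar \<chi> x = (\<Sum>n=1..x. \<chi> n * mangoldt n / of_nat n)"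

text \<open>The n not coprime to N that matter are primes dividing N, with total weight K, and
  nonprimes, with total weight at most 8. The constant 9 is this 8 plus the 1 from the lower bound
  of Mertens' theorem.\<close>

lemma mangoldt_sum_principal:
  assumes "N > 0"
  shows "\<exists>B. \<forall>x>0. norm (mangoldt_sum_dchar (principal_dchar N) x - of_real (ln (real x))) \<le> B"
proof -
  define K where "K = (\<Sum>p\<in>prime_factors N. mangoldt p / real p :: real)"
  have K: "K \<ge> 0" unfolding K_def by (intro sum_nonneg divide_nonneg_nonneg mangoldt_nonneg) auto
  show ?thesis
  proof (intro exI[of _ "9 + K"] allI impI)
    fix x :: nat assume x: "x > 0"
    let ?g = "\<lambda>n. mangoldt n / real n :: real"
    have nonneg: "0 \<le> ?g n" for n by (intro divide_nonneg_nonneg mangoldt_nonneg) auto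
    define A where "A = {n \<in> {1..x}. \<not> coprime n N}"
    have "(\<Sum>n\<in>A. ?g n) \<le> sum ?g (prime_factors N \<union> {d. d \<in> {1..x} \<and> \<not> prime d})"
    proof (rule sum_mono2)
      show "A \<subseteq> prime_factors N \<union> {d. d \<in> {1..x} \<and> \<not> prime d}"
        using assms by (auto simp: A_def in_prime_factors_iff dest: prime_imp_coprime)
    qed (use nonneg in auto)
    also have "\<dots> \<le> K + (\<Sum>d | d \<in> {1..x} \<and> \<not> prime d. ?g d)"
    proof -
      have "sum ?g (prime_factors N \<union> {d. d \<in> {1..x} \<and> \<not> prime d}) =
        K + (\<Sum>d | d \<in> {1..x} \<and> \<not> prime d. ?g d)"
        unfolding K_def by (rule sum.union_disjoint) auto
      thus ?thesis by simp
    qed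
    also have "\<dots> \<le> K + 8" using sum_mangoldt_nonprime_le[of x] by simp
    finally have A: "(\<Sum>n\<in>A. ?g n) \<le> K + 8" "0 \<le> (\<Sum>n\<in>A. ?g n)"
      using nonneg by (auto intro: sum_nonneg)
    have "mangoldt_sum_dchar (principal_dchar N) x = of_real (\<Sum>n\<in>{1..x} - A. ?g n)"
    proof -
      have "mangoldt_sum_dchar (principal_dchar N) x = (\<Sum>n\<in>{1..x} - A. mangoldt n / of_nat n)"
        unfolding mangoldt_sum_dchar_def
        by (rule sum.mono_neutral_cong_right) (auto simp: A_def principal_dchar_def)
      thus ?thesis by simp
    qed
    also have "(\<Sum>n\<in>{1..x} - A. ?g n) = (\<Sum>n=1..x. ?g n) - (\<Sum>n\<in>A. ?g n)"
      by (rule sum_diff) (auto simp: A_def)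
    finally have "norm (mangoldt_sum_dchar (principal_dchar N) x - of_real (ln (real x))) =
      \<bar>(\<Sum>n=1..x. ?g n) - (\<Sum>n\<in>A. ?g n) - ln (real x)\<bar>"
      by (simp only: of_real_diff [symmetric] norm_of_real)
    also have "\<dots> \<le> 9 + K"
      using sum_mangoldt_div_bounds[OF x] A K by (auto simp: abs_le_iff)
    finally show "norm (mangoldt_sum_dchar (principal_dchar N) x - of_real (ln (real x))) \<le> 9 + K" .
  qed
qed

lemma mangoldt_sum_nonprincipal:
  assumes "nonprincipal_dchar N \<chi>"
  shows "\<exists>B. \<forall>x>0. norm (mangoldt_sum_dchar \<chi> x -
     (if nonprincipal_dchar.L \<chi> = 0 then - 1 else 0) * of_real (ln (real x))) \<le> B"
proof -
  interpret nonprincipal_dchar N \<chi> by fact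
  have S: "mangoldt_sum_dchar \<chi> = S" by (auto simp: fun_eq_iff mangoldt_sum_dchar_def S_def)
  show ?thesis
  proof (cases "L = 0")
    case True
    thus ?thesis using norm_ln_add_S_le unfolding S by (intro exI[of _ "2 * real N"]) (auto simp: add.commute)
  next
    case False
    have "norm (S x) \<le> (1 + 2 * real N * ln 3 + 12 * real N) / norm L" for x
      using norm_L_mult_S_le[of x] False by (simp add: norm_mult field_simps)
    thus ?thesis unfolding S using False by auto
  qed
qed

lemma sum_dchars_mangoldt:
  assumes "squarefree N"
  shows "(\<Sum>\<chi> | dchar N \<chi>. \<chi> b * mangoldt_sum_dchar \<chi> x) =
     of_real (real (card {\<chi>. dchar N \<chi>}) * (\<Sum>n | n \<in> {1..x} \<and> [b * n = 1] (mod N). mangoldt n / real n))"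
proof -
  let ?X = "{\<chi>. dchar N \<chi>}"
  have "(\<Sum>\<chi>\<in>?X. \<chi> b * mangoldt_sum_dchar \<chi> x) = (\<Sum>\<chi>\<in>?X. \<Sum>n=1..x. \<chi> (b * n) * (mangoldt n / of_nat n))"
    by (intro sum.cong refl) (simp add: mangoldt_sum_dchar_def sum_distrib_left dcharD mult.assoc)
  also have "\<dots> = (\<Sum>n=1..x. (\<Sum>\<chi>\<in>?X. \<chi> (b * n)) * (mangoldt n / of_nat n))"
    by (subst sum.swap) (simp only: sum_distrib_right)
  also have "\<dots> = (\<Sum>n=1..x. (if [b * n = 1] (mod N) then of_nat (card ?X) else 0) * (mangoldt n / of_nat n))"
  proof (intro sum.cong refl)
    fix n
    show "(\<Sum>\<chi>\<in>?X. \<chi> (b * n)) * (mangoldt n / of_nat n) =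
       (if [b * n = 1] (mod N) then of_nat (card ?X) else 0) * (mangoldt n / of_nat n)"
    proof (cases "coprime (b * n) N")
      case True
      thus ?thesis using sum_dchars[OF assms True] by simp
    next
      case False
      hence "\<not> [b * n = 1] (mod N)" by (metis cong_imp_coprime cong_sym coprime_1_left)
      moreover have "(\<Sum>\<chi>\<in>?X. \<chi> (b * n)) = 0"
        using False dcharD(4) by (intro sum.neutral) blast
      ultimately show ?thesis by simp
    qed
  qed
  also have "\<dots> = (\<Sum>n | n \<in> {1..x} \<and> [b * n = 1] (mod N). of_nat (card ?X) * (mangoldt n / of_nat n))"
    by (intro sum.mono_neutral_cong_right) auto
  also have "\<dots> = of_real (real (card ?X) * (\<Sum>n | n \<in> {1..x} \<and> [b * n = 1] (mod N). mangoldt n / real n))"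
    by (simp add: sum_distrib_left)
  finally show ?thesis .
qed

lemma ln_real_unbounded: "\<exists>x>0. B < ln (real x)"
proof -
  obtain x :: nat where x: "exp B < real x" using reals_Archimedean2 by blast
  hence "x > 0" using exp_gt_zero[of B] by (intro Nat.gr0I) auto
  moreover have "B < ln (real x)" using x \<open>x > 0\<close> by (metis exp_gt_zero ln_exp ln_less_cancel_iff of_nat_0_less_iff)
  ultimately show ?thesis by blast
qed

text \<open>
  Summing over all characters gives a nonnegative quantity, so at most one nonprincipal character
  can contribute \<open>- ln x\<close>. A vanishing \<open>L(1, \<chi>)\<close> also kills \<open>L(1, cnj \<chi>)\<close>, which forces \<open>\<chi>\<close> to be real.
\<close>

lemma dchar_L_nonzero:
  assumes N: "squarefree N" and "nonprincipal_dchar N \<chi>"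
  shows "nonprincipal_dchar.L \<chi> \<noteq> 0"
proof
  assume L0: "nonprincipal_dchar.L \<chi> = 0"
  let ?X = "{\<chi>. dchar N \<chi>}" and ?L = nonprincipal_dchar.L
  have N0: "N > 0" using N by (intro Nat.gr0I) auto
  have fin: "finite ?X" using finite_dchars[OF N0] .
  interpret nonprincipal_dchar N \<chi> by fact
  define \<psi> where "\<psi> = (\<lambda>n. cnj (\<chi> n))"
  have "\<psi> \<noteq> principal_dchar N"
  proof
    assume *: "\<psi> = principal_dchar N"
    have "\<chi> n = principal_dchar N n" for n
      using fun_cong[OF *, of n]
      by (cases "coprime n N") (simp_all add: \<psi>_def principal_dchar_def complex_eq_iff)
    thus False using nonprincipal by blast
  qed
  hence nonpr: "nonprincipal_dchar N \<psi>"
    using dchar_cnj[OF dchar] N0 by (auto simp: nonprincipal_dchar_def \<psi>_def)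
  interpret c: nonprincipal_dchar N \<psi> by fact
  have "c.P = (\<lambda>x. cnj (P x))" unfolding c.P_def P_def by (simp add: \<psi>_def)
  hence "c.P \<longlonglongrightarrow> cnj L" using tendsto_cnj[OF P_tendsto_L] by simp
  hence cL: "c.L = 0" using c.P_tendsto_L LIMSEQ_unique L0 by fastforce
  have neq: "\<psi> \<noteq> \<chi>" using L_nonzero_if_real L0 by (metis \<psi>_def)
  \<comment> \<open>The coefficient of ln x in the growth of each character sum.\<close>
  define k :: "(nat \<Rightarrow> complex) \<Rightarrow> real" where
    "k = (\<lambda>\<chi>. if \<chi> = principal_dchar N then 1 else if ?L \<chi> = 0 then - 1 else 0)"
  have "\<forall>\<chi>\<in>?X. \<exists>B. \<forall>x>0. norm (mangoldt_sum_dchar \<chi> x - of_real (k \<chi> * ln (real x))) \<le> B"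
  proof safe
    fix \<chi> assume "dchar N \<chi>"
    thus "\<exists>B. \<forall>x>0. norm (mangoldt_sum_dchar \<chi> x - of_real (k \<chi> * ln (real x))) \<le> B"
      using mangoldt_sum_principal[OF N0] mangoldt_sum_nonprincipal[of N \<chi>] N0
      by (cases "\<chi> = principal_dchar N"; cases "?L \<chi> = 0") (auto simp: k_def nonprincipal_dchar_def)
  qed
  then obtain B where B: "norm (mangoldt_sum_dchar \<chi> x - of_real (k \<chi> * ln (real x))) \<le> B \<chi>"
    if "\<chi> \<in> ?X" "x > 0" for \<chi> x by metis
  \<comment> \<open>The principal character contributes 1, \<chi> and its conjugate contribute - 1
    each, and no other character contributes a positive amount.\<close>
  have ksum: "(\<Sum>\<chi>\<in>?X. k \<chi>) \<le> - 1"
  proof -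
    let ?T = "{principal_dchar N, \<chi>, \<psi>}"
    have sub: "?T \<subseteq> ?X" using dchar c.dchar dchar_principal by auto
    have "(\<Sum>\<chi>\<in>?X. k \<chi>) = (\<Sum>\<chi>\<in>?T. k \<chi>) + (\<Sum>\<chi>\<in>?X - ?T. k \<chi>)"
      using sum.subset_diff[OF sub fin, of k] by simp
    also have "(\<Sum>\<chi>\<in>?X - ?T. k \<chi>) \<le> 0" by (intro sum_nonpos) (auto simp: k_def)
    also have "(\<Sum>\<chi>\<in>?T. k \<chi>) = - 1"
      using neq nonprincipal c.nonprincipal L0 cL by (simp add: k_def)
    finally show ?thesis by simp
  qed
  obtain x where x: "x > 0" "(\<Sum>\<chi>\<in>?X. B \<chi>) < ln (real x)" using ln_real_unbounded by blast
  have "norm (\<Sum>\<chi>\<in>?X. mangoldt_sum_dchar \<chi> x - of_real (k \<chi> * ln (real x))) \<le> (\<Sum>\<chi>\<in>?X. B \<chi>)"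
    using B x by (intro sum_norm_le) auto
  moreover have "(\<Sum>\<chi>\<in>?X. mangoldt_sum_dchar \<chi> x - of_real (k \<chi> * ln (real x))) =
      (\<Sum>\<chi>\<in>?X. \<chi> 1 * mangoldt_sum_dchar \<chi> x) - of_real ((\<Sum>\<chi>\<in>?X. k \<chi>) * ln (real x))"
    by (simp add: sum_subtractf sum_distrib_right dcharD(1))
  ultimately have "norm ((\<Sum>\<chi>\<in>?X. \<chi> 1 * mangoldt_sum_dchar \<chi> x) - of_real ((\<Sum>\<chi>\<in>?X. k \<chi>) * ln (real x))) < ln (real x)"
    using x by simp
  hence "Re ((\<Sum>\<chi>\<in>?X. \<chi> 1 * mangoldt_sum_dchar \<chi> x) - of_real ((\<Sum>\<chi>\<in>?X. k \<chi>) * ln (real x))) < ln (real x)"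
    using complex_Re_le_cmod order.strict_trans1 by blast
  hence "Re (\<Sum>\<chi>\<in>?X. \<chi> 1 * mangoldt_sum_dchar \<chi> x) < ln (real x) + (\<Sum>\<chi>\<in>?X. k \<chi>) * ln (real x)"
    by simp
  also have "\<dots> \<le> ln (real x) + (- 1) * ln (real x)"
    using x ksum by (intro add_left_mono mult_right_mono) auto
  finally have "Re (\<Sum>\<chi>\<in>?X. \<chi> 1 * mangoldt_sum_dchar \<chi> x) < 0" by simp
  moreover have "Re (\<Sum>\<chi>\<in>?X. \<chi> 1 * mangoldt_sum_dchar \<chi> x) \<ge> 0"
    unfolding sum_dchars_mangoldt[OF N]
    by (auto intro!: mult_nonneg_nonneg sum_nonneg divide_nonneg_nonneg mangoldt_nonneg)
  ultimately show False by simp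
qed

text \<open>With b inverse to a, orthogonality isolates the sum of \<open>mangoldt n / n\<close>
  over n congruent to a. Only the principal character grows, like ln x, so this sum is unbounded;
  finitely many primes plus all nonprimes would bound it by K.\<close>

theorem dirichlet_squarefree_modulus:
  fixes N a :: nat
  assumes N: "squarefree N" and a: "coprime a N"
  shows "infinite {p. prime p \<and> [p = a] (mod N)}"
proof
  assume fin_primes: "finite {p. prime p \<and> [p = a] (mod N)}"
  let ?X = "{\<chi>. dchar N \<chi>}"
  have N0: "N > 0" using N by (intro Nat.gr0I) auto
  have fin: "finite ?X" using finite_dchars[OF N0] .
  obtain b where b: "[a * b = 1] (mod N)" using cong_solve_coprime_nat[OF a] by auto
  have ab: "[n = a] (mod N)" if "[b * n = 1] (mod N)" for n
  proof -
    have "[a * (b * n) = a * 1] (mod N)" using that by (rule cong_scalar_left)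
    moreover have "[(a * b) * n = 1 * n] (mod N)" using b by (rule cong_scalar_right)
    ultimately show ?thesis by (metis cong_sym cong_trans mult.assoc mult_1 mult.right_neutral)
  qed
  have "\<forall>\<chi>\<in>?X. \<exists>B. \<forall>x>0. norm (mangoldt_sum_dchar \<chi> x - of_bool (\<chi> = principal_dchar N) * of_real (ln (real x))) \<le> B"
  proof safe
    fix \<chi> assume "dchar N \<chi>"
    thus "\<exists>B. \<forall>x>0. norm (mangoldt_sum_dchar \<chi> x - of_bool (\<chi> = principal_dchar N) * of_real (ln (real x))) \<le> B"
      using mangoldt_sum_principal[OF N0] mangoldt_sum_nonprincipal[of N \<chi>] N0 dchar_L_nonzero[OF N, of \<chi>]
      by (cases "\<chi> = principal_dchar N") (auto simp: nonprincipal_dchar_def)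
  qed
  then obtain B where B: "norm (mangoldt_sum_dchar \<chi> x - of_bool (\<chi> = principal_dchar N) * of_real (ln (real x))) \<le> B \<chi>"
    if "\<chi> \<in> ?X" "x > 0" for \<chi> x by metis
  define K where "K = (\<Sum>p | prime p \<and> [p = a] (mod N). mangoldt p / real p) + (8::real)"
  obtain x where x: "x > 0" "(\<Sum>\<chi>\<in>?X. B \<chi>) + real (card ?X) * K < ln (real x)"
    using ln_real_unbounded by blast
  have "norm (\<Sum>\<chi>\<in>?X. \<chi> b * (mangoldt_sum_dchar \<chi> x - of_bool (\<chi> = principal_dchar N) * of_real (ln (real x)))) \<le> (\<Sum>\<chi>\<in>?X. 1 * B \<chi>)"
    unfolding norm_mult [symmetric]
  proof (intro sum_norm_le)
    fix \<chi> assume "\<chi> \<in> ?X"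
    thus "norm (\<chi> b * (mangoldt_sum_dchar \<chi> x - of_bool (\<chi> = principal_dchar N) * of_real (ln (real x)))) \<le> 1 * B \<chi>"
      unfolding norm_mult using x B norm_dchar_le_1[OF _ N0] by (intro mult_mono) auto
  qed
  moreover have "(\<Sum>\<chi>\<in>?X. \<chi> b * (mangoldt_sum_dchar \<chi> x - of_bool (\<chi> = principal_dchar N) * of_real (ln (real x)))) =
      (\<Sum>\<chi>\<in>?X. \<chi> b * mangoldt_sum_dchar \<chi> x) - of_real (ln (real x))"
  proof -
    have cop: "coprime b N"
      using b by (metis cong_imp_coprime cong_sym coprime_1_left coprime_mult_left_iff)
    have "(\<Sum>\<chi>\<in>?X. \<chi> b * (of_bool (\<chi> = principal_dchar N) * of_real (ln (real x)))) =
          (\<Sum>\<chi>\<in>{principal_dchar N}. \<chi> b * of_real (ln (real x)))"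
      using fin by (intro sum.mono_neutral_cong_right) (auto simp: dchar_principal)
    also have "\<dots> = of_real (ln (real x))" using cop by (simp add: principal_dchar_def)
    finally show ?thesis by (simp add: right_diff_distrib sum_subtractf)
  qed
  ultimately have "norm ((\<Sum>\<chi>\<in>?X. \<chi> b * mangoldt_sum_dchar \<chi> x) - of_real (ln (real x))) \<le> (\<Sum>\<chi>\<in>?X. B \<chi>)"
    by simp
  hence "\<bar>real (card ?X) * (\<Sum>n | n \<in> {1..x} \<and> [b * n = 1] (mod N). mangoldt n / real n) - ln (real x)\<bar> \<le> (\<Sum>\<chi>\<in>?X. B \<chi>)"
    unfolding sum_dchars_mangoldt[OF N] of_real_diff [symmetric] norm_of_real .
  hence "ln (real x) - (\<Sum>\<chi>\<in>?X. B \<chi>) \<le>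
      real (card ?X) * (\<Sum>n | n \<in> {1..x} \<and> [b * n = 1] (mod N). mangoldt n / real n)"
    by linarith
  also have "(\<Sum>n | n \<in> {1..x} \<and> [b * n = 1] (mod N). mangoldt n / real n) \<le> K"
  proof -
    have "(\<Sum>n | n \<in> {1..x} \<and> [b * n = 1] (mod N). mangoldt n / real n) \<le>
      (\<Sum>n\<in>{p. prime p \<and> [p = a] (mod N)} \<union> {d. d \<in> {1..x} \<and> \<not> prime d}. mangoldt n / real n)"
      using fin_primes ab by (intro sum_mono2) (auto intro!: divide_nonneg_nonneg mangoldt_nonneg)
    also have "\<dots> = (\<Sum>p | prime p \<and> [p = a] (mod N). mangoldt p / real p) +
        (\<Sum>d | d \<in> {1..x} \<and> \<not> prime d. mangoldt d / real d)"
      using fin_primes by (intro sum.union_disjoint) auto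
    also have "\<dots> \<le> K" using sum_mangoldt_nonprime_le[of x] by (simp add: K_def)
    finally show ?thesis .
  qed
  finally show False using x by (simp add: mult_left_mono)
qed

section \<open>Ternary cyclotomic polynomials\<close>

abbreviation xpow_minus_1 :: "nat \<Rightarrow> complex poly" where
  "xpow_minus_1 n \<equiv> monom 1 n - 1"

lemma cyclotomic_poly_altdef:
  "cyclotomic_poly n = (\<Prod>j\<in>{j\<in>{1..n}. coprime j n}. [:- cis (2 * pi * real j / real n), 1:])"
  by (simp add: cyclotomic_poly_def cis_conv_exp mult_ac)

lemma degree_prod_linear: "degree (\<Prod>a\<in>A. [:- f a, 1 :: complex:]) = card A"
  by (subst degree_prod_eq_sum_degree) auto

lemma lead_coeff_prod_linear: "lead_coeff (\<Prod>a\<in>A. [:- f a, 1 :: complex:]) = 1"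
  by (simp add: lead_coeff_prod)

text \<open>Both sides are monic of degree n, so a nonzero difference would have degree below n and
  yet vanish at all n roots of unity. The index range 1..n, with k = n in place of 0, matches the
  definition of \<open>cyclotomic_poly\<close>.\<close>

lemma xpow_minus_1_eq_prod:
  assumes "n > 0"
  shows "xpow_minus_1 n = (\<Prod>k\<in>{1..n}. [:- cis (2 * pi * real k / real n), 1:])"
proof (rule ccontr)
  let ?R = "\<Prod>k\<in>{1..n}. [:- cis (2 * pi * real k / real n), 1:]"
  define D where "D = xpow_minus_1 n - ?R"
  assume "xpow_minus_1 n \<noteq> ?R"
  hence D0: "D \<noteq> 0" by (simp add: D_def)
  have degX: "degree (xpow_minus_1 n) = n" "lead_coeff (xpow_minus_1 n) = 1"
  proof -
    show *: "degree (xpow_minus_1 n) = n"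
      using assms by (intro antisym degree_diff_le le_degree) (auto simp: degree_monom_eq)
    show "lead_coeff (xpow_minus_1 n) = 1" unfolding * using assms by simp
  qed
  have degR: "degree ?R = n" "lead_coeff ?R = 1"
    by (simp only: degree_prod_linear card_atLeastAtMost) (simp, rule lead_coeff_prod_linear)
  have "degree D < n"
  proof (rule ccontr)
    assume "\<not> degree D < n"
    moreover have "degree D \<le> n" unfolding D_def by (rule degree_diff_le) (use degX degR in auto)
    ultimately have "degree D = n" by simp
    hence "lead_coeff D = lead_coeff (xpow_minus_1 n) - lead_coeff ?R"
      unfolding D_def degX(1) degR(1) by simp
    thus False using D0 degX(2) degR(2) by simp
  qed
  moreover have "{z. z ^ n = 1} \<subseteq> {z. poly D z = 0}"
  proof safe
    fix z :: complex assume z: "z ^ n = 1"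
    then obtain k where k: "k < n" "z = cis (2 * pi * real k / real n)"
      using bij_betw_roots_unity[OF assms] by (auto simp: bij_betw_def)
    have "\<exists>j\<in>{1..n}. z = cis (2 * pi * real j / real n)"
    proof (cases "k = 0")
      case True
      thus ?thesis using k assms by (intro bexI[of _ n]) auto
    qed (use k in \<open>auto intro!: bexI[of _ k]\<close>)
    hence "poly ?R z = 0" by (auto simp: poly_prod intro!: prod_zero)
    thus "poly D z = 0" using z by (simp add: D_def poly_monom)
  qed
  hence "card {z::complex. z ^ n = 1} \<le> card {z. poly D z = 0}"
    using D0 by (intro card_mono poly_roots_finite)
  moreover have "card {z. poly D z = 0} \<le> degree D" using D0 by (rule card_poly_roots_bound)
  ultimately show False using card_roots_unity_eq[OF assms] by simp
qed

text \<open>Grouping the n-th roots of unity by exact order amounts to writing k / n in lowest terms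
  j / d.\<close>

lemma prod_cyclotomic_poly:
  assumes "n > 0"
  shows "(\<Prod>d | d dvd n. cyclotomic_poly d) = xpow_minus_1 n"
proof -
  let ?T = "\<lambda>d. {j\<in>{1..d}. coprime j d}"
  have "(\<Prod>d | d dvd n. cyclotomic_poly d) =
     (\<Prod>(d, j)\<in>Sigma {d. d dvd n} ?T. [:- cis (2 * pi * real j / real d), 1:])"
    unfolding cyclotomic_poly_altdef using assms by (intro prod.Sigma) auto
  also have "\<dots> = (\<Prod>k\<in>{1..n}. [:- cis (2 * pi * real k / real n), 1:])"
  proof (rule prod.reindex_bij_witness[where i = "\<lambda>k. (n div gcd k n, k div gcd k n)" and j = "\<lambda>(d, j). n div d * j"])
    fix x assume "x \<in> Sigma {d. d dvd n} ?T"
    then obtain d j where x: "x = (d, j)" "d dvd n" "1 \<le> j" "j \<le> d" "coprime j d" by auto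
    then obtain e where e: "n = d * e" by auto
    have pos: "d > 0" "e > 0" using e assms by auto
    have g: "gcd (e * j) (d * e) = e"
      using x(5) by (metis coprime_imp_gcd_eq_1 gcd_mult_distrib_nat mult.commute mult.right_neutral)
    show "(n div gcd (case x of (d, j) \<Rightarrow> n div d * j) n, (case x of (d, j) \<Rightarrow> n div d * j) div gcd (case x of (d, j) \<Rightarrow> n div d * j) n) = x"
      using x e pos g by simp
    show "(case x of (d, j) \<Rightarrow> n div d * j) \<in> {1..n}"
      using x e pos by (simp add: mult.commute)
    show "[:- cis (2 * pi * real (case x of (d, j) \<Rightarrow> n div d * j) / real n), 1:] =
        (case x of (d, j) \<Rightarrow> [:- cis (2 * pi * real j / real d), 1:])"
      using x e pos by (simp add: field_simps)
  next
    fix k assume k: "k \<in> {1..n}"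
    define g where "g = gcd k n"
    have g: "g dvd k" "g dvd n" "g > 0" using k by (auto simp: g_def)
    have "coprime (k div g) (n div g)" unfolding g_def using k by (intro div_gcd_coprime) auto
    moreover have "k div g \<le> n div g" using k by (intro div_le_mono) auto
    moreover have "k div g > 0" using g k by (auto simp: div_greater_zero_iff dvd_imp_le)
    ultimately show "(n div gcd k n, k div gcd k n) \<in> Sigma {d. d dvd n} ?T"
      using g by (auto simp: g_def [symmetric])
    show "(case (n div gcd k n, k div gcd k n) of (d, j) \<Rightarrow> n div d * j) = k"
      using g assms unfolding g_def [symmetric] by (auto elim!: dvdE)
  qed
  also have "\<dots> = xpow_minus_1 n" by (rule xpow_minus_1_eq_prod [OF assms, symmetric])
  finally show ?thesis .
qed

lemma prod_divisors_prime_mult: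
  fixes f :: "nat \<Rightarrow> 'a::comm_monoid_mult"
  assumes "prime p" "\<not> p dvd m"
  shows "(\<Prod>d | d dvd p * m. f d) = (\<Prod>d | d dvd m. f d * f (p * d))"
proof -
  have m: "m > 0" using assms by (intro Nat.gr0I) auto
  have "prod f {d. d dvd p * m} = prod f ({d. d dvd m} \<union> (*) p ` {d. d dvd m})"
    using divisors_prime_power_mult[OF assms, of 0] by simp
  also have "\<dots> = prod f {d. d dvd m} * prod f ((*) p ` {d. d dvd m})"
    using assms m by (intro prod.union_disjoint) (auto dest: dvd_mult_left simp: prime_gt_0_nat)
  also have "prod f ((*) p ` {d. d dvd m}) = (\<Prod>d | d dvd m. f (p * d))"
    using assms(1) by (subst prod.reindex) (auto simp: inj_on_def)
  finally show ?thesis by (simp add: prod.distrib)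
qed

text \<open>The Moebius product formula in cross-multiplied form, which avoids polynomial division:
  every factor expands into cyclotomic polynomials and the two sides agree.\<close>

lemma cyclotomic_poly_ternary:
  assumes "prime p" "prime q" "prime r" "p \<noteq> q" "p \<noteq> r" "q \<noteq> r"
  shows "cyclotomic_poly (p * q * r) * xpow_minus_1 1 * xpow_minus_1 (p * q) * xpow_minus_1 (p * r) * xpow_minus_1 (q * r) =
     xpow_minus_1 (p * q * r) * xpow_minus_1 p * xpow_minus_1 q * xpow_minus_1 r"
proof -
  have nd: "\<not> p dvd q" "\<not> p dvd r" "\<not> q dvd r" "\<not> p dvd q * r"
    using assms by (auto simp: primes_dvd_imp_eq prime_dvd_mult_iff)
  have pos: "p > 0" "q > 0" "r > 0" using assms by (auto simp: prime_gt_0_nat)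
  have nu: "\<not> p dvd 1" "\<not> q dvd 1" "\<not> r dvd 1" using assms by auto
  note exp = prod_divisors_prime_mult[OF assms(1)] prod_divisors_prime_mult[OF assms(2)] prod_divisors_prime_mult[OF assms(3)]
  let ?f = cyclotomic_poly
  have "xpow_minus_1 1 = ?f 1" by (subst prod_cyclotomic_poly [symmetric]) auto
  moreover have X1: "xpow_minus_1 p = ?f 1 * ?f p" 
    using exp(1)[OF nu(1), of ?f] pos by (simp add: prod_cyclotomic_poly)
  moreover have "xpow_minus_1 q = ?f 1 * ?f q"
    using exp(2)[OF nu(2), of ?f] pos by (simp add: prod_cyclotomic_poly)
  moreover have r: "(\<Prod>d | d dvd r. f d) = f 1 * f r" for f :: "nat \<Rightarrow> complex poly"
    using exp(3)[OF nu(3), of f] by simp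
  moreover have q: "(\<Prod>d | d dvd q. f d) = f 1 * f q" for f :: "nat \<Rightarrow> complex poly"
    using exp(2)[OF nu(2), of f] by simp
  moreover have "xpow_minus_1 r = ?f 1 * ?f r" using r[of ?f] pos by (simp add: prod_cyclotomic_poly)
  moreover have "xpow_minus_1 (p * q) = ?f 1 * ?f p * (?f q * ?f (p * q))"
    using exp(1)[OF nd(1), of ?f] pos unfolding q by (simp add: prod_cyclotomic_poly)
  moreover have "xpow_minus_1 (p * r) = ?f 1 * ?f p * (?f r * ?f (p * r))"
    using exp(1)[OF nd(2), of ?f] pos unfolding r by (simp add: prod_cyclotomic_poly)
  moreover have "xpow_minus_1 (q * r) = ?f 1 * ?f q * (?f r * ?f (q * r))"
    using exp(2)[OF nd(3), of ?f] pos unfolding r by (simp add: prod_cyclotomic_poly)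
  moreover have "xpow_minus_1 (p * q * r) = ?f 1 * ?f p * (?f q * ?f (p * q)) * (?f r * ?f (p * r) * (?f (q * r) * ?f (p * q * r)))"
    using exp(1)[OF nd(4), of ?f] pos unfolding exp(2)[OF nd(3)] r
    by (simp add: prod_cyclotomic_poly mult.assoc)
  ultimately show ?thesis by (simp add: mult_ac)
qed

section \<open>Coefficients from a quotient by 1 - x^M\<close>

text \<open>Dividing by 1 - x^M repeats each shifted copy of W with period M. As W has degree below
  M the repetitions do not overlap, so the copy starting at r * i contributes a single coefficient
  of W.\<close>

lemma coeff_periodic_quotient:
  fixes A W :: "'a::comm_ring_1 poly"
  assumes M: "M > 0" and W: "\<And>j. j \<ge> M \<Longrightarrow> coeff W j = 0"
    and eq: "A * (1 - monom 1 M) = (\<Sum>i<K. monom (c i) (r * i)) * W"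
  shows "coeff A n = (\<Sum>i<K. if r * i \<le> n then c i * coeff W ((n - r * i) mod M) else 0)"
proof (induction n rule: less_induct)
  case (less n)
  have rhs: "coeff ((\<Sum>i<K. monom (c i) (r * i)) * W) n =
      (\<Sum>i<K. if r * i \<le> n then c i * coeff W (n - r * i) else 0)"
    unfolding sum_distrib_right coeff_sum
    by (intro sum.cong refl) (auto simp: coeff_monom_mult)
  have lhs: "coeff (A * (1 - monom 1 M)) n = coeff A n - (if M \<le> n then coeff A (n - M) else 0)"
    by (simp add: right_diff_distrib mult.commute[of A "monom 1 M"] coeff_monom_mult)
  have "coeff A n = (\<Sum>i<K. if r * i \<le> n then c i * coeff W (n - r * i) else 0) +
      (if M \<le> n then coeff A (n - M) else 0)"
    using lhs unfolding eq rhs by (simp add: eq_diff_eq)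
  also have "\<dots> = (\<Sum>i<K. (if r * i \<le> n then c i * coeff W (n - r * i) else 0) +
      (if M + r * i \<le> n then c i * coeff W ((n - M - r * i) mod M) else 0))"
  proof (cases "M \<le> n")
    case True
    have "coeff A (n - M) = (\<Sum>i<K. if r * i \<le> n - M then c i * coeff W ((n - M - r * i) mod M) else 0)"
      using True M by (intro less.IH) auto
    also have "\<dots> = (\<Sum>i<K. if M + r * i \<le> n then c i * coeff W ((n - M - r * i) mod M) else 0)"
      using True by (intro sum.cong refl if_cong) auto
    finally show ?thesis using True by (simp add: sum.distrib)
  qed auto
  also have "\<dots> = (\<Sum>i<K. if r * i \<le> n then c i * coeff W ((n - r * i) mod M) else 0)"
  proof (intro sum.cong refl)
    fix i
    show "(if r * i \<le> n then c i * coeff W (n - r * i) else 0) +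
      (if M + r * i \<le> n then c i * coeff W ((n - M - r * i) mod M) else 0) =
      (if r * i \<le> n then c i * coeff W ((n - r * i) mod M) else 0)"
    proof (cases "M + r * i \<le> n")
      case True
      hence "coeff W (n - r * i) = 0" by (intro W) simp
      moreover have "(n - M - r * i) mod M = (n - r * i) mod M"
        using True by (metis add.commute diff_diff_left le_add_diff_inverse2 le_mod_geq add_le_imp_le_diff)
      ultimately show ?thesis using True by simp
    next
      case False
      hence "(n - r * i) mod M = n - r * i" if "r * i \<le> n" using that by (intro mod_less) linarith
      thus ?thesis using False by simp
    qed
  qed
  finally show ?case .
qed

section \<open>Explicit coefficients of binary cyclotomic polynomials\<close>

lemma sum_power_int_interval:
  fixes Y :: "'a::comm_ring_1"
  assumes "0 \<le> a" "a \<le> c"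
  shows "(\<Sum>k\<in>{a..<c}. Y ^ nat k) * (Y - 1) = Y ^ nat c - Y ^ nat a"
  using assms(2)
proof (induction c rule: int_ge_induct)
  case (step c)
  have "{a..<c + 1} = insert c {a..<c}" using step by auto
  hence "(\<Sum>k\<in>{a..<c + 1}. Y ^ nat k) * (Y - 1) = Y ^ nat c * (Y - 1) + (\<Sum>k\<in>{a..<c}. Y ^ nat k) * (Y - 1)"
    by (simp add: distrib_right)
  also have "\<dots> = Y ^ nat (c + 1) - Y ^ nat a"
    using step assms by (simp add: nat_add_distrib algebra_simps)
  finally show ?case .
qed auto

text \<open>
  In this locale \<open>pb\<close> is the inverse of \<open>p\<close> modulo \<open>q\<close> and \<open>sg\<close> is the inverse of \<open>q\<close> modulo \<open>p\<close>.
  A residue \<open>x\<close> modulo \<open>p * q\<close> is described by coordinates with \<open>x \<equiv> al x * p + be x * q\<close>, and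
  \<open>b i\<close> for \<open>0 \<le> i < p * q\<close> is the \<open>i\<close>-th coefficient of the binary cyclotomic polynomial.
\<close>

locale binary_pair =
  fixes p q pb sg :: int
  assumes bezout: "p * pb + q * sg = p * q + 1"
    and pb: "0 < pb" "pb < q" and sg: "0 < sg" "sg < p"
begin

definition al :: "int \<Rightarrow> int" where "al x = (x * pb) mod q"
definition be :: "int \<Rightarrow> int" where "be x = (x * sg) mod p"

definition b :: "int \<Rightarrow> int" where
  "b x = (if al x < pb \<and> be x < sg then 1 else if al x \<ge> pb \<and> be x \<ge> sg then - 1 else 0)"

lemma pq_pos: "0 < p" "0 < q" using pb sg by auto

lemma cong_pb: "[p * pb = 1] (mod q)"
proof -
  have "p * pb = 1 + q * (p - sg)" using bezout by (simp add: algebra_simps)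
  thus ?thesis by (simp add: cong_def)
qed

lemma cong_sg: "[q * sg = 1] (mod p)"
proof -
  have "q * sg = 1 + p * (q - pb)" using bezout by (simp add: algebra_simps)
  thus ?thesis by (simp add: cong_def)
qed

lemma coprime_pq: "coprime p q"
  using cong_pb by (metis coprime_iff_invertible_int)

lemma al_range: "0 \<le> al x" "al x < q" and be_range: "0 \<le> be x" "be x < p"
  using pq_pos by (auto simp: al_def be_def)

lemma al_combine: "0 \<le> \<alpha> \<Longrightarrow> \<alpha> < q \<Longrightarrow> al (\<alpha> * p + \<beta> * q) = \<alpha>"
proof -
  assume \<alpha>: "0 \<le> \<alpha>" "\<alpha> < q"
  have "[(\<alpha> * p + \<beta> * q) * pb = \<alpha> * (p * pb) + q * (\<beta> * pb)] (mod q)"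
    by (simp add: algebra_simps)
  also have "[\<alpha> * (p * pb) + q * (\<beta> * pb) = \<alpha> * 1 + 0] (mod q)"
    by (intro cong_add cong_mult cong_pb) (auto simp: cong_def)
  finally show ?thesis using \<alpha> by (simp add: al_def cong_def)
qed

lemma be_combine: "0 \<le> \<beta> \<Longrightarrow> \<beta> < p \<Longrightarrow> be (\<alpha> * p + \<beta> * q) = \<beta>"
proof -
  assume \<beta>: "0 \<le> \<beta>" "\<beta> < p"
  have "[(\<alpha> * p + \<beta> * q) * sg = \<beta> * (q * sg) + p * (\<alpha> * sg)] (mod p)"
    by (simp add: algebra_simps)
  also have "[\<beta> * (q * sg) + p * (\<alpha> * sg) = \<beta> * 1 + 0] (mod p)"
    by (intro cong_add cong_mult cong_sg) (auto simp: cong_def)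
  finally show ?thesis using \<beta> by (simp add: be_def cong_def)
qed

lemma combine_al_be: "[al x * p + be x * q = x] (mod p * q)"
proof (rule coprime_cong_mult)
  have "[al x * p + be x * q = be x * q] (mod p)" by (simp add: cong_def)
  also have "[be x * q = x * sg * q] (mod p)" by (intro cong_mult) (auto simp: be_def)
  also have "[x * sg * q = x * 1] (mod p)"
    using cong_mult[OF cong_refl cong_sg, of x] by (simp add: mult_ac)
  finally show "[al x * p + be x * q = x] (mod p)" by simp
  have "[al x * p + be x * q = al x * p] (mod q)" by (simp add: cong_def)
  also have "[al x * p = x * pb * p] (mod q)" by (intro cong_mult) (auto simp: al_def)
  also have "[x * pb * p = x * 1] (mod q)"
    using cong_mult[OF cong_refl cong_pb, of x] by (simp add: mult_ac)
  finally show "[al x * p + be x * q = x] (mod q)" by simp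
qed (rule coprime_pq)

text \<open>Bezout puts the corner \<open>(pb, sg)\<close> at exponent \<open>p * q + 1\<close>. The
  largest corner of the low rectangle therefore has exponent \<open>p * q + 1 - p - q\<close>, and
  reduction modulo \<open>p * q\<close> is trivial there; on the opposite rectangle it subtracts
  exactly \<open>p * q\<close>.\<close>

lemma combine_low: "0 \<le> \<alpha> \<Longrightarrow> \<alpha> < pb \<Longrightarrow> 0 \<le> \<beta> \<Longrightarrow> \<beta> < sg \<Longrightarrow> \<alpha> * p + \<beta> * q < p * q"
proof -
  assume "0 \<le> \<alpha>" "\<alpha> < pb" "0 \<le> \<beta>" "\<beta> < sg"
  hence "\<alpha> * p \<le> (pb - 1) * p" "\<beta> * q \<le> (sg - 1) * q" using pq_pos by (auto intro!: mult_right_mono)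
  thus ?thesis using bezout pq_pos pb sg by (simp add: algebra_simps)
qed

lemma combine_high:
  assumes "pb \<le> \<alpha>" "\<alpha> < q" "sg \<le> \<beta>" "\<beta> < p"
  shows "p * q < \<alpha> * p + \<beta> * q" "\<alpha> * p + \<beta> * q < 2 * (p * q)"
proof -
  have "pb * p \<le> \<alpha> * p" "sg * q \<le> \<beta> * q" using assms pq_pos by (auto intro!: mult_right_mono)
  thus "p * q < \<alpha> * p + \<beta> * q" using bezout by (simp add: algebra_simps)
  have "\<alpha> * p \<le> q * p" "\<beta> * q < p * q" using assms pq_pos by (auto intro!: mult_right_mono)
  thus "\<alpha> * p + \<beta> * q < 2 * (p * q)" by (simp add: algebra_simps)
qed

lemma mod_low:
  assumes "al x < pb" "be x < sg"
  shows "x mod (p * q) = al x * p + be x * q"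
proof -
  have "0 \<le> al x * p + be x * q" using al_range[of x] be_range[of x] pq_pos by simp
  moreover have "al x * p + be x * q < p * q" using assms al_range[of x] be_range[of x] by (intro combine_low)
  ultimately show ?thesis using combine_al_be[of x] by (simp add: cong_def)
qed

lemma mod_high:
  assumes "pb \<le> al x" "sg \<le> be x"
  shows "x mod (p * q) = al x * p + be x * q - p * q"
proof -
  have "[al x * p + be x * q - p * q = x - 0] (mod p * q)"
    by (intro cong_diff combine_al_be) (auto simp: cong_def)
  moreover have "0 \<le> al x * p + be x * q - p * q" "al x * p + be x * q - p * q < p * q"
    using combine_high[OF assms(1) al_range(2) assms(2) be_range(2)] by auto
  ultimately show ?thesis by (metis cong_def diff_zero mod_pos_pos_trivial)
qed

text \<open>The positive and the negative indices form two rectangles, so each part is a product of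
  geometric sums in Y and Z. Multiplication by M undoes the shift by \<open>p * q\<close> on the
  negative rectangle, and everything collapses through Y^q = Z^p = M and Y^pb * Z^sg = M * x. Stated
  for an element of any integral domain, it can be evaluated at the monomial x^r.\<close>

lemma b_identity:
  fixes x :: "'a::idom"
  assumes x: "x \<noteq> 0"
  shows "(\<Sum>i\<in>{0..<p * q}. of_int (b i) * x ^ nat i) * (x ^ nat p - 1) * (x ^ nat q - 1) =
    (x ^ nat (p * q) - 1) * (x - 1)"
proof -
  define Y Z M where "Y = x ^ nat p" and "Z = x ^ nat q" and "M = x ^ nat (p * q)"
  define Ip Im where "Ip = {i\<in>{0..<p * q}. b i = 1}" and "Im = {i\<in>{0..<p * q}. b i = - 1}"
  let ?B = "\<Sum>i\<in>{0..<p * q}. of_int (b i) * x ^ nat i"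
  have YZ: "x ^ nat (\<alpha> * p + \<beta> * q) = Y ^ nat \<alpha> * Z ^ nat \<beta>" if "0 \<le> \<alpha>" "0 \<le> \<beta>" for \<alpha> \<beta>
  proof -
    have "nat (\<alpha> * p + \<beta> * q) = nat p * nat \<alpha> + nat q * nat \<beta>"
      using that pq_pos by (simp add: nat_add_distrib nat_mult_distrib mult.commute)
    thus ?thesis by (simp add: Y_def Z_def power_add power_mult)
  qed
  have "?B = (\<Sum>i\<in>{0..<p * q}. (if b i = 1 then x ^ nat i else 0) - (if b i = - 1 then x ^ nat i else 0))"
    by (intro sum.cong refl) (auto simp: b_def)
  also have "\<dots> = (\<Sum>i\<in>Ip. x ^ nat i) - (\<Sum>i\<in>Im. x ^ nat i)"
    by (simp only: Ip_def Im_def sum.inter_filter[OF finite_atLeastLessThan_int] sum_subtractf)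
  finally have B: "?B = (\<Sum>i\<in>Ip. x ^ nat i) - (\<Sum>i\<in>Im. x ^ nat i)" .
  have "(\<Sum>i\<in>Ip. x ^ nat i) = (\<Sum>(\<alpha>, \<beta>)\<in>{0..<pb} \<times> {0..<sg}. Y ^ nat \<alpha> * Z ^ nat \<beta>)"
  proof (rule sum.reindex_bij_witness[where i = "\<lambda>(\<alpha>, \<beta>). \<alpha> * p + \<beta> * q" and j = "\<lambda>i. (al i, be i)"])
    fix i assume "i \<in> Ip"
    hence i: "0 \<le> i" "i < p * q" "al i < pb" "be i < sg" by (auto simp: Ip_def b_def split: if_splits)
    show "(case (al i, be i) of (\<alpha>, \<beta>) \<Rightarrow> \<alpha> * p + \<beta> * q) = i" using mod_low[of i] i by simp
    show "(al i, be i) \<in> {0..<pb} \<times> {0..<sg}" using i al_range be_range by auto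
    have "x ^ nat i = x ^ nat (al i * p + be i * q)"
      using mod_low[of i] i by simp
    also have "\<dots> = Y ^ nat (al i) * Z ^ nat (be i)" by (intro YZ al_range be_range)
    finally show "(case (al i, be i) of (\<alpha>, \<beta>) \<Rightarrow> Y ^ nat \<alpha> * Z ^ nat \<beta>) = x ^ nat i" by simp
  next
    fix z assume "z \<in> {0..<pb} \<times> {0..<sg}"
    then obtain \<alpha> \<beta> where z: "z = (\<alpha>, \<beta>)" "0 \<le> \<alpha>" "\<alpha> < pb" "0 \<le> \<beta>" "\<beta> < sg" by auto
    have ab: "al (\<alpha> * p + \<beta> * q) = \<alpha>" "be (\<alpha> * p + \<beta> * q) = \<beta>"
      using z pb sg by (auto intro!: al_combine be_combine)
    thus "(al (case z of (\<alpha>, \<beta>) \<Rightarrow> \<alpha> * p + \<beta> * q), be (case z of (\<alpha>, \<beta>) \<Rightarrow> \<alpha> * p + \<beta> * q)) = z"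
      using z by simp
    show "(case z of (\<alpha>, \<beta>) \<Rightarrow> \<alpha> * p + \<beta> * q) \<in> Ip"
      using z ab combine_low[of \<alpha> \<beta>] pq_pos by (auto simp: Ip_def b_def)
  qed
  also have "\<dots> = (\<Sum>\<alpha>\<in>{0..<pb}. Y ^ nat \<alpha>) * (\<Sum>\<beta>\<in>{0..<sg}. Z ^ nat \<beta>)"
    by (simp add: sum_product sum.cartesian_product)
  finally have Ip: "(\<Sum>i\<in>Ip. x ^ nat i) = \<dots>" .
  have "M * (\<Sum>i\<in>Im. x ^ nat i) = (\<Sum>i\<in>Im. x ^ nat (i + p * q))"
    unfolding sum_distrib_left M_def
  proof (intro sum.cong refl)
    fix i assume "i \<in> Im"
    hence "nat (i + p * q) = nat (p * q) + nat i" using pq_pos by (auto simp: Im_def nat_add_distrib)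
    thus "x ^ nat (p * q) * x ^ nat i = x ^ nat (i + p * q)"
      by (simp add: power_add)
  qed
  also have "\<dots> = (\<Sum>(\<alpha>, \<beta>)\<in>{pb..<q} \<times> {sg..<p}. Y ^ nat \<alpha> * Z ^ nat \<beta>)"
  proof (rule sum.reindex_bij_witness[where i = "\<lambda>(\<alpha>, \<beta>). \<alpha> * p + \<beta> * q - p * q" and j = "\<lambda>i. (al i, be i)"])
    fix i assume "i \<in> Im"
    hence i: "0 \<le> i" "i < p * q" "pb \<le> al i" "sg \<le> be i" by (auto simp: Im_def b_def split: if_splits)
    show "(case (al i, be i) of (\<alpha>, \<beta>) \<Rightarrow> \<alpha> * p + \<beta> * q - p * q) = i" using mod_high[of i] i by simp
    show "(al i, be i) \<in> {pb..<q} \<times> {sg..<p}" using i al_range be_range by auto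
    have "x ^ nat (i + p * q) = x ^ nat (al i * p + be i * q)"
    proof -
      have "i + p * q = al i * p + be i * q" using mod_high[of i] i by simp
      thus ?thesis by simp
    qed
    also have "\<dots> = Y ^ nat (al i) * Z ^ nat (be i)" by (intro YZ al_range be_range)
    finally show "(case (al i, be i) of (\<alpha>, \<beta>) \<Rightarrow> Y ^ nat \<alpha> * Z ^ nat \<beta>) = x ^ nat (i + p * q)" by simp
  next
    fix z assume "z \<in> {pb..<q} \<times> {sg..<p}"
    then obtain \<alpha> \<beta> where z: "z = (\<alpha>, \<beta>)" "pb \<le> \<alpha>" "\<alpha> < q" "sg \<le> \<beta>" "\<beta> < p" by auto
    have shift: "\<alpha> * p + \<beta> * q - p * q = \<alpha> * p + (\<beta> - p) * q" "\<alpha> * p + \<beta> * q - p * q = (\<alpha> - q) * p + \<beta> * q"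
      by (simp_all add: algebra_simps)
    have ab: "al (\<alpha> * p + \<beta> * q - p * q) = \<alpha>" "be (\<alpha> * p + \<beta> * q - p * q) = \<beta>"
      unfolding shift(1) using z pb sg apply (intro al_combine; simp)
      unfolding shift(1) [symmetric] shift(2) using z pb sg by (intro be_combine; simp)
    thus "(al (case z of (\<alpha>, \<beta>) \<Rightarrow> \<alpha> * p + \<beta> * q - p * q), be (case z of (\<alpha>, \<beta>) \<Rightarrow> \<alpha> * p + \<beta> * q - p * q)) = z"
      using z by simp
    show "(case z of (\<alpha>, \<beta>) \<Rightarrow> \<alpha> * p + \<beta> * q - p * q) \<in> Im"
      using z ab combine_high[of \<alpha> \<beta>] by (auto simp: Im_def b_def)
  qed
  also have "\<dots> = (\<Sum>\<alpha>\<in>{pb..<q}. Y ^ nat \<alpha>) * (\<Sum>\<beta>\<in>{sg..<p}. Z ^ nat \<beta>)"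
    by (simp add: sum_product sum.cartesian_product)
  finally have Im: "M * (\<Sum>i\<in>Im. x ^ nat i) = \<dots>" .
  have YM: "Y ^ nat q = M" and ZM: "Z ^ nat p = M"
    using pq_pos by (simp_all add: Y_def Z_def M_def nat_mult_distrib mult.commute flip: power_mult)
  have YZ1: "Y ^ nat pb * Z ^ nat sg = M * x"
  proof -
    have "nat (pb * p + sg * q) = nat (p * q) + 1"
      using bezout pq_pos by (simp add: mult.commute nat_add_distrib)
    thus ?thesis using YZ[of pb sg] pb sg by (simp add: M_def mult.commute)
  qed
  have "M * (?B * (Y - 1) * (Z - 1)) =
      M * (((\<Sum>\<alpha>\<in>{0..<pb}. Y ^ nat \<alpha>) * (Y - 1)) * ((\<Sum>\<beta>\<in>{0..<sg}. Z ^ nat \<beta>) * (Z - 1))) -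
      ((\<Sum>\<alpha>\<in>{pb..<q}. Y ^ nat \<alpha>) * (Y - 1)) * ((\<Sum>\<beta>\<in>{sg..<p}. Z ^ nat \<beta>) * (Z - 1))"
  proof -
    have "M * (?B * (Y - 1) * (Z - 1)) = (M * (\<Sum>i\<in>Ip. x ^ nat i) - M * (\<Sum>i\<in>Im. x ^ nat i)) * ((Y - 1) * (Z - 1))"
      unfolding B by (simp add: algebra_simps)
    also have "\<dots> = M * (\<Sum>i\<in>Ip. x ^ nat i) * ((Y - 1) * (Z - 1)) - (M * (\<Sum>i\<in>Im. x ^ nat i)) * ((Y - 1) * (Z - 1))"
      by (rule left_diff_distrib)
    finally show ?thesis unfolding Ip Im by (simp only: mult_ac)
  qed
  also have "\<dots> = M * ((Y ^ nat pb - 1) * (Z ^ nat sg - 1)) - (M - Y ^ nat pb) * (M - Z ^ nat sg)"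
    using pb sg by (simp add: sum_power_int_interval YM ZM)
  also have "\<dots> = M * (Y ^ nat pb * Z ^ nat sg) + M - M * M - Y ^ nat pb * Z ^ nat sg"
    by (simp add: algebra_simps)
  also have "\<dots> = M * ((M - 1) * (x - 1))"
    unfolding YZ1 by (simp add: algebra_simps)
  finally have "M * (?B * (Y - 1) * (Z - 1)) = M * ((M - 1) * (x - 1))" .
  moreover have "M \<noteq> 0" using x by (simp add: M_def)
  ultimately show ?thesis using x by (auto simp: Y_def Z_def M_def)
qed

end

section \<open>Ternary coefficients as truncated sums of binary ones\<close>

context binary_pair
begin

text \<open>For p < q these are the coefficients of (1 + x + ... + x^(p - 1)) (1 - x^q).\<close>

definition w :: "int \<Rightarrow> int" where
  "w x = (if 0 \<le> x \<and> x < p then 1 else if q \<le> x \<and> x < q + p then - 1 else 0)"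

text \<open>
  The coefficient of \<open>x^n\<close> in the ternary polynomial is \<open>csum r N t\<close> with \<open>N = n div r\<close> and \<open>t = n\<close>;
  since \<open>r > p * q\<close>, the cutoff \<open>N\<close> and the residue of \<open>t\<close> modulo \<open>p * q\<close> vary independently.
\<close>

definition csum :: "int \<Rightarrow> int \<Rightarrow> int \<Rightarrow> int" where
  "csum r N t = (\<Sum>i\<in>{0..<p * q}. if i \<le> N then b i * w ((t - r * i) mod (p * q)) else 0)"

text \<open>\<open>b_identity\<close> at x^R makes B the binary polynomial in x^R. Cancelling the
  nonzero factor Z from the product formula leaves \<Phi> (1 - x^(PQ)) = B * W, and W has degree
  below P + Q \<le> PQ, as \<open>coeff_periodic_quotient\<close> requires.\<close>

lemma cyclotomic_coeff_ternary:
  fixes P Q R n :: nat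
  assumes primes: "prime P" "prime Q" "prime R" and PQ: "p = int P" "q = int Q" "P < Q" and R: "P * Q < R"
  shows "cyclotomic_coeff (P * Q * R) n = of_int (csum (int R) (int (n div R)) (int n))"
proof -
  have P2: "2 \<le> P" using primes by (simp add: prime_ge_2_nat)
  have QPQ: "Q + P \<le> P * Q"
  proof -
    have "2 * Q \<le> P * Q" using P2 by simp
    thus ?thesis using PQ(3) by linarith
  qed
  have pos: "0 < P" "0 < Q" "0 < R" using primes by (auto simp: prime_gt_0_nat)
  have "Q * 1 \<le> P * Q" "P * 1 \<le> P * Q" using pos by simp_all
  hence neq: "P \<noteq> Q" "P \<noteq> R" "Q \<noteq> R" using PQ(3) R by auto
  have nats: "nat p = P" "nat q = Q" "nat (p * q) = P * Q"
    using PQ by (simp_all add: nat_mult_distrib)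
  define \<Phi> where "\<Phi> = cyclotomic_poly (P * Q * R)"
  define G :: "complex poly" where "G = (\<Sum>m<P. monom 1 m)"
  define W where "W = G * (1 - monom 1 Q)"
  define B :: "complex poly" where "B = (\<Sum>i<P * Q. monom (of_int (b (int i))) (R * i))"
  have mpow: "monom 1 R ^ k = (monom 1 (R * k) :: complex poly)" for k
    by (simp add: monom_power)
  have "B = (\<Sum>i\<in>{0..<p * q}. of_int (b i) * monom 1 R ^ nat i)"
    unfolding B_def
    by (rule sum.reindex_bij_witness[where i = nat and j = int])
       (use PQ in \<open>auto simp: mpow of_int_poly smult_monom nat_less_iff simp flip: of_nat_mult\<close>)
  hence B: "B * xpow_minus_1 (P * R) * xpow_minus_1 (Q * R) = xpow_minus_1 (P * Q * R) * xpow_minus_1 R"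
    using b_identity[of "monom 1 R :: complex poly"] by (simp add: mpow nats mult.commute mult.left_commute)
  have Xnz: "xpow_minus_1 k \<noteq> 0" if "k > 0" for k
  proof
    assume "xpow_minus_1 k = 0"
    hence "coeff (xpow_minus_1 k) k = 0" by simp
    thus False using that by simp
  qed
  have GX: "xpow_minus_1 P = xpow_minus_1 1 * G"
    using power_diff_1_eq[of "monom 1 1 :: complex poly" P] by (simp add: G_def monom_power)
  define Z where "Z = xpow_minus_1 1 * xpow_minus_1 (P * R) * xpow_minus_1 (Q * R)"
  have "Z \<noteq> 0" using Xnz[of 1] Xnz[of "P * R"] Xnz[of "Q * R"] pos by (simp add: Z_def)
  have "\<Phi> * (1 - monom 1 (P * Q)) * Z = - (\<Phi> * xpow_minus_1 1 * xpow_minus_1 (P * Q) * xpow_minus_1 (P * R) * xpow_minus_1 (Q * R))"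
    by (simp add: Z_def algebra_simps)
  also have "\<dots> = - (xpow_minus_1 (P * Q * R) * xpow_minus_1 R * xpow_minus_1 P * xpow_minus_1 Q)"
    unfolding \<Phi>_def cyclotomic_poly_ternary[OF primes neq] by (simp only: mult_ac)
  also have "\<dots> = - (B * xpow_minus_1 (P * R) * xpow_minus_1 (Q * R) * (xpow_minus_1 1 * G) * xpow_minus_1 Q)"
    by (simp only: B GX)
  also have "\<dots> = B * W * Z"
    by (simp add: W_def Z_def algebra_simps)
  finally have eq: "\<Phi> * (1 - monom 1 (P * Q)) = B * W" using \<open>Z \<noteq> 0\<close> by simp
  have G: "coeff G j = (if j < P then 1 else 0)" for j
    by (auto simp: G_def coeff_sum)
  have W: "coeff W j = of_int (w (int j))" for j
  proof -
    have "coeff W j = coeff G j - (if Q \<le> j then coeff G (j - Q) else 0)"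
      by (simp add: W_def right_diff_distrib mult.commute[of G "monom 1 Q"] coeff_monom_mult)
    moreover have "w (int j) = (if j < P then 1 else if Q \<le> j \<and> j < Q + P then - 1 else 0)"
      unfolding w_def using PQ by auto
    ultimately show ?thesis using PQ(3) by (auto simp: G)
  qed
  have "coeff \<Phi> n = (\<Sum>i<P * Q. if R * i \<le> n then of_int (b (int i)) * coeff W ((n - R * i) mod (P * Q)) else 0)"
  proof (rule coeff_periodic_quotient)
    show "P * Q > 0" using pos by simp
    show "coeff W j = 0" if "P * Q \<le> j" for j
      using that QPQ PQ unfolding W w_def by (auto simp flip: of_nat_add)
    show "\<Phi> * (1 - monom 1 (P * Q)) = (\<Sum>i<P * Q. monom (of_int (b (int i))) (R * i)) * W"
      using eq by (simp add: B_def)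
  qed
  also have "\<dots> = (\<Sum>i\<in>{0..<p * q}. of_int (if i \<le> int (n div R) then b i * w ((int n - int R * i) mod (p * q)) else 0))"
  proof (rule sum.reindex_bij_witness[where i = nat and j = int])
    fix i assume i: "i \<in> {..<P * Q}"
    show "int i \<in> {0..<p * q}" using i PQ by (simp flip: of_nat_mult)
    have iff: "R * i \<le> n \<longleftrightarrow> i \<le> n div R" using pos by (simp add: less_eq_div_iff_mult_less_eq mult.commute)
    show "of_int (if int i \<le> int (n div R) then b (int i) * w ((int n - int R * int i) mod (p * q)) else 0) =
       (if R * i \<le> n then of_int (b (int i)) * coeff W ((n - R * i) mod (P * Q)) else 0)"
    proof (cases "R * i \<le> n")
      case True
      hence "(int n - int R * int i) mod (p * q) = int ((n - R * i) mod (P * Q))"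
        using PQ by (simp add: of_nat_diff zmod_int)
      thus ?thesis using True iff by (simp add: W)
    qed (use iff in simp)
  qed (use PQ in \<open>auto simp: nat_less_iff simp flip: of_nat_mult\<close>)
  also have "\<dots> = of_int (csum (int R) (int (n div R)) (int n))"
    by (simp add: csum_def)
  finally show ?thesis by (simp add: cyclotomic_coeff_def \<Phi>_def)
qed

text \<open>
  \<open>g N\<close> is the coefficient function \<open>b\<close>, truncated to indices at most \<open>N\<close>, in the coordinates
  \<open>(al x, be x)\<close>. Shifting by \<open>s * q\<close> fixes the first coordinate, hence the shape of \<open>D\<close>.
\<close>

definition g :: "int \<Rightarrow> int \<Rightarrow> int \<Rightarrow> int" where
  "g N \<alpha> \<beta> = (if \<alpha> < pb \<and> \<beta> < sg then (if \<alpha> * p + \<beta> * q \<le> N then 1 else 0)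
     else if pb \<le> \<alpha> \<and> sg \<le> \<beta> then (if \<alpha> * p + \<beta> * q - p * q \<le> N then - 1 else 0) else 0)"

definition D :: "int \<Rightarrow> int \<Rightarrow> int \<Rightarrow> int \<Rightarrow> int" where
  "D s N \<alpha> \<beta> = g N \<alpha> \<beta> - g N \<alpha> ((\<beta> - s) mod p)"

lemma g_al_be: "g N (al x) (be x) = (if x mod (p * q) \<le> N then b x else 0)"
  using mod_low[of x] mod_high[of x] by (auto simp: g_def b_def)

lemma b_mod: "b (x mod (p * q)) = b x"
proof -
  have "al (x mod (p * q)) = al x" unfolding al_def
    by (metis mod_mod_cancel mod_mult_left_eq dvd_triv_right)
  moreover have "be (x mod (p * q)) = be x" unfolding be_def
    by (metis mod_mod_cancel mod_mult_left_eq dvd_triv_left)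
  ultimately show ?thesis by (simp add: b_def)
qed

lemma al_shift: "al (x - s * q) = al x"
proof -
  have "(x - s * q) * pb = x * pb + q * (- (s * pb))" by (simp add: algebra_simps)
  thus ?thesis by (simp only: al_def mod_mult_self2)
qed

lemma be_shift: "be (x - s * q) = (be x - s) mod p"
proof -
  have "[(x - s * q) * sg = x * sg - s * (q * sg)] (mod p)" by (simp add: algebra_simps)
  also have "[x * sg - s * (q * sg) = x * sg - s * 1] (mod p)"
    by (intro cong_diff cong_mult cong_refl cong_sg)
  also have "[x * sg - s * 1 = be x - s] (mod p)"
    unfolding be_def by (intro cong_diff) (auto simp: cong_def)
  finally show ?thesis by (simp add: be_def cong_def)
qed

text \<open>As r is invertible modulo \<open>p * q\<close> with inverse s, exactly one index i is
  selected, namely the residue of \<open>s * (t - m)\<close>.\<close>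

lemma sum_select_residue:
  assumes rs: "[r * s = 1] (mod p * q)" and m: "0 \<le> m" "m < p * q"
  shows "(\<Sum>i\<in>{0..<p * q}. if i \<le> N \<and> (t - r * i) mod (p * q) = m then b i else 0) =
    g N (al (s * (t - m))) (be (s * (t - m)))"
proof -
  define i0 where "i0 = (s * (t - m)) mod (p * q)"
  have pq: "p * q > 0" using pq_pos by simp
  have i0: "0 \<le> i0" "i0 < p * q" using pq by (auto simp: i0_def)
  have iff: "(t - r * i) mod (p * q) = m \<longleftrightarrow> i = i0" if "0 \<le> i" "i < p * q" for i
  proof -
    have "(t - r * i) mod (p * q) = m \<longleftrightarrow> [t - r * i = m] (mod p * q)"
      using m by (simp add: cong_def)
    also have "\<dots> \<longleftrightarrow> [r * i = t - m] (mod p * q)"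
    proof -
      have "t - r * i - m = - (r * i - (t - m))" by simp
      thus ?thesis unfolding cong_iff_dvd_diff by (simp only: dvd_minus_iff)
    qed
    also have "\<dots> \<longleftrightarrow> [i = s * (t - m)] (mod p * q)"
    proof
      assume "[r * i = t - m] (mod p * q)"
      hence "[s * (r * i) = s * (t - m)] (mod p * q)" by (rule cong_scalar_left)
      moreover have "[(r * s) * i = 1 * i] (mod p * q)" using rs by (rule cong_scalar_right)
      ultimately show "[i = s * (t - m)] (mod p * q)"
        by (metis cong_sym cong_trans mult.assoc mult.commute mult_1)
    next
      assume "[i = s * (t - m)] (mod p * q)"
      hence "[r * i = r * (s * (t - m))] (mod p * q)" by (rule cong_scalar_left)
      moreover have "[(r * s) * (t - m) = 1 * (t - m)] (mod p * q)" using rs by (rule cong_scalar_right)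
      ultimately show "[r * i = t - m] (mod p * q)"
        by (metis cong_trans mult.assoc mult_1)
    qed
    also have "\<dots> \<longleftrightarrow> i = i0" using that by (simp add: cong_def i0_def)
    finally show ?thesis .
  qed
  have "(\<Sum>i\<in>{0..<p * q}. if i \<le> N \<and> (t - r * i) mod (p * q) = m then b i else 0) =
        (\<Sum>i\<in>{0..<p * q}. if i = i0 then (if i0 \<le> N then b i0 else 0) else 0)"
    using iff by (intro sum.cong) auto
  also have "\<dots> = (if i0 \<le> N then b i0 else 0)" using i0 by simp
  finally show ?thesis by (simp add: g_al_be i0_def b_mod)
qed

text \<open>\<open>w\<close> is the indicator of a window of length p minus the indicator of its
  translate by q. After multiplication by s the translation becomes \<open>s * q\<close>, which
  leaves \<open>al\<close> alone and moves \<open>be\<close> by s.\<close>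

lemma csum_eq_sum_D:
  assumes rs: "[r * s = 1] (mod p * q)" and pq: "p < q" "2 \<le> p"
  shows "csum r N t = (\<Sum>m\<in>{0..<p}. D s N (al (s * (t - m))) (be (s * (t - m))))"
proof -
  have "2 * q \<le> p * q" using pq by (intro mult_right_mono) auto
  hence le: "q + p \<le> p * q" using pq by linarith
  have w: "w x = (\<Sum>m\<in>{0..<p}. (if x = m then 1 else 0) - (if x = q + m then 1 else 0))" if "0 \<le> x" for x
  proof -
    have "(\<Sum>m\<in>{0..<p}. if x = q + m then 1 else 0) = (\<Sum>m\<in>{0..<p}. if x - q = m then 1 else 0 :: int)"
      by (intro sum.cong) auto
    thus ?thesis using that pq by (auto simp: sum_subtractf w_def)
  qed
  have "csum r N t = (\<Sum>i\<in>{0..<p * q}. \<Sum>m\<in>{0..<p}.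
      (if i \<le> N \<and> (t - r * i) mod (p * q) = m then b i else 0) - (if i \<le> N \<and> (t - r * i) mod (p * q) = q + m then b i else 0))"
    unfolding csum_def
  proof (intro sum.cong refl)
    fix i
    have "0 \<le> (t - r * i) mod (p * q)" using pq_pos by simp
    thus "(if i \<le> N then b i * w ((t - r * i) mod (p * q)) else 0) = (\<Sum>m\<in>{0..<p}.
      (if i \<le> N \<and> (t - r * i) mod (p * q) = m then b i else 0) - (if i \<le> N \<and> (t - r * i) mod (p * q) = q + m then b i else 0))"
      by (auto simp: w sum_distrib_left intro!: sum.cong)
  qed
  also have "\<dots> = (\<Sum>m\<in>{0..<p}. g N (al (s * (t - m))) (be (s * (t - m))) - g N (al (s * (t - (q + m)))) (be (s * (t - (q + m)))))"
    by (subst sum.swap) (use le pq in \<open>simp add: sum_subtractf sum_select_residue[OF rs]\<close>)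
  also have "\<dots> = (\<Sum>m\<in>{0..<p}. D s N (al (s * (t - m))) (be (s * (t - m))))"
  proof (intro sum.cong refl)
    fix m
    have "s * (t - (q + m)) = s * (t - m) - s * q" by (simp add: algebra_simps)
    thus "g N (al (s * (t - m))) (be (s * (t - m))) - g N (al (s * (t - (q + m)))) (be (s * (t - (q + m)))) =
      D s N (al (s * (t - m))) (be (s * (t - m)))"
      by (simp only: D_def al_shift be_shift)
  qed
  finally show ?thesis .
qed

end

section \<open>Extremal coefficients\<close>

context binary_pair
begin

lemma sub_mod:
  assumes "0 \<le> \<beta>" "\<beta> < p" "0 \<le> \<rho>" "\<rho> < p"
  shows "(\<beta> - \<rho>) mod p = (if \<rho> \<le> \<beta> then \<beta> - \<rho> else \<beta> - \<rho> + p)"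
proof (cases "\<rho> \<le> \<beta>")
  case False
  have "(\<beta> - \<rho>) mod p = (\<beta> - \<rho> + p) mod p" by simp
  also have "\<dots> = \<beta> - \<rho> + p" using False assms by (intro mod_pos_pos_trivial) auto
  finally show ?thesis using False by simp
qed (use assms in auto)

text \<open>Subtracting \<rho> modulo p raises \<beta> cyclically by p - \<rho>. If this stays on
  the same side of \<open>sg\<close>, the exponent only grows, so only the raised point can be lost
  to the cutoff. If it crosses \<open>sg\<close>, which by the assumptions on \<rho> includes every
  wrap-around, then for each \<alpha> one of the two values of \<open>g\<close> is 0 and the other
  has the right sign.\<close>

lemma D_bounds:
  assumes "0 \<le> \<beta>" "\<beta> < p" and \<rho>: "sg \<le> \<rho>" "\<rho> < p" "p \<le> \<rho> + sg"
  shows "(if \<beta> < sg then 0 else - 1) \<le> D \<rho> N \<alpha> \<beta>" "D \<rho> N \<alpha> \<beta> \<le> (if \<beta> < sg then 1 else 0)"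
proof -
  have "\<rho> * q \<le> p * q" "0 \<le> \<rho> * q" using \<rho> sg pq_pos by (auto intro: mult_right_mono)
  moreover have "(\<beta> - \<rho>) mod p = (if \<rho> \<le> \<beta> then \<beta> - \<rho> else \<beta> - \<rho> + p)"
    using assms sg by (intro sub_mod) auto
  ultimately show "(if \<beta> < sg then 0 else - 1) \<le> D \<rho> N \<alpha> \<beta>" "D \<rho> N \<alpha> \<beta> \<le> (if \<beta> < sg then 1 else 0)"
    using assms by (auto simp: D_def g_def algebra_simps)
qed

lemma sum_indicator:
  "(\<Sum>\<beta>\<in>{0..<p}. if \<beta> < sg then 1 else 0) = sg" (is ?A)
  "(\<Sum>\<beta>\<in>{0..<p}. if \<beta> < sg then 0 else - 1) = sg - p" (is ?B)
proof -
  have "(\<Sum>\<beta>\<in>{0..<p}. if \<beta> < sg then 1 else 0) = (\<Sum>\<beta>\<in>{0..<sg}. 1 :: int)"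
    using sg by (intro sum.mono_neutral_cong_right) auto
  thus ?A using sg by simp
  have "(\<Sum>\<beta>\<in>{0..<p}. if \<beta> < sg then 0 else - 1) = (\<Sum>\<beta>\<in>{sg..<p}. - 1 :: int)"
    using sg by (intro sum.mono_neutral_cong_right) auto
  thus ?B using sg by simp
qed

text \<open>Both s and \<open>sg\<close>, an inverse of q, are units modulo p; hence every \<beta>
  occurs in exactly one of the p differences.\<close>

lemma be_bij:
  assumes "coprime s p"
  shows "bij_betw (\<lambda>m. be (s * (t - m))) {0..<p} {0..<p}"
proof -
  have "inj_on (\<lambda>m. be (s * (t - m))) {0..<p}"
  proof (rule inj_onI)
    fix x y assume xy: "x \<in> {0..<p}" "y \<in> {0..<p}" "be (s * (t - x)) = be (s * (t - y))"
    have "[(t - x) * (s * sg) = (t - y) * (s * sg)] (mod p)"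
      using xy(3) by (simp add: be_def cong_def mult_ac)
    moreover have "coprime (s * sg) p"
      using assms cong_sg by (metis coprime_iff_invertible_int coprime_mult_left_iff mult.commute)
    ultimately have h: "[t - x = t - y] (mod p)" by (simp add: cong_mult_rcancel)
    have "[t - (t - x) = t - (t - y)] (mod p)" by (rule cong_diff[OF cong_refl h])
    hence "[x = y] (mod p)" by simp
    thus "x = y" using xy(1,2) by (simp add: cong_def)
  qed
  thus ?thesis unfolding bij_betw_def using be_range by (intro conjI endo_inj_surj) auto
qed

lemma csum_bounds:
  assumes rs: "[r * s = 1] (mod p * q)" and pq: "p < q" "2 \<le> p"
    and s: "s mod p = \<rho>" and \<rho>: "sg \<le> \<rho>" "p \<le> \<rho> + sg"
  shows "sg - p \<le> csum r N t" "csum r N t \<le> sg"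
proof -
  have cop: "coprime s p"
    using cong_modulus_mult[OF rs] by (metis coprime_iff_invertible_int mult.commute)
  have D: "D s N \<alpha> \<beta> = D \<rho> N \<alpha> \<beta>" for \<alpha> \<beta>
    unfolding D_def s [symmetric] by (simp add: mod_diff_right_eq)
  have \<rho>p: "\<rho> < p" using s pq_pos by auto
  note reindex = sum.reindex_bij_betw[OF be_bij[OF cop, of t]]
  have "csum r N t \<le> (\<Sum>m\<in>{0..<p}. if be (s * (t - m)) < sg then 1 else 0)"
    unfolding csum_eq_sum_D[OF rs pq] D by (intro sum_mono D_bounds be_range \<rho> \<rho>p)
  also have "\<dots> = sg" using reindex[of "\<lambda>\<beta>. if \<beta> < sg then 1 else 0 :: int"] sum_indicator by simp
  finally show "csum r N t \<le> sg" .
  have "sg - p = (\<Sum>m\<in>{0..<p}. if be (s * (t - m)) < sg then 0 else - 1)"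
    using reindex[of "\<lambda>\<beta>. if \<beta> < sg then 0 else - 1 :: int"] sum_indicator by simp
  also have "\<dots> \<le> csum r N t"
    unfolding csum_eq_sum_D[OF rs pq] D by (intro sum_mono D_bounds be_range \<rho> \<rho>p)
  finally show "sg - p \<le> csum r N t" .
qed

text \<open>Taking t = r * x0 makes s * t congruent to x0, so the points start at x0. Each step in m
  moves \<open>be\<close> by \<epsilon> and \<open>al\<close> by - \<epsilon> * \<kappa>, which
  keeps them on one line.\<close>

lemma csum_on_line:
  assumes rs: "[r * s = 1] (mod p * q)" and pq: "p < q" "2 \<le> p" and \<epsilon>: "\<epsilon> = 1 \<or> \<epsilon> = - 1"
    and s: "[s * sg = - \<epsilon>] (mod p)" "[s = \<epsilon> * (\<kappa> * p)] (mod q)"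
  shows "\<exists>t. \<forall>N. csum r N t = (\<Sum>\<beta>\<in>{0..<p}. D s N ((\<alpha>0 - \<kappa> * \<beta>) mod q) \<beta>)"
proof -
  \<comment> \<open>Starting at this end makes c + \<epsilon> * m run through 0, ..., p - 1 without
    reduction modulo p. The point x0 has coordinates \<alpha>0 - \<kappa> * c (modulo q) and
    c.\<close>
  define c where "c = (if \<epsilon> = 1 then 0 else p - 1)"
  define x0 where "x0 = (\<alpha>0 - \<kappa> * c) * p + c * q"
  have "[s * r * x0 = 1 * x0] (mod p * q)" using rs by (intro cong_scalar_right) (simp add: mult.commute)
  hence *: "[s * r * x0 = x0] (mod p * q)" by simp
  hence "[s * r * x0 = x0] (mod q * p)" by (simp only: mult.commute)
  with * have x0: "[s * r * x0 = x0] (mod p)" "[s * r * x0 = x0] (mod q)"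
    by (blast dest: cong_modulus_mult)+
  have al: "al (s * (r * x0 - m)) = (\<alpha>0 - \<kappa> * (c + \<epsilon> * m)) mod q" for m
  proof -
    have "[s * (r * x0 - m) * pb = (s * r * x0 - s * m) * pb] (mod q)" by (simp add: algebra_simps)
    also have "[(s * r * x0 - s * m) * pb = (x0 - (\<epsilon> * (\<kappa> * p)) * m) * pb] (mod q)"
      by (intro cong_mult cong_diff x0 s cong_refl)
    also have "(x0 - (\<epsilon> * (\<kappa> * p)) * m) * pb = (\<alpha>0 - \<kappa> * (c + \<epsilon> * m)) * (p * pb) + q * (c * pb)"
      by (simp add: x0_def algebra_simps)
    also have "[\<dots> = (\<alpha>0 - \<kappa> * (c + \<epsilon> * m)) * 1 + 0] (mod q)"
      by (intro cong_add cong_mult cong_refl cong_pb) (simp add: cong_def)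
    finally show ?thesis by (simp add: al_def cong_def)
  qed
  have be: "be (s * (r * x0 - m)) = (c + \<epsilon> * m) mod p" for m
  proof -
    have "[s * (r * x0 - m) * sg = s * r * x0 * sg - (s * sg) * m] (mod p)" by (simp add: algebra_simps)
    also have "[s * r * x0 * sg - (s * sg) * m = x0 * sg - (- \<epsilon>) * m] (mod p)"
      by (intro cong_mult cong_diff x0 s cong_refl)
    also have "x0 * sg - (- \<epsilon>) * m = c * (q * sg) + \<epsilon> * m + p * ((\<alpha>0 - \<kappa> * c) * sg)"
      by (simp add: x0_def algebra_simps)
    also have "[\<dots> = c * 1 + \<epsilon> * m + 0] (mod p)"
      by (intro cong_add cong_mult cong_refl cong_sg) (simp add: cong_def)
    finally show ?thesis by (simp add: be_def cong_def)
  qed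
  have "csum r N (r * x0) = (\<Sum>\<beta>\<in>{0..<p}. D s N ((\<alpha>0 - \<kappa> * \<beta>) mod q) \<beta>)" for N
    unfolding csum_eq_sum_D[OF rs pq] al be
  proof (rule sum.reindex_bij_witness[where i = "\<lambda>\<beta>. \<epsilon> * (\<beta> - c)" and j = "\<lambda>m. c + \<epsilon> * m"])
    fix m assume "m \<in> {0..<p}"
    thus "D s N ((\<alpha>0 - \<kappa> * (c + \<epsilon> * m)) mod q) (c + \<epsilon> * m) = D s N ((\<alpha>0 - \<kappa> * (c + \<epsilon> * m)) mod q) ((c + \<epsilon> * m) mod p)"
      using \<epsilon> by (auto simp: c_def)
  qed (use \<epsilon> in \<open>auto simp: c_def\<close>)
  thus ?thesis by blast
qed

lemma pb_le_iff: "pb \<le> \<alpha> \<longleftrightarrow> (p - sg) * q < \<alpha> * p"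
proof -
  have "p * pb = (p - sg) * q + 1" using bezout by (simp add: algebra_simps)
  moreover have "pb \<le> \<alpha> \<longleftrightarrow> p * pb \<le> p * \<alpha>" using pq_pos by simp
  ultimately show ?thesis by (simp add: mult.commute) linarith
qed

text \<open>The cutoff is the exponent of the line's point (0, sg - 1). Towards smaller \<beta> the
  exponent falls by q - \<kappa> * p per step, so these points count, while their copies raised by p
  - \<rho> either pass the cutoff or leave the low rectangle. Towards larger \<beta> the first
  coordinate wraps to the top of its range, beyond \<open>pb\<close>, where the exponents exceed the
  cutoff and nothing counts.\<close>

lemma D_max_line:
  assumes \<rho>: "sg \<le> \<rho>" "\<rho> < p" "p \<le> \<rho> + sg" and w: "p < 2 * sg"
    and \<kappa>: "0 < \<kappa>" "\<kappa> * p < q" "\<kappa> * p * (sg - 1) \<le> (p - sg) * q" "(q - \<kappa> * p) * (sg - 1) < (p - \<rho>) * q"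
    and \<beta>: "0 \<le> \<beta>" "\<beta> < p"
  shows "D \<rho> ((sg - 1) * q) ((\<kappa> * (sg - 1) - \<kappa> * \<beta>) mod q) \<beta> = (if \<beta> < sg then 1 else 0)"
proof -
  define K where "K = \<kappa> * p"
  note K = \<kappa>[folded K_def]
  have Kpos: "K > 0" using \<kappa>(1) pq_pos by (simp add: K_def)
  define \<alpha> where "\<alpha> = (\<kappa> * (sg - 1) - \<kappa> * \<beta>) mod q"
  have sub: "(\<beta> - \<rho>) mod p = (if \<rho> \<le> \<beta> then \<beta> - \<rho> else \<beta> - \<rho> + p)"
    using \<beta> \<rho> sg by (intro sub_mod) auto
  show ?thesis
  proof (cases "\<beta> < sg")
    case True
    have "K * (sg - 1 - \<beta>) \<le> K * (sg - 1)" using Kpos \<beta> by (intro mult_left_mono) auto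
    hence le: "K * (sg - 1 - \<beta>) \<le> (p - sg) * q" using K(3) by linarith
    have "(p - sg) * q < p * q" using sg pq_pos by (intro mult_strict_right_mono) auto
    hence "\<kappa> * (sg - 1 - \<beta>) * p < q * p" using le by (simp add: K_def mult_ac)
    hence "\<kappa> * (sg - 1 - \<beta>) < q" using pq_pos by simp
    moreover have "0 \<le> \<kappa> * (sg - 1 - \<beta>)" using \<kappa>(1) True by simp
    ultimately have \<alpha>: "\<alpha> = \<kappa> * (sg - 1 - \<beta>)" by (simp add: \<alpha>_def right_diff_distrib)
    have \<alpha>p: "\<alpha> * p = K * (sg - 1 - \<beta>)" by (simp add: \<alpha> K_def)
    have low: "\<alpha> < pb" using pb_le_iff[of \<alpha>] le \<alpha>p by linarith
    have id: "\<alpha> * p + \<beta> * q = (sg - 1) * q - (q - K) * (sg - 1 - \<beta>)"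
      by (simp add: \<alpha>p algebra_simps)
    have nn: "0 \<le> (q - K) * (sg - 1 - \<beta>)" using K True by simp
    have "(q - K) * (sg - 1 - \<beta>) \<le> (q - K) * (sg - 1)" using K \<beta> by (intro mult_left_mono) auto
    hence lt: "(q - K) * (sg - 1 - \<beta>) < (p - \<rho>) * q" using K(4) by linarith
    have "g ((sg - 1) * q) \<alpha> \<beta> = 1" using low True id nn by (simp add: g_def)
    moreover have "g ((sg - 1) * q) \<alpha> (\<beta> - \<rho> + p) = 0"
    proof -
      have "\<alpha> * p + (\<beta> - \<rho> + p) * q = \<alpha> * p + \<beta> * q + (p - \<rho>) * q" by (simp add: algebra_simps)
      hence "\<not> \<alpha> * p + (\<beta> - \<rho> + p) * q \<le> (sg - 1) * q" using id lt by linarith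
      thus ?thesis using low by (simp add: g_def)
    qed
    ultimately show ?thesis using True \<rho> by (simp add: D_def sub flip: \<alpha>_def)
  next
    case False
    have "K * (\<beta> - sg + 1) \<le> K * (p - sg)" using Kpos \<beta> by (intro mult_left_mono) auto
    also have "\<dots> < q * (p - sg)" using K sg by (intro mult_strict_right_mono) auto
    finally have lt: "K * (\<beta> - sg + 1) < q * (p - sg)" .
    have ge: "0 < K * (\<beta> - sg + 1)" using Kpos False by simp
    have q1: "q * (p - sg) < q * p" using sg pq_pos by (intro mult_strict_left_mono) auto
    have "\<kappa> * (\<beta> - sg + 1) * p < q * p" using lt q1 by (simp add: K_def mult_ac)
    hence "\<kappa> * (\<beta> - sg + 1) < q" using pq_pos by simp
    moreover have "0 < \<kappa> * (\<beta> - sg + 1)" using \<kappa>(1) False by simp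
    moreover have "\<alpha> = (q - \<kappa> * (\<beta> - sg + 1)) mod q"
      by (simp add: \<alpha>_def algebra_simps) (metis (no_types, lifting) add.commute add_diff_eq mod_add_self1)
    moreover have "(q - \<kappa> * (\<beta> - sg + 1)) mod q = q - \<kappa> * (\<beta> - sg + 1)"
      using calculation(1,2) by (intro mod_pos_pos_trivial) auto
    ultimately have \<alpha>: "\<alpha> = q - \<kappa> * (\<beta> - sg + 1)" by (simp only:)
    have \<alpha>p: "\<alpha> * p = p * q - K * (\<beta> - sg + 1)" by (simp add: \<alpha> K_def algebra_simps)
    \<comment> \<open>Here \<open>p < 2 * sg\<close> keeps the wrapped part right of
      \<open>pb\<close>: \<alpha> * p exceeds sg * q, hence also (p - sg) * q.\<close>
    have "(p - sg) * q < q * sg" using w pq_pos by (simp add: mult.commute)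
    hence high: "pb \<le> \<alpha>" unfolding pb_le_iff \<alpha>p using lt by (simp add: algebra_simps)
    have id: "\<alpha> * p + \<beta> * q - p * q = (sg - 1) * q + (q - K) * (\<beta> - sg + 1)"
      by (simp add: \<alpha>p algebra_simps)
    have pos: "0 < (q - K) * (\<beta> - sg + 1)" using K False by simp
    have "g ((sg - 1) * q) \<alpha> \<beta> = 0" using high id pos by (simp add: g_def)
    moreover have "g ((sg - 1) * q) \<alpha> (\<beta> - \<rho>) = 0" using high \<beta> \<rho> by (simp add: g_def)
    moreover have "g ((sg - 1) * q) \<alpha> (\<beta> - \<rho> + p) = 0"
    proof -
      have "\<alpha> * p + (\<beta> - \<rho> + p) * q - p * q = \<alpha> * p + \<beta> * q - p * q + (p - \<rho>) * q" by (simp add: algebra_simps)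
      moreover have "0 < (p - \<rho>) * q" using \<rho> pq_pos by simp
      ultimately have "\<not> \<alpha> * p + (\<beta> - \<rho> + p) * q - p * q \<le> (sg - 1) * q" using id pos by linarith
      thus ?thesis using high by (simp add: g_def)
    qed
    ultimately show ?thesis using False by (simp add: D_def sub flip: \<alpha>_def)
  qed
qed

text \<open>The cutoff is the reduced exponent of (pb, p - 1), where the line starts at the top.
  Going down j steps, the exponent falls by (q - \<kappa> * p) * j while the first coordinate grows
  from \<open>pb\<close>. Before it reaches q, points with \<beta> \<ge> sg count as - 1 and E1
  pushes relevant raised copies past the cutoff. After it wraps into the low range, E2 makes a point
  and its raised copy both count, and they cancel.\<close>

lemma D_min_line:
  assumes \<rho>: "sg \<le> \<rho>" "\<rho> < p" "p \<le> \<rho> + sg" and w: "p < 2 * sg"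
    and \<kappa>: "0 < \<kappa>" "\<kappa> * p < q"
    and E1: "(q - \<kappa> * p) * (2 * p - sg - \<rho> - 1) < (p - \<rho>) * q"
    and E2: "(p - \<rho>) * q * (\<kappa> * p) \<le> (q - \<kappa> * p) * (sg * q - 1)"
    and \<beta>: "0 \<le> \<beta>" "\<beta> < p"
  shows "D \<rho> ((p - sg - 1) * q + 1) ((pb + \<kappa> * (p - 1) - \<kappa> * \<beta>) mod q) \<beta> = (if \<beta> < sg then 0 else - 1)"
proof -
  define K where "K = \<kappa> * p"
  define N where "N = (p - sg - 1) * q + 1"
  have K: "0 < K" "K < q" using \<kappa> pq_pos by (auto simp: K_def)
  define d where "d = p - \<rho>"
  have d: "0 < d" "d \<le> p - sg" using \<rho> by (auto simp: d_def)
  define j where "j = p - 1 - \<beta>"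
  have j: "0 \<le> j" "j \<le> p - 1" using \<beta> by (auto simp: j_def)
  \<comment> \<open>The first coordinate before reduction modulo q.\<close>
  define u where "u = pb + \<kappa> * j"
  define \<alpha> where "\<alpha> = (pb + \<kappa> * (p - 1) - \<kappa> * \<beta>) mod q"
  have \<alpha>u: "\<alpha> = u mod q" by (simp add: \<alpha>_def u_def j_def algebra_simps)
  have up: "u * p = (p - sg) * q + 1 + K * j"
    using bezout by (simp add: u_def K_def algebra_simps)
  have Kj: "0 \<le> K * j" "K * j < q * p"
  proof -
    show "0 \<le> K * j" using K j by simp
    have "K * j \<le> q * j" using K j by (intro mult_right_mono) auto
    also have "\<dots> < q * p" using j pq_pos by simp
    finally show "K * j < q * p" .
  qed
  have u0: "0 \<le> u" "pb \<le> u" using \<kappa>(1) j pb by (auto simp: u_def)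
  have sub: "(\<beta> - \<rho>) mod p = (if \<rho> \<le> \<beta> then \<beta> - \<rho> else \<beta> + d)"
    using sub_mod[of \<beta> \<rho>] \<beta> \<rho> sg by (simp add: d_def)
  have val: "u * p + \<beta> * q - p * q = N - (q - K) * j"
  proof -
    have "u * p + \<beta> * q - p * q = ((p - sg) * q + 1 + K * j) + \<beta> * q - p * q" by (simp only: up)
    also have "\<dots> = N - (q - K) * j" by (simp add: N_def j_def algebra_simps)
    finally show ?thesis .
  qed
  have Ej: "0 \<le> (q - K) * j" using K j by simp
  have E1': "(q - K) * j < d * q" if "j \<le> p - 1 - sg + d"
  proof -
    have "(q - K) * j \<le> (q - K) * (2 * p - sg - \<rho> - 1)" using K that by (intro mult_left_mono) (auto simp: d_def)
    thus ?thesis using E1 by (simp add: K_def d_def)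
  qed
  \<comment> \<open>A wrap would force sg * q - 1 \<le> K * j, hence d * q \<le> (q - K) * j by E2,
    contradicting E1'.\<close>
  have u_small: "u < q" if "j \<le> p - 1 - sg + d"
  proof (rule ccontr)
    assume "\<not> u < q"
    hence "q * p \<le> u * p" using pq_pos by simp
    hence "sg * q - 1 \<le> K * j" using up by (simp add: algebra_simps)
    hence "(q - K) * (sg * q - 1) \<le> (q - K) * (K * j)" using K by (intro mult_left_mono) auto
    hence "d * q * K \<le> ((q - K) * j) * K" using E2 by (simp add: K_def d_def mult_ac)
    hence "d * q \<le> (q - K) * j" using K by simp
    thus False using E1'[OF that] by simp
  qed
  show ?thesis
  proof (cases "u < q")
    case True
    have \<alpha>: "\<alpha> = u" using True u0 by (simp add: \<alpha>u)
    have shift: "u * p + (\<beta> + d) * q - p * q = N - (q - K) * j + d * q"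
      using val by (simp add: algebra_simps)
    show ?thesis
    proof (cases "\<beta> < sg")
      case low: True
      have "g N \<alpha> \<beta> = 0" using low u0 by (simp add: g_def \<alpha>)
      moreover have "g N \<alpha> (\<beta> + d) = 0"
      proof (cases "\<beta> + d < sg")
        case False
        hence "(q - K) * j < d * q" by (intro E1') (auto simp: j_def)
        thus ?thesis using u0 shift by (simp add: g_def \<alpha>)
      qed (use u0 in \<open>simp add: g_def \<alpha>\<close>)
      ultimately show ?thesis using low \<rho> by (simp add: D_def sub flip: \<alpha>_def N_def)
    next
      case high: False
      have "g N \<alpha> \<beta> = - 1" using high u0 val Ej by (simp add: g_def \<alpha>)
      moreover have "g N \<alpha> (\<beta> - \<rho>) = 0" using u0 \<beta> \<rho> by (simp add: g_def \<alpha>)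
      moreover have "g N \<alpha> (\<beta> + d) = 0"
      proof -
        have "(q - K) * j < d * q" using high d by (intro E1') (auto simp: j_def)
        thus ?thesis using u0 shift by (simp add: g_def \<alpha>)
      qed
      ultimately show ?thesis using high by (simp add: D_def sub flip: \<alpha>_def N_def)
    qed
  next
    case False
    hence j_big: "p - 1 - sg + d < j" using u_small by force
    hence \<beta>low: "\<beta> + d < sg" by (simp add: j_def)
    have "0 < sg * q" using sg pq_pos by simp
    hence "u * p < 2 * (q * p)" using up Kj by (simp add: algebra_simps)
    hence "u < 2 * q" using pq_pos by (simp add: mult.assoc [symmetric])
    hence "(u - q) mod q = u - q" using False by (intro mod_pos_pos_trivial) auto
    hence \<alpha>: "\<alpha> = u - q" by (simp add: \<alpha>u)
    have low: "\<alpha> < pb" using pb_le_iff[of \<alpha>] Kj up by (simp add: \<alpha> algebra_simps)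
    have v: "\<alpha> * p + \<beta> * q = N - (q - K) * j" using val by (simp add: \<alpha> algebra_simps)
    have big: "d * q \<le> (q - K) * j"
    proof -
      have "q * p \<le> u * p" using False pq_pos by simp
      hence "sg * q - 1 \<le> K * j" using up by (simp add: algebra_simps)
      hence "(q - K) * (sg * q - 1) \<le> (q - K) * (K * j)" using K by (intro mult_left_mono) auto
      hence "d * q * K \<le> ((q - K) * j) * K" using E2 by (simp add: K_def d_def mult_ac)
      thus ?thesis using K by simp
    qed
    have "g N \<alpha> \<beta> = 1" using low \<beta>low d v Ej by (simp add: g_def)
    moreover have "g N \<alpha> (\<beta> + d) = 1"
    proof -
      have "\<alpha> * p + (\<beta> + d) * q = N - (q - K) * j + d * q" using v by (simp add: algebra_simps)
      thus ?thesis using low \<beta>low big by (simp add: g_def)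
    qed
    ultimately show ?thesis using \<beta>low d \<rho> by (simp add: D_def sub flip: \<alpha>_def N_def)
  qed
qed

end

section \<open>From the extremal values to the full interval\<close>

context binary_pair
begin

lemma csum_cong: "[t = t'] (mod p * q) \<Longrightarrow> csum r N t = csum r N t'"
  unfolding csum_def by (intro sum.cong refl if_cong) (metis cong_def mod_diff_left_eq)

lemma csum_0: "csum r 0 t = w (t mod (p * q))"
proof -
  have "csum r 0 t = (\<Sum>i\<in>{0}. b i * w ((t - r * i) mod (p * q)))"
    unfolding csum_def using pq_pos by (intro sum.mono_neutral_cong_right) auto
  thus ?thesis using pb sg by (simp add: b_def al_def be_def)
qed

lemma csum_step: "\<bar>csum r (N + 1) t - csum r N t\<bar> \<le> 1"
proof -
  have "csum r (N + 1) t - csum r N t = (\<Sum>i\<in>{0..<p * q}. if i = N + 1 then b i * w ((t - r * i) mod (p * q)) else 0)"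
    unfolding csum_def sum_subtractf [symmetric] by (intro sum.cong refl) auto
  also have "\<bar>\<dots>\<bar> \<le> 1" by (auto simp: b_def w_def)
  finally show ?thesis .
qed

lemma cyclotomic_coeff_set:
  fixes P Q R :: nat
  assumes primes: "prime P" "prime Q" "prime R" and PQ: "p = int P" "q = int Q" "P < Q" and R: "P * Q < R"
    and bounds: "\<And>N t. sg - p \<le> csum (int R) N t" "\<And>N t. csum (int R) N t \<le> sg"
    and max: "csum (int R) (int N1) t1 = sg" and min: "csum (int R) (int N2) t2 = sg - p"
  shows "{cyclotomic_coeff (P * Q * R) k | k. k \<ge> 0} = of_int ` {sg - p..sg}"
proof (intro equalityI subsetI)
  fix x assume "x \<in> {cyclotomic_coeff (P * Q * R) k | k. k \<ge> 0}"
  thus "x \<in> of_int ` {sg - p..sg}"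
    using cyclotomic_coeff_ternary[OF primes PQ R] bounds by auto
next
  fix x :: complex assume "x \<in> of_int ` {sg - p..sg}"
  then obtain v where v: "x = of_int v" "sg - p \<le> v" "v \<le> sg" by auto
  have "w y \<in> {-1, 0, 1}" for y by (auto simp: w_def)
  hence c0: "- 1 \<le> csum (int R) 0 t" "csum (int R) 0 t \<le> 1" for t
    unfolding csum_0 by (metis insertE singletonD order.refl neg_le_0_iff_le zero_le_one neg_le_iff_le order.trans)+
  have step: "\<bar>csum (int R) (int (i + 1)) t - csum (int R) (int i) t\<bar> \<le> 1" for i t
    using csum_step[of "int R" "int i" t] by (simp add: add.commute)
  have "\<exists>N t. csum (int R) (int N) t = v"
  proof -
    consider "v = 0" | "v \<ge> 1" | "v \<le> - 1" by linarith
    thus ?thesis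
    proof cases
      \<comment> \<open>A path from 1 up to the maximum, or from - 1 down to the minimum, may miss
        0, so 0 gets its own witness: N = 0 at the residue p, just after the first window of
        \<open>w\<close>.\<close>
      case 1
      have "1 * p < q * p" using PQ pq_pos sg by (intro mult_strict_right_mono) auto
      hence "p mod (p * q) = p" using pq_pos by (simp add: mult.commute)
      moreover have "w p = 0" unfolding w_def using PQ by simp
      ultimately have "csum (int R) (int 0) p = v" using 1 by (simp only: csum_0 of_nat_0)
      thus ?thesis by blast
    next
      case 2
      have "\<exists>i\<le>N1. csum (int R) (int i) t1 = v"
        using step c0[of t1] 2 v max by (intro nat0_intermed_int_val) auto
      thus ?thesis by blast
    next
      case 3
      have "\<exists>i\<le>N2. - csum (int R) (int i) t2 = - v"
        using step[of _ t2] c0[of t2] 3 v min by (intro nat0_intermed_int_val) (auto simp: abs_minus_commute)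
      thus ?thesis by auto
    qed
  qed
  then obtain N t where Nt: "csum (int R) (int N) t = v" by blast
  \<comment> \<open>The remainder that puts R * N + m in the class of t; since m < PQ < R, the
    quotient by R remains N.\<close>
  define m where "m = nat ((t - int (R * N)) mod (p * q))"
  have m0: "int m = (t - int (R * N)) mod (p * q)" using pq_pos by (simp add: m_def)
  have "int m < p * q" unfolding m0 using pq_pos by simp
  hence "m < R" using R PQ by (simp flip: of_nat_mult)
  hence n: "(R * N + m) div R = N" using R by simp
  have "[int (R * N + m) = t] (mod p * q)"
    by (simp add: m0 cong_def mod_add_right_eq)
  hence "csum (int R) (int ((R * N + m) div R)) (int (R * N + m)) = v"
    unfolding n using Nt csum_cong by metis
  hence "cyclotomic_coeff (P * Q * R) (R * N + m) = x"
    using cyclotomic_coeff_ternary[OF primes PQ R, of "R * N + m"] v(1) by simp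
  thus "x \<in> {cyclotomic_coeff (P * Q * R) k | k. k \<ge> 0}" by blast
qed

end

section \<open>Choice of the parameters\<close>

text \<open>d is the absolutely least residue of 2 / (l + 2) modulo p up to the sign \<epsilon>. If
  d \<le> l + 1, the positive number d (l + 2) - 2 \<epsilon> is at most l^2 + 3l + 4 and cannot be
  a multiple of p: here the bound on p is used to the last unit.\<close>

lemma small_residue_exists:
  fixes l p :: int
  assumes l: "1 \<le> l" "odd l" and p: "prime p" "l ^ 2 + 3 * l + 5 \<le> p"
  obtains d \<epsilon> :: int where "\<epsilon> = 1 \<or> \<epsilon> = - 1" "l + 2 \<le> d" "2 * d \<le> p - l - 2" "p dvd d * (l + 2) - 2 * \<epsilon>"
proof -
  have l2: "0 \<le> l ^ 2" by simp
  have podd: "odd p" using p l l2 prime_odd_int[of p] by linarith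
  have lp: "\<not> p dvd l + 2" using l p l2 zdvd_not_zless[of "l + 2" p] by linarith
  obtain x where x: "[(l + 2) * x = 1] (mod p)"
    using cong_solve_coprime_int[of "l + 2" p] prime_imp_coprime[OF p(1) lp] by (auto simp: coprime_commute)
  define y where "y = (2 * x) mod p"
  have "[y * (l + 2) = (2 * x) * (l + 2)] (mod p)"
    unfolding y_def by (intro cong_scalar_right) (simp add: cong_def)
  also have "(2 * x) * (l + 2) = 2 * ((l + 2) * x)" by simp
  also have "[2 * ((l + 2) * x) = 2 * 1] (mod p)" using x by (rule cong_scalar_left)
  finally have ydvd: "p dvd y * (l + 2) - 2" by (simp add: cong_iff_dvd_diff)
  have "0 < p" using l p l2 by linarith
  hence y: "0 \<le> y" "y < p" by (simp_all add: y_def)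
  obtain d \<epsilon> :: int where d: "\<epsilon> = 1 \<or> \<epsilon> = - 1" "0 \<le> d" "2 * d \<le> p - 1" "p dvd d * (l + 2) - 2 * \<epsilon>"
  proof (cases "2 * y \<le> p - 1")
    case True
    thus ?thesis using that[of 1 y] ydvd y by simp
  next
    case False
    have "(p - y) * (l + 2) - 2 * (- 1) = p * (l + 2) - (y * (l + 2) - 2)" by (simp add: algebra_simps)
    hence "p dvd (p - y) * (l + 2) - 2 * (- 1)" using ydvd by (metis dvd_diff dvd_triv_left)
    moreover have "2 * (p - y) \<le> p - 1" using False podd by presburger
    ultimately show ?thesis using that[of "- 1" "p - y"] y by simp
  qed
  have small: False if "p dvd z" "z \<noteq> 0" "- p < z" "z < p" for z
    using that by (metis abs_less_iff dvd_imp_le_int linorder_not_less abs_of_nonneg minus_less_iff dual_order.strict_trans2 abs_ge_zero le_cases)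
  have "l + 2 \<le> d"
  proof (rule ccontr)
    assume "\<not> l + 2 \<le> d"
    hence "d * (l + 2) \<le> (l + 1) * (l + 2)" using l by (intro mult_right_mono) auto
    also have "\<dots> = l ^ 2 + 3 * l + 2" by (simp add: algebra_simps power2_eq_square)
    finally have up: "d * (l + 2) - 2 * \<epsilon> < p" using p(2) d(1) by linarith
    have "d \<noteq> 0"
    proof
      assume "d = 0"
      hence "p dvd 2 * \<epsilon>" using d(4) by simp
      moreover have "2 < p" using p(2) l l2 by linarith
      ultimately show False using small[of "2 * \<epsilon>"] d(1) by auto
    qed
    hence "1 * (l + 2) \<le> d * (l + 2)" using d(2) l by (intro mult_right_mono) auto
    hence "l + 2 \<le> d * (l + 2)" by (simp only: mult_1)
    moreover have "2 * \<epsilon> \<le> 2" using d(1) by auto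
    ultimately have "0 < d * (l + 2) - 2 * \<epsilon>" using l by linarith
    thus False using small[OF d(4)] up l p l2 by linarith
  qed
  moreover have "2 * d \<le> p - l - 2"
  proof (rule ccontr)
    assume *: "\<not> 2 * d \<le> p - l - 2"
    \<comment> \<open>For d close to p / 2, doubling turns the congruence into one for the small
      number j. As j is odd and below l + 2 with l odd, j \<le> l; then j (l + 2) + 4 \<epsilon> is
      odd, hence nonzero, and too small for a multiple of p.\<close>
    define j where "j = p - 2 * d"
    have j: "1 \<le> j" "j \<le> l" using * d(3) podd l(2) unfolding j_def by presburger+
    have "p dvd p * (l + 2) - 2 * (d * (l + 2) - 2 * \<epsilon>)"
      by (rule dvd_diff[OF dvd_triv_left dvd_mult[OF d(4)]])
    moreover have "p * (l + 2) - 2 * (d * (l + 2) - 2 * \<epsilon>) = j * (l + 2) + 4 * \<epsilon>"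
      by (simp add: j_def algebra_simps)
    ultimately have dvd: "p dvd j * (l + 2) + 4 * \<epsilon>" by (simp only:)
    have "j * (l + 2) \<le> l * (l + 2)" using j l by (intro mult_right_mono) auto
    also have "\<dots> = l ^ 2 + 2 * l" by (simp add: algebra_simps power2_eq_square)
    finally have "j * (l + 2) + 4 * \<epsilon> < p" using p(2) d(1) l by linarith
    moreover have "1 * (l + 2) \<le> j * (l + 2)" using j l by (intro mult_right_mono) auto
    hence "l + 2 \<le> j * (l + 2)" by (simp only: mult_1)
    hence "- p < j * (l + 2) + 4 * \<epsilon>" using d(1) l p(2) l2 by linarith
    moreover have "odd (j * (l + 2) + 4 * \<epsilon>)" using l(2) podd by (simp add: j_def)
    hence "j * (l + 2) + 4 * \<epsilon> \<noteq> 0" by (metis even_zero)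
    ultimately show False using small[OF dvd] by blast
  qed
  ultimately show ?thesis using that d by blast
qed

text \<open>
  \<open>\<kappa>\<close> is the floor of \<open>v * q / ((v + d) * p)\<close>: for large \<open>q\<close> the conditions below say that
  \<open>1 - \<kappa> * p / q\<close> lies in an open interval that contains \<open>d / (v + d)\<close>.
\<close>

lemma step_size_exists:
  fixes p q v d l :: int
  assumes v: "0 < v" "d \<le> v" and d: "0 \<le> l" "l + 2 \<le> d" and p: "v + d \<le> p" and q: "p ^ 3 \<le> q"
  obtains \<kappa> where "0 < \<kappa>" "\<kappa> * p < q" "\<kappa> * p * (v + l + 1) \<le> v * q" "(q - \<kappa> * p) * (v + l + 1) < d * q"
    "(q - \<kappa> * p) * (v + d - 1) < d * q" "d * q * (\<kappa> * p) \<le> (q - \<kappa> * p) * ((v + l + 2) * q - 1)"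
proof -
  define T where "T = v + d"
  have T: "0 < T" "T \<le> p" "0 < p" using v d p by (auto simp: T_def)
  have qbig: "T * T * p \<le> q"
  proof -
    have "T * T * p \<le> p * p * p" using T by (intro mult_mono) auto
    thus ?thesis using q by (simp add: power3_eq_cube)
  qed
  have "1 * (T * p) \<le> T * (T * p)" using T by (intro mult_right_mono) auto
  hence qbig2: "T * p \<le> q" using qbig by (simp add: mult.assoc)
  have Tp: "0 < T * p" using T by simp
  have qpos: "0 < q" using qbig2 Tp by linarith
  define \<kappa> where "\<kappa> = (v * q) div (T * p)"
  define K where "K = \<kappa> * p"
  have "v * q mod (T * p) = v * q - \<kappa> * (T * p)"
    unfolding \<kappa>_def by (metis minus_div_mult_eq_mod)
  hence KT: "K * T \<le> v * q" "v * q < K * T + T * p"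
    using pos_mod_sign[OF Tp, of "v * q"] pos_mod_bound[OF Tp, of "v * q"] by (auto simp: K_def mult_ac)
  have "1 * q \<le> v * q" using v qpos by (intro mult_right_mono) auto
  hence "T * p \<le> v * q" using qbig2 by linarith
  hence \<kappa>pos: "0 < \<kappa>" using Tp by (simp add: \<kappa>_def pos_imp_zdiv_pos_iff)
  hence Kpos: "0 < K" using T by (simp add: K_def)
  have "v * q < T * q" using d qpos by (simp add: T_def)
  hence "K * T < q * T" using KT(1) by (simp add: mult.commute)
  hence Kq: "K < q" using T by simp
  define E where "E = q - K"
  have ET: "d * q \<le> E * T" "E * T < d * q + T * p"
    using KT by (auto simp: E_def T_def algebra_simps)
  \<comment> \<open>The size of q pays off here: once E \<ge> T * p, the rounding error T * p in E *
    T is repaid by passing from T to T - 1.\<close>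
  have "T * p * T \<le> E * T"
  proof -
    have "T * p * T = T * T * p" by simp
    also have "\<dots> \<le> 1 * q" using qbig by simp
    also have "\<dots> \<le> d * q" using d qpos by (intro mult_right_mono) auto
    finally show ?thesis using ET(1) by linarith
  qed
  hence "T * p \<le> E" using T by (simp add: mult.commute)
  hence E1: "E * (T - 1) < d * q" using ET(2) by (simp add: algebra_simps)
  have le: "v + l + 1 \<le> T - 1" using d by (simp add: T_def)
  have "E * (v + l + 1) \<le> E * (T - 1)" using le Kq by (intro mult_left_mono) (auto simp: E_def)
  hence E3: "E * (v + l + 1) < d * q" using E1 by linarith
  have "K * (v + l + 1) \<le> K * T" using le Kpos by (intro mult_left_mono) auto
  hence K3: "K * (v + l + 1) \<le> v * q" using KT(1) by linarith
  \<comment> \<open>Multiplied by T, the claim follows from K * T \<le> v * q and d * q \<le> E * T;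
    the surplus (l + 2) * q absorbs the - 1.\<close>
  have "(d * q * K) * T \<le> (E * ((v + l + 2) * q - 1)) * T"
  proof -
    have "(d * q * K) * T = d * q * (K * T)" by simp
    also have "\<dots> \<le> d * q * (v * q)" using KT(1) d qpos by (intro mult_left_mono) auto
    also have "\<dots> \<le> d * q * ((v + l + 2) * q - 1)"
    proof (intro mult_left_mono)
      have "1 * 1 \<le> (l + 2) * q" using d qpos by (intro mult_mono) auto
      thus "v * q \<le> (v + l + 2) * q - 1" by (simp add: algebra_simps)
    qed (use d qpos in auto)
    also have "\<dots> \<le> E * T * ((v + l + 2) * q - 1)"
    proof (rule mult_right_mono[OF ET(1)])
      have "1 * 1 \<le> (v + l + 2) * q" using v d qpos by (intro mult_mono) auto
      thus "0 \<le> (v + l + 2) * q - 1" by simp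
    qed
    finally show ?thesis by (simp add: mult_ac)
  qed
  hence "d * q * K \<le> E * ((v + l + 2) * q - 1)" using T by simp
  thus ?thesis using that[of \<kappa>] \<kappa>pos Kq K3 E3 E1 by (simp add: K_def E_def T_def)
qed

text \<open>The choices depend on each other in one order: d and \<epsilon> come from l and p, then
  q is taken inverse to \<open>sg\<close> modulo p and beyond both M and p^3, \<kappa> depends on q,
  and r is taken inverse to s modulo \<open>p * q\<close>. The parameter M serves to make the
  sequence of q increase.\<close>

lemma optimal_pair_exists:
  fixes l p M :: nat
  assumes l: "l \<ge> 1" "odd l" and p: "prime p" "p \<ge> l ^ 2 + 3 * l + 5"
  shows "\<exists>q r. prime q \<and> prime r \<and> M < q \<and> p < q \<and> p * q < r \<and>
    {cyclotomic_coeff (p * q * r) k | k. k \<ge> 0} =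
         of_int ` {m :: int. - ((real p - real l - 2) / 2) \<le> real_of_int m \<and>
                             real_of_int m \<le> (real p + real l + 2) / 2}"
proof -
  have p': "prime (int p)" "int l ^ 2 + 3 * int l + 5 \<le> int p"
  proof -
    show "prime (int p)" using p(1) by simp
    have "int (l ^ 2 + 3 * l + 5) \<le> int p" using p(2) by (simp only: of_nat_le_iff)
    thus "int l ^ 2 + 3 * int l + 5 \<le> int p" by simp
  qed
  have l': "1 \<le> int l" "odd (int l)" using l by auto
  have l2: "0 \<le> int l ^ 2" by simp
  obtain d \<epsilon> :: int where \<epsilon>: "\<epsilon> = 1 \<or> \<epsilon> = - 1"
    and d: "int l + 2 \<le> d" "2 * d \<le> int p - int l - 2" "int p dvd d * (int l + 2) - 2 * \<epsilon>"
    by (rule small_residue_exists[OF l' p'])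
  have podd: "odd p" using p l prime_odd_nat[of p] by (cases "p = 2") auto
  define sg where "sg = (int p + int l + 2) div 2"
  have "even (int p + int l + 2)" using podd l(2) by simp
  hence sg2: "2 * sg = int p + int l + 2" by (simp add: sg_def)
  have sg: "0 < sg" "sg < int p" using sg2 p' l l2 by linarith+
  define v where "v = int p - sg"
  have v: "0 < v" "d \<le> v" "v + d \<le> int p" "sg = v + int l + 2"
    using sg sg2 d by (auto simp: v_def)
  \<comment> \<open>2 * sg is congruent to l + 2 modulo p, so this is the congruence for d divided
    by 2, which is invertible because p is odd.\<close>
  have dsg: "[d * sg = \<epsilon>] (mod int p)"
  proof -
    have "2 * (d * sg - \<epsilon>) = int p * d + (d * (int l + 2) - 2 * \<epsilon>)"
      using sg2 by (simp add: algebra_simps)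
    hence "int p dvd 2 * (d * sg - \<epsilon>)" using d(3) by (metis dvd_add dvd_triv_left)
    moreover have "coprime (int p) 2" using podd by simp
    ultimately have "int p dvd d * sg - \<epsilon>" by (simp only: coprime_dvd_mult_right_iff)
    thus ?thesis by (simp add: cong_iff_dvd_diff)
  qed
  have "\<not> p dvd nat sg" using sg by (auto dest: dvd_imp_le)
  hence "coprime (nat sg) p" using p(1) prime_imp_coprime coprime_commute by blast
  then obtain a where a: "[nat sg * a = 1] (mod p)" using cong_solve_coprime_nat by auto
  have "coprime a p" using a by (metis coprime_iff_invertible_nat mult.commute One_nat_def)
  hence "infinite {q. prime q \<and> [q = a] (mod p)}"
    using p(1) by (intro dirichlet_squarefree_modulus squarefree_prime)
  then obtain q where q: "prime q" "[q = a] (mod p)" "M + p ^ 3 < q"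
    unfolding infinite_nat_iff_unbounded by blast
  have "p ^ 1 \<le> p ^ 3" using p by (intro power_increasing) auto
  hence pq: "p < q" "M < q" using q(3) by auto
  have "[nat sg * q = 1] (mod p)" using q(2) a by (metis cong_scalar_left cong_trans)
  hence "[int (nat sg * q) = int 1] (mod int p)" by (simp only: cong_int_iff)
  hence "int p dvd sg * int q - 1" using sg by (simp add: cong_iff_dvd_diff)
  then obtain k where k: "sg * int q - 1 = int p * k" by blast
  define pb where "pb = int q - k"
  have bez: "int p * pb + int q * sg = int p * int q + 1"
    using k by (simp add: pb_def algebra_simps)
  have ppb: "int p * pb = v * int q + 1" using bez by (simp add: v_def algebra_simps)
  have qpos: "0 < int q" using q by (simp add: prime_gt_0_nat)
  have "0 < int p * pb" using ppb v qpos by simp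
  hence pb0: "0 < pb" using p by (simp add: zero_less_mult_iff)
  have "1 * 2 \<le> sg * int q"
    using sg q(1) by (intro mult_mono) (auto dest: prime_ge_2_nat)
  hence "int p * pb < int p * int q" using bez by (simp add: mult.commute)
  hence pbq: "pb < int q" using p by (simp add: prime_gt_0_nat)
  interpret binary_pair "int p" "int q" pb sg
    using bez pb0 pbq sg by unfold_locales
  have q3: "int p ^ 3 \<le> int q" using q(3) by (simp flip: of_nat_power)
  obtain \<kappa> where \<kappa>: "0 < \<kappa>" "\<kappa> * int p < int q" "\<kappa> * int p * (v + int l + 1) \<le> v * int q"
    "(int q - \<kappa> * int p) * (v + int l + 1) < d * int q"
    "(int q - \<kappa> * int p) * (v + d - 1) < d * int q"
    "d * int q * (\<kappa> * int p) \<le> (int q - \<kappa> * int p) * ((v + int l + 2) * int q - 1)"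
    by (rule step_size_exists[OF v(1,2) of_nat_0_le_iff d(1) v(3) q3])
  define \<rho> where "\<rho> = int p - d"
  have \<rho>: "sg \<le> \<rho>" "\<rho> < int p" "int p \<le> \<rho> + sg" using v(2,4) d(1) l' unfolding \<rho>_def v_def by linarith+
  \<comment> \<open>Chinese remaindering: q * sg and p * pb are the idempotents modulo
    \<open>p * q\<close>. The residue \<rho> modulo p makes \<beta> move by steps of \<epsilon>, and
    the residue modulo q prescribes the slope \<kappa>.\<close>
  define s where "s = \<rho> * (int q * sg) + \<epsilon> * (\<kappa> * int p) * (int p * pb)"
  have sp: "[s = \<rho>] (mod int p)"
  proof -
    have "[s = \<rho> * 1 + 0] (mod int p)"
      unfolding s_def by (intro cong_add cong_mult cong_refl cong_sg) (simp add: cong_def)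
    thus ?thesis by simp
  qed
  have sq: "[s = \<epsilon> * (\<kappa> * int p)] (mod int q)"
  proof -
    have "[s = 0 + \<epsilon> * (\<kappa> * int p) * 1] (mod int q)"
      unfolding s_def by (intro cong_add cong_mult cong_refl cong_pb) (simp add: cong_def)
    thus ?thesis by simp
  qed
  have smod: "s mod int p = \<rho>" using sp \<rho> sg by (simp add: cong_def)
  have ssg: "[s * sg = - \<epsilon>] (mod int p)"
  proof -
    have "[s * sg = \<rho> * sg] (mod int p)" using sp by (rule cong_scalar_right)
    also have "\<rho> * sg = int p * sg - d * sg" by (simp add: \<rho>_def left_diff_distrib)
    also have "[int p * sg - d * sg = 0 - \<epsilon>] (mod int p)"
      by (intro cong_diff dsg) (simp add: cong_def)
    finally show ?thesis by simp
  qed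
  have cop: "coprime s (int p * int q)"
  proof -
    have "\<not> int p dvd \<rho>" using \<rho> sg by (auto dest: zdvd_imp_le)
    hence "coprime \<rho> (int p)" using p'(1) prime_imp_coprime coprime_commute by blast
    hence "coprime s (int p)" using sp cong_imp_coprime cong_sym by blast
    moreover have "coprime s (int q)"
    proof -
      have pq': "prime (int q)" using q(1) by simp
      have "\<not> int q dvd int p" using pq p by (auto dest!: zdvd_imp_le simp: prime_gt_0_nat)
      moreover have "\<kappa> * 1 \<le> \<kappa> * int p" using \<kappa>(1) p by (intro mult_left_mono) (auto simp: prime_gt_0_nat Suc_leI)
      hence "\<kappa> \<le> \<kappa> * int p" by (simp only: mult.right_neutral)
      hence "\<kappa> < int q" using \<kappa>(2) by linarith
      hence "\<not> int q dvd \<kappa>" using \<kappa>(1) by (auto dest!: zdvd_imp_le)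
      moreover have "\<not> int q dvd \<epsilon>" using \<epsilon> pq' by auto
      ultimately have "\<not> int q dvd \<epsilon> * (\<kappa> * int p)" using pq' by (simp add: prime_dvd_mult_iff)
      hence "coprime (\<epsilon> * (\<kappa> * int p)) (int q)" using pq' prime_imp_coprime coprime_commute by blast
      thus ?thesis using sq cong_imp_coprime cong_sym by blast
    qed
    ultimately show ?thesis by simp
  qed
  then obtain r0 where r0: "[s * r0 = 1] (mod int p * int q)" using cong_solve_coprime_int by blast
  define r1 where "r1 = nat (r0 mod (int p * int q))"
  have r1: "[int r1 = r0] (mod int p * int q)"
    using pq_pos by (simp add: r1_def cong_def)
  have "[int r1 * s = r0 * s] (mod int p * int q)" using r1 by (rule cong_scalar_right)
  hence r1s: "[int r1 * s = 1] (mod int p * int q)" using r0 by (metis cong_trans mult.commute)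
  hence "coprime (int r1) (int p * int q)" by (metis coprime_iff_invertible_int)
  hence "coprime r1 (p * q)" by (simp flip: of_nat_mult)
  moreover have "squarefree (p * q)"
    using p(1) q(1) pq(1) by (intro squarefree_mult_coprime squarefree_prime primes_coprime) auto
  ultimately have "infinite {r. prime r \<and> [r = r1] (mod p * q)}"
    by (intro dirichlet_squarefree_modulus)
  then obtain r where r: "prime r" "[r = r1] (mod p * q)" "p * q < r"
    unfolding infinite_nat_iff_unbounded by blast
  have "[int r = int r1] (mod int p * int q)" using r(2) by (simp flip: of_nat_mult add: cong_int_iff)
  hence rs: "[int r * s = 1] (mod int p * int q)" using r1s by (metis cong_scalar_right cong_trans)
  have pq2: "int p < int q" "2 \<le> int p" using pq p(1) by (auto dest: prime_ge_2_nat)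
  have Ds: "D s N \<alpha> \<beta> = D \<rho> N \<alpha> \<beta>" for N \<alpha> \<beta>
    unfolding D_def smod [symmetric] by (simp add: mod_diff_right_eq)
  have w2: "int p < 2 * sg" using sg2 by simp
  have pr: "int p - \<rho> = d" "int p - sg = v" "sg - 1 = v + int l + 1" "2 * int p - sg - \<rho> - 1 = v + d - 1"
    using v(4) by (simp_all add: \<rho>_def v_def)
  have k3: "\<kappa> * int p * (sg - 1) \<le> (int p - sg) * int q" using \<kappa>(3) by (simp only: pr)
  have k4: "(int q - \<kappa> * int p) * (sg - 1) < (int p - \<rho>) * int q" using \<kappa>(4) by (simp only: pr)
  have k5: "(int q - \<kappa> * int p) * (2 * int p - sg - \<rho> - 1) < (int p - \<rho>) * int q"
    using \<kappa>(5) by (simp only: pr)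
  have k6: "(int p - \<rho>) * int q * (\<kappa> * int p) \<le> (int q - \<kappa> * int p) * (sg * int q - 1)"
    using \<kappa>(6) by (simp only: pr v(4) [symmetric])
  obtain t1 where "csum (int r) ((sg - 1) * int q) t1 =
      (\<Sum>\<beta>\<in>{0..<int p}. D s ((sg - 1) * int q) ((\<kappa> * (sg - 1) - \<kappa> * \<beta>) mod int q) \<beta>)"
    using csum_on_line[OF rs pq2 \<epsilon> ssg sq] by blast
  also have "\<dots> = (\<Sum>\<beta>\<in>{0..<int p}. if \<beta> < sg then 1 else 0)"
    unfolding Ds by (intro sum.cong refl D_max_line[OF \<rho> w2 \<kappa>(1,2) k3 k4]) auto
  also have "\<dots> = sg" by (rule sum_indicator)
  finally have max: "csum (int r) (int (nat ((sg - 1) * int q))) t1 = sg" using sg by simp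
  obtain t2 where "csum (int r) ((int p - sg - 1) * int q + 1) t2 =
      (\<Sum>\<beta>\<in>{0..<int p}. D s ((int p - sg - 1) * int q + 1) ((pb + \<kappa> * (int p - 1) - \<kappa> * \<beta>) mod int q) \<beta>)"
    using csum_on_line[OF rs pq2 \<epsilon> ssg sq] by blast
  also have "\<dots> = (\<Sum>\<beta>\<in>{0..<int p}. if \<beta> < sg then 0 else - 1)"
    unfolding Ds by (intro sum.cong refl D_min_line[OF \<rho> w2 \<kappa>(1,2) k5 k6]) auto
  also have "\<dots> = sg - int p" by (rule sum_indicator)
  finally have min: "csum (int r) (int (nat ((int p - sg - 1) * int q + 1))) t2 = sg - int p"
    using sg by simp
  have "{cyclotomic_coeff (p * q * r) k | k. k \<ge> 0} = of_int ` {sg - int p..sg}"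
    by (rule cyclotomic_coeff_set[OF p(1) q(1) r(1) refl refl pq(1) r(3) _ _ max min])
       (rule csum_bounds[OF rs pq2 smod \<rho>(1,3)])+
  also have "{sg - int p..sg} = {m. - ((real p - real l - 2) / 2) \<le> real_of_int m \<and> real_of_int m \<le> (real p + real l + 2) / 2}"
  proof -
    have "2 * real_of_int sg = real p + real l + 2" using arg_cong[OF sg2, of real_of_int] by simp
    hence "(real p + real l + 2) / 2 = real_of_int sg"
      "- ((real p - real l - 2) / 2) = real_of_int (sg - int p)" by (simp_all add: field_simps)
    thus ?thesis by (simp only: of_int_le_iff atLeastAtMost_def atLeast_def atMost_def Collect_conj_eq)
  qed
  finally show ?thesis using q r pq by blast
qed

theorem theorem1:
  fixes l p :: nat
  assumes "l \<ge> 1" and "odd l"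
    and "prime p" and "p \<ge> l^2 + 3 * l + 5"
  shows "\<exists>q r :: nat \<Rightarrow> nat.
    (\<forall>j. prime (q j) \<and> prime (r j) \<and> p < q j \<and> p * q j < r j \<and> q j < q (Suc j) \<and>
       {cyclotomic_coeff (p * q j * r j) k | k. k \<ge> 0} =
         of_int ` {m :: int. - ((real p - real l - 2) / 2) \<le> real_of_int m \<and>
                             real_of_int m \<le> (real p + real l + 2) / 2})"
proof -
  define good where "good = (\<lambda>(q, r). prime q \<and> prime r \<and> p < q \<and> p * q < r \<and>
       {cyclotomic_coeff (p * q * r) k | k. k \<ge> 0} =
         of_int ` {m :: int. - ((real p - real l - 2) / 2) \<le> real_of_int m \<and>
                             real_of_int m \<le> (real p + real l + 2) / 2})"
  \<comment> \<open>Applied to the previous q as M, this yields the strictly increasing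
    sequence.\<close>
  have ex: "\<exists>x. good x \<and> M < fst x" for M
    using optimal_pair_exists[OF assms, of M] by (auto simp: good_def)
  obtain f where f: "\<And>j. good (f j) \<and> fst (f j) < fst (f (Suc j))"
    using dependent_nat_choice[of "\<lambda>_. good" "\<lambda>_ x y. fst x < fst y"] ex by blast
  show ?thesis
  proof (intro exI allI)
    fix j
    show "prime (fst (f j)) \<and> prime (snd (f j)) \<and> p < fst (f j) \<and> p * fst (f j) < snd (f j) \<and>
       fst (f j) < fst (f (Suc j)) \<and> {cyclotomic_coeff (p * fst (f j) * snd (f j)) k | k. k \<ge> 0} =
         of_int ` {m :: int. - ((real p - real l - 2) / 2) \<le> real_of_int m \<and>
                             real_of_int m \<le> (real p + real l + 2) / 2}"
      using f[of j] unfolding good_def case_prod_beta by blast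
  qed
qed

end
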